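(* Consider the majority process on the regular tree of degree $k$ with unbiased i.i.d. initialization ($\theta=0$). Then for any vertex $i\in\mathcal V$ and any integer $T\ge 0$, $$\big(\sigma_i(0),\sigma_i(1),\dots,\sigma_i(T)\big)\ \xrightarrow{d}\ \big(\tau(0),\tau(1),\dots,\tau(T)\big)\qquad\text{as }k\to\infty,$$ where $\{\tau(t)\}_{t\ge0}$ is distributed according to the cavity process.
   Context: Majority process. Let $\mathcal G=(\mathcal V,\mathcal E)$ be the infinite regular tree of degree $k\ge 2$, and let $\partial i$ be the set of neighbors of $i\in\mathcal V$. Each vertex carries a spin $\sigma_i(t)\in\{-1,+1\}$, $t=0,1,2,\dots$. All spins are updated synchronously: if $\sum_{j\in\partial i}\sigma_j(t)\neq 0$ then $\sigma_i(t+1)=\mathrm{sign}\big(\sum_{j\in\partial i}\sigma_j(t)\big)$; if $\sum_{j\in\partial i}\sigma_j(t)=0$ then $\sigma_i(t+1)=\pm\sigma_i(t)$ with probability $1/2$ each. The tie-breaking coins are independent across vertices and times and independent of the initial configuration. The initial spins are i.i.d. with $\mathbb P_\theta\{\sigma_i(0)=+1\}=(1+\theta)/2$. Effective process. Let $C=\{C(t,s)\}_{t,s\in\mathbb Z_+}$ be a positive definite symmetric matrix, and $R=\{R(t,s)\}_{t>s\ge0}$, $h=\{h(t)\}_{t\in\mathbb Z_+}$ arbitrary real numbers. The effective process with parameters $C,R,h$ is generated as follows: $\tau(0)$ is uniform on $\{-1,+1\}$; $\{\eta(t)\}_{t\in\mathbb Z_+}$ are jointly Gaussian with mean zero and covariance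 $C$, independent of $\tau(0)$; and for $t\ge 0$ $$\tau(t+1)=\mathrm{sign}\Big(\eta(t)+\sum_{s=0}^{t-1}R(t,s)\tau(s)+h(t)\Big).$$ Expectation with respect to it is denoted $\mathbb E_{C,R,h}$. Cavity process. $C,R$ are called consistent if $C(t,s)=\mathbb E_{C,R,0}[\tau(t)\tau(s)]$ for all $t,s\ge0$ and $R(t,s)=\frac{\partial}{\partial h(s)}\mathbb E_{C,R,h}[\tau(t)]\big|_{h=0}$ for all $0\le s<t$. There is a unique consistent pair $C,R$; the cavity process $\{\tau(t)\}_{t\ge0}$ is the effective process with this consistent pair and $h=0$. *)

theory Defs
  imports "HOL-Probability.Probability"
begin

section \<open>The regular tree\<close>

definition neighbors :: "('v \<Rightarrow> 'v \<Rightarrow> bool) \<Rightarrow> 'v \<Rightarrow> 'v set" where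
  "neighbors adj i = {j. adj i j}"

locale regular_tree =
  fixes k :: nat and V :: "'v set" and adj :: "'v \<Rightarrow> 'v \<Rightarrow> bool"
  assumes infinite_vertices: "infinite V"
    and adj_vertices: "adj u v \<Longrightarrow> u \<in> V \<and> v \<in> V"
    and adj_sym: "adj u v \<Longrightarrow> adj v u"
    and adj_irrefl: "\<not> adj u u"
    and connected: "u \<in> V \<Longrightarrow> v \<in> V \<Longrightarrow> adj\<^sup>*\<^sup>* u v"
    and no_cycle: "3 \<le> length p \<Longrightarrow> distinct p \<Longrightarrow> successively adj p \<Longrightarrow> \<not> adj (last p) (hd p)"
    and finite_neighbors: "u \<in> V \<Longrightarrow> finite (neighbors adj u)"
    and regular: "u \<in> V \<Longrightarrow> card (neighbors adj u) = k"

section \<open>The majority process\<close>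

text \<open>
  Spins are real-valued; \<open>\<sigma> i t\<close> is the spin of vertex \<open>i\<close> at time \<open>t\<close>, and \<open>\<xi> i t\<close> is the
  uniform sign that multiplies \<open>\<sigma> i t\<close> if there is a tie among the neighbors of \<open>i\<close> at time \<open>t\<close>.
  The family in \<open>independent\<close> consists of all initial spins (left summand) and all coins
  (right summand).
\<close>

locale majority_process = prob_space M
  for V :: "'v set" and adj :: "'v \<Rightarrow> 'v \<Rightarrow> bool" and \<theta> :: real and M :: "'w measure" +
  fixes \<sigma> :: "'v \<Rightarrow> nat \<Rightarrow> 'w \<Rightarrow> real" and \<xi> :: "'v \<Rightarrow> nat \<Rightarrow> 'w \<Rightarrow> real"
  assumes independent:
      "indep_vars (\<lambda>_. borel) (case_sum (\<lambda>i. \<sigma> i 0) (\<lambda>(i, t). \<xi> i t)) (V <+> V \<times> UNIV)"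
    and initial_values: "i \<in> V \<Longrightarrow> \<omega> \<in> space M \<Longrightarrow> \<sigma> i 0 \<omega> \<in> {-1, 1}"
    and initial_prob: "i \<in> V \<Longrightarrow> prob {\<omega> \<in> space M. \<sigma> i 0 \<omega> = 1} = (1 + \<theta>) / 2"
    and coin_values: "i \<in> V \<Longrightarrow> \<omega> \<in> space M \<Longrightarrow> \<xi> i t \<omega> \<in> {-1, 1}"
    and coin_prob: "i \<in> V \<Longrightarrow> prob {\<omega> \<in> space M. \<xi> i t \<omega> = 1} = 1 / 2"
    and update: "i \<in> V \<Longrightarrow> \<omega> \<in> space M \<Longrightarrow>
      \<sigma> i (Suc t) \<omega> =
        (if (\<Sum>j\<in>neighbors adj i. \<sigma> j t \<omega>) \<noteq> 0
         then sgn (\<Sum>j\<in>neighbors adj i. \<sigma> j t \<omega>)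
         else \<xi> i t \<omega> * \<sigma> i t \<omega>)"

section \<open>The effective process and the cavity process\<close>

definition pos_def_matrix :: "(nat \<Rightarrow> nat \<Rightarrow> real) \<Rightarrow> bool" where
  "pos_def_matrix C \<longleftrightarrow>
     (\<forall>s t. C s t = C t s) \<and>
     (\<forall>n a. (\<exists>t<n. a t \<noteq> 0) \<longrightarrow> 0 < (\<Sum>s<n. \<Sum>t<n. a s * a t * C s t))"

text \<open>
  The path \<open>\<tau>(0), \<tau>(1), \<dots>\<close> as a function of the initial value \<open>x\<close> and the path \<open>e\<close> of the
  Gaussian noise. Only \<open>R t s\<close> with \<open>s < t\<close> is used. \<open>sgn 0 = 0\<close> is harmless: for positive definite
  covariance the argument of \<open>sgn\<close> vanishes with probability zero.
\<close>

function effective_path ::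
  "(nat \<Rightarrow> nat \<Rightarrow> real) \<Rightarrow> (nat \<Rightarrow> real) \<Rightarrow> real \<Rightarrow> (nat \<Rightarrow> real) \<Rightarrow> nat \<Rightarrow> real" where
  "effective_path R h x e 0 = x"
| "effective_path R h x e (Suc t) =
     sgn (e t + (\<Sum>s<t. R t s * effective_path R h x e s) + h t)"
  by pat_completeness auto
termination
  by (relation "Wellfounded.measure (\<lambda>(R, h, x, e, t). t)") auto

text \<open>
  The randomness driving the effective process: \<open>\<tau>\<^sub>0\<close> is \<open>\<tau>(0)\<close>, and \<open>\<eta>\<close> is jointly Gaussian with
  mean zero and covariance \<open>C\<close>, i.e. every linear combination of finitely many of the \<open>\<eta> t\<close> is
  a centered normal variable with the variance prescribed by \<open>C\<close>. For nontrivial combinations this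
  variance is nonzero as \<open>C\<close> is positive definite. The assumption \<open>independent\<close> is
  \<open>indep_var\<close> for random elements of different types and includes measurability.
\<close>

locale effective_process = prob_space N for N :: "'w measure" +
  fixes \<tau>\<^sub>0 :: "'w \<Rightarrow> real" and \<eta> :: "nat \<Rightarrow> 'w \<Rightarrow> real" and C R :: "nat \<Rightarrow> nat \<Rightarrow> real"
  assumes pos_def: "pos_def_matrix C"
    and tau0_values: "\<omega> \<in> space N \<Longrightarrow> \<tau>\<^sub>0 \<omega> \<in> {-1, 1}"
    and tau0_prob: "prob {\<omega> \<in> space N. \<tau>\<^sub>0 \<omega> = 1} = 1 / 2"
    and gaussian: "(\<exists>t<n. a t \<noteq> 0) \<Longrightarrow>
      distributed N lborel (\<lambda>\<omega>. \<Sum>t<n. a t * \<eta> t \<omega>)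
        (normal_density 0 (sqrt (\<Sum>s<n. \<Sum>t<n. a s * a t * C s t)))"
    and independent: "indep_set
      (sets (vimage_algebra (space N) \<tau>\<^sub>0 borel))
      (sets (vimage_algebra (space N) (\<lambda>\<omega> t. \<eta> t \<omega>) (\<Pi>\<^sub>M t\<in>UNIV. borel)))"
begin

definition \<tau> :: "(nat \<Rightarrow> real) \<Rightarrow> nat \<Rightarrow> 'w \<Rightarrow> real" where
  "\<tau> h t \<omega> = effective_path R h (\<tau>\<^sub>0 \<omega>) (\<lambda>s. \<eta> s \<omega>) t"

end

text \<open>
  The driving variables do not involve \<open>h\<close>, so \<open>\<integral> \<tau> h t\<close> is the expectation of \<open>\<tau>(t)\<close> in the
  effective process with parameters \<open>C, R, h\<close>; it depends only on these parameters
  and not on the realization \<open>N, \<tau>\<^sub>0, \<eta>\<close>, whose joint law is determined by \<open>C\<close>.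
\<close>

locale cavity_process = effective_process +
  assumes consistent_C: "C t s = expectation (\<lambda>\<omega>. \<tau> (\<lambda>_. 0) t \<omega> * \<tau> (\<lambda>_. 0) s \<omega>)"
    and consistent_R: "s < t \<Longrightarrow>
      ((\<lambda>x. expectation (\<tau> ((\<lambda>_. 0)(s := x)) t)) has_real_derivative R t s) (at 0)"

section \<open>Convergence in distribution\<close>

text \<open>
  Convergence in distribution of random elements \<open>X k\<close>, defined on possibly different probability
  spaces, of a topological space. It is applied to \<open>nat \<Rightarrow> real\<close> with the product topology, where
  a vector with index set \<open>{0,\<dots>,T}\<close> is a function that is \<open>restrict\<close>ed to \<open>{..T}\<close>.
\<close>

definition converges_in_distribution ::
  "(nat \<Rightarrow> 'w measure) \<Rightarrow> (nat \<Rightarrow> 'w \<Rightarrow> 'b::topological_space) \<Rightarrow> 'u measure \<Rightarrow> ('u \<Rightarrow> 'b) \<Rightarrow> bool" where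
  "converges_in_distribution M X N Y \<longleftrightarrow>
     (\<forall>f :: 'b \<Rightarrow> real. continuous_on UNIV f \<longrightarrow> bounded (range f) \<longrightarrow>
        (\<lambda>k. \<integral>\<omega>. f (X k \<omega>) \<partial>M k) \<longlonglongrightarrow> (\<integral>\<omega>. f (Y \<omega>) \<partial>N))"

end

theory Submission
  imports Defs "HOL-Real_Asymp.Real_Asymp"
begin

text \<open>
  Replacing the path of the parent of a vertex by a fixed path \<open>u\<close> makes the subtrees of its
  children independent, so the law of the path of the vertex satisfies an exact recursion over the
  time horizon: given its path \<open>x\<close>, the \<open>k - 1\<close> children are i.i.d. with the law of a
  vertex whose parent follows \<open>x\<close>. As \<open>k\<close> grows, the sum of the children divided by
  \<open>sqrt k\<close> is asymptotically Gaussian with covariance \<open>C\<close>, and its mean is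
  \<open>\<Sum>s<t. R t s * x s\<close>, provided that the mean path of a child responds to its parent as
  \<open>(\<Sum>s<t. R t s * u s) / sqrt k\<close>. This response is a difference of two laws whose fields
  differ by one unit. As a function of the field at one time, the laws have second differences of order
  \<open>1 / k\<close>, so the unit difference agrees up to \<open>O(\<epsilon> / sqrt k)\<close> with the
  difference over \<open>\<epsilon> * sqrt k\<close> units divided by their number, and for the latter the
  central limit theorem gives the difference quotient that defines \<open>R\<close>.
\<close>

section \<open>Averages over independent samples\<close>

text \<open>A vertex is one of the \<open>k\<close> neighbors of each of its children and shifts the
  mean of a child by order \<open>1 / sqrt k\<close> only. All children together shift their sum by
  order \<open>sqrt k\<close>, the size of its fluctuations, so the shift survives in the limit as
  the feedback \<open>R\<close>. Hence the mean of a child is needed up to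
  \<open>o(1 / sqrt k)\<close>, while a central limit theorem is exact only up to
  \<open>o(1)\<close>. Smoothness of the laws in the field closes this gap in place of a local limit
  theorem. It comes from an integration by parts over two samples, which requires that every path
  has probability bounded below uniformly in \<open>k\<close>. Therefore limits of the laws, limits
  of the rescaled means and lower bounds on the laws go through one joint induction. Sums of
  \<open>k - 1\<close> spins live on a lattice of span two, so smoothness is available in steps of
  two, and parity relates the unit step caused by the parent to these. The consistency conditions
  enter at one place each: \<open>C\<close> as limiting covariance of a child, \<open>R\<close> as a
  derivative at zero field that is taken after \<open>k\<close> has tended to infinity.\<close>

primrec iid_mean :: "('a \<Rightarrow> real) \<Rightarrow> 'a set \<Rightarrow> nat \<Rightarrow> ('a list \<Rightarrow> real) \<Rightarrow> real" where
  "iid_mean \<nu> A 0 f = f []"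
| "iid_mean \<nu> A (Suc n) f = (\<Sum>y\<in>A. \<nu> y * iid_mean \<nu> A n (\<lambda>ys. f (y # ys)))"

lemma iid_mean_add: "iid_mean \<nu> A n (\<lambda>ys. f ys + g ys) = iid_mean \<nu> A n f + iid_mean \<nu> A n g"
  by (induction n arbitrary: f g) (simp_all add: distrib_left sum.distrib)

lemma iid_mean_cmult: "iid_mean \<nu> A n (\<lambda>ys. c * f ys) = c * iid_mean \<nu> A n f"
  by (induction n arbitrary: f) (simp_all add: sum_distrib_left mult.left_commute)

lemma iid_mean_diff: "iid_mean \<nu> A n (\<lambda>ys. f ys - g ys) = iid_mean \<nu> A n f - iid_mean \<nu> A n g"
  using iid_mean_add[of \<nu> A n f "\<lambda>ys. - 1 * g ys"] iid_mean_cmult[of \<nu> A n "- 1" g] by simp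

lemma iid_mean_sum: "iid_mean \<nu> A n (\<lambda>ys. \<Sum>i\<in>I. f i ys) = (\<Sum>i\<in>I. iid_mean \<nu> A n (f i))"
proof (induction n arbitrary: f)
  case (Suc n)
  then show ?case by (simp add: sum_distrib_left) (rule sum.swap)
qed simp

lemma iid_mean_cong:
  assumes "\<And>y. y \<in> A \<Longrightarrow> \<nu> y = \<nu>' y"
    and "\<And>ys. set ys \<subseteq> A \<Longrightarrow> length ys = n \<Longrightarrow> f ys = g ys"
  shows "iid_mean \<nu> A n f = iid_mean \<nu>' A n g"
  using assms(2) by (induction n arbitrary: f g) (simp_all add: assms(1) cong: sum.cong)

lemma iid_mean_mono:
  assumes "\<And>y. y \<in> A \<Longrightarrow> 0 \<le> \<nu> y"
    and "\<And>ys. set ys \<subseteq> A \<Longrightarrow> length ys = n \<Longrightarrow> f ys \<le> g ys"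
  shows "iid_mean \<nu> A n f \<le> iid_mean \<nu> A n g"
  using assms(2)
  by (induction n arbitrary: f g) (auto intro!: sum_mono mult_left_mono assms(1))

lemma iid_mean_prod_list: "iid_mean \<nu> A n (\<lambda>ys. prod_list (map h ys)) = (\<Sum>y\<in>A. \<nu> y * h y) ^ n"
  by (induction n) (simp_all add: iid_mean_cmult sum_distrib_right mult.assoc)

text \<open>Change of measure: a density that is a product over the samples is absorbed into the
  weights one sample at a time.\<close>

lemma iid_mean_tilt: "iid_mean \<nu> A n (\<lambda>ys. prod_list (map h ys) * f ys) = iid_mean (\<lambda>y. \<nu> y * h y) A n f"
  by (induction n arbitrary: f) (simp_all add: iid_mean_cmult mult.assoc)

lemma iid_mean_const:
  assumes "sum \<nu> A = 1"
  shows "iid_mean \<nu> A n (\<lambda>_. c) = c"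
  by (induction n) (simp_all flip: sum_distrib_right add: assms)

lemma iid_mean_nonneg:
  assumes "\<And>y. y \<in> A \<Longrightarrow> 0 \<le> \<nu> y"
    and "\<And>ys. set ys \<subseteq> A \<Longrightarrow> length ys = n \<Longrightarrow> 0 \<le> f ys"
  shows "0 \<le> iid_mean \<nu> A n f"
  using iid_mean_mono[of A \<nu> n "\<lambda>_. 0 * 0" f] assms iid_mean_cmult[of \<nu> A n 0 "\<lambda>_. 0"] by simp

lemma iid_mean_abs:
  assumes "\<And>y. y \<in> A \<Longrightarrow> 0 \<le> \<nu> y"
  shows "\<bar>iid_mean \<nu> A n f\<bar> \<le> iid_mean \<nu> A n (\<lambda>ys. \<bar>f ys\<bar>)"
proof -
  have "iid_mean \<nu> A n f \<le> iid_mean \<nu> A n (\<lambda>ys. \<bar>f ys\<bar>)"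
    and "iid_mean \<nu> A n (\<lambda>ys. (- 1) * f ys) \<le> iid_mean \<nu> A n (\<lambda>ys. \<bar>f ys\<bar>)"
    by (rule iid_mean_mono; use assms in auto)+
  then show ?thesis unfolding iid_mean_cmult by linarith
qed

section \<open>Moments of sums and pair sums, and integration by parts\<close>

abbreviation wsum :: "('a \<Rightarrow> real) \<Rightarrow> 'a list \<Rightarrow> real" where
  "wsum w ys \<equiv> sum_list (map w ys)"

text \<open>
  Weighting samples by \<open>wpair w\<close>, the sum of \<open>w y\<^sub>i * w y\<^sub>j\<close> over pairs, is a discrete
  integration by parts if \<open>w\<close> is the reciprocal of the weight at \<open>a\<close>, minus that reciprocal at
  \<open>b\<close>, and zero elsewhere: it produces second differences in the direction from \<open>b\<close> to \<open>a\<close>.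
  The number of pairs is of order \<open>n\<^sup>2\<close>, but the root mean square of \<open>wpair w\<close> only of order
  \<open>n\<close>, so these second differences are of order \<open>1 / n\<close>.
\<close>

primrec wpair :: "('a \<Rightarrow> real) \<Rightarrow> 'a list \<Rightarrow> real" where
  "wpair w [] = 0"
| "wpair w (y # ys) = wpair w ys + w y * wsum w ys"

lemma iid_mean_wsum:
  "sum \<nu> A = 1 \<Longrightarrow> iid_mean \<nu> A n (wsum w) = n * (\<Sum>y\<in>A. \<nu> y * w y)"
  by (induction n) (simp_all add: iid_mean_add iid_mean_const distrib_left sum.distrib distrib_right flip: sum_distrib_right)

lemma iid_mean_wsum_square:
  assumes "sum \<nu> A = 1" "(\<Sum>y\<in>A. \<nu> y * w y) = 0"
  shows "iid_mean \<nu> A n (\<lambda>ys. (wsum w ys)\<^sup>2) = n * (\<Sum>y\<in>A. \<nu> y * (w y)\<^sup>2)"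
proof (induction n)
  case (Suc n)
  have "iid_mean \<nu> A n (\<lambda>ys. (wsum w (y # ys))\<^sup>2) = (w y)\<^sup>2 + n * (\<Sum>y\<in>A. \<nu> y * (w y)\<^sup>2)" for y
    using iid_mean_wsum[OF assms(1), of n w] Suc assms
    by (simp add: power2_sum iid_mean_add iid_mean_const iid_mean_cmult)
  then show ?case
    using assms(1) by (simp add: distrib_left sum.distrib flip: sum_distrib_right) (simp add: algebra_simps)
qed simp

text \<open>Two different pairs leave an index that occurs only once, and averaging over that sample
  gives zero. Only the squares of the \<open>n (n - 1) / 2\<close> pairs remain, each with mean
  equal to the squared variance of \<open>w\<close>.\<close>

lemma iid_mean_wpair_square:
  assumes "sum \<nu> A = 1" "(\<Sum>y\<in>A. \<nu> y * w y) = 0"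
  shows "iid_mean \<nu> A n (\<lambda>ys. (wpair w ys)\<^sup>2) = (\<Sum>y\<in>A. \<nu> y * (w y)\<^sup>2)\<^sup>2 * (real n * (real n - 1) / 2)"
proof (induction n)
  case (Suc n)
  define V where "V = (\<Sum>y\<in>A. \<nu> y * (w y)\<^sup>2)"
  \<comment> \<open>The mixed moment \<open>X\<close> stays unevaluated: its coefficient contains
    \<open>w y\<close>, whose mean is zero.\<close>
  define X where "X = iid_mean \<nu> A n (\<lambda>ys. wpair w ys * wsum w ys)"
  have "iid_mean \<nu> A n (\<lambda>ys. (wpair w (y # ys))\<^sup>2) =
      V\<^sup>2 * (real n * (real n - 1) / 2) + 2 * w y * X + (w y)\<^sup>2 * (n * V)" for y
  proof -
    have "iid_mean \<nu> A n (\<lambda>ys. (wpair w (y # ys))\<^sup>2) = iid_mean \<nu> A n (\<lambda>ys. (wpair w ys)\<^sup>2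
        + (w y)\<^sup>2 * (wsum w ys)\<^sup>2 + (2 * w y) * (wpair w ys * wsum w ys))"
      by (intro iid_mean_cong) (simp_all add: power2_eq_square algebra_simps)
    then show ?thesis
      unfolding iid_mean_add iid_mean_cmult Suc iid_mean_wsum_square[OF assms] V_def X_def by simp
  qed
  then have "iid_mean \<nu> A (Suc n) (\<lambda>ys. (wpair w ys)\<^sup>2) =
      (\<Sum>y\<in>A. \<nu> y * (V\<^sup>2 * (real n * (real n - 1) / 2)) + 2 * X * (\<nu> y * w y) + (n * V) * (\<nu> y * (w y)\<^sup>2))"
    by (simp add: algebra_simps)
  also have "\<dots> = V\<^sup>2 * (real n * (real n - 1) / 2) + n * V * V"
    using assms unfolding sum.distrib sum_distrib_left[symmetric] sum_distrib_right[symmetric]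
    by (simp add: V_def)
  finally show ?case by (simp add: V_def power2_eq_square field_simps)
qed simp

text \<open>Averaging over the sample that carries the weight \<open>w\<close> leaves the difference
  of the function between \<open>a\<close> and \<open>b\<close> in that slot. By symmetry the slot
  can be moved to the front, and all \<open>Suc n\<close> slots contribute equally.\<close>

lemma iid_mean_wsum_times:
  assumes w: "\<And>G. (\<Sum>y\<in>A. \<nu> y * w y * G y) = G a - G b"
    and sym: "\<And>xs ys. mset xs = mset ys \<Longrightarrow> f xs = f ys"
  shows "iid_mean \<nu> A (Suc n) (\<lambda>ys. wsum w ys * f ys) = Suc n * iid_mean \<nu> A n (\<lambda>ys. f (a # ys) - f (b # ys))"
  using sym
proof (induction n arbitrary: f)
  case 0
  show ?case using w[of "\<lambda>y. f [y]"] by (simp add: mult.assoc)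
next
  case (Suc n)
  have eq: "iid_mean \<nu> A (Suc n) (\<lambda>ys. wsum w (y # ys) * f (y # ys)) =
     w y * iid_mean \<nu> A (Suc n) (\<lambda>ys. f (y # ys)) + Suc n * iid_mean \<nu> A n (\<lambda>ys. f (a # y # ys) - f (b # y # ys))" for y
  proof -
    have "iid_mean \<nu> A (Suc n) (\<lambda>ys. wsum w (y # ys) * f (y # ys)) =
        iid_mean \<nu> A (Suc n) (\<lambda>ys. w y * f (y # ys) + wsum w ys * f (y # ys))"
      by (intro iid_mean_cong) (auto simp: algebra_simps)
    also have "\<dots> = w y * iid_mean \<nu> A (Suc n) (\<lambda>ys. f (y # ys)) +
        Suc n * iid_mean \<nu> A n (\<lambda>ys. f (y # a # ys) - f (y # b # ys))"
      unfolding iid_mean_add iid_mean_cmult by (subst Suc.IH) (auto intro: Suc.prems)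
    also have "(\<lambda>ys. f (y # a # ys) - f (y # b # ys)) = (\<lambda>ys. f (a # y # ys) - f (b # y # ys))"
      by (intro ext arg_cong2[where f="(-)"] Suc.prems) auto
    finally show ?thesis .
  qed
  have "iid_mean \<nu> A (Suc (Suc n)) (\<lambda>ys. wsum w ys * f ys) =
     (\<Sum>y\<in>A. \<nu> y * iid_mean \<nu> A (Suc n) (\<lambda>ys. wsum w (y # ys) * f (y # ys)))" by simp
  also have "\<dots> = (\<Sum>y\<in>A. \<nu> y * w y * iid_mean \<nu> A (Suc n) (\<lambda>ys. f (y # ys))) +
     Suc n * (\<Sum>y\<in>A. \<nu> y * iid_mean \<nu> A n (\<lambda>ys. f (a # y # ys) - f (b # y # ys)))"
    unfolding eq distrib_left sum.distrib sum_distrib_left by (simp add: mult_ac)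
  also have "\<dots> = iid_mean \<nu> A (Suc n) (\<lambda>ys. f (a # ys) - f (b # ys)) +
     Suc n * iid_mean \<nu> A (Suc n) (\<lambda>ys. f (a # ys) - f (b # ys))"
    unfolding w iid_mean_diff[of _ _ "Suc n"] by (simp add: iid_mean_diff right_diff_distrib sum_subtractf)
  finally show ?case by (simp add: algebra_simps)
qed

text \<open>Each of the \<open>(n + 2) (n + 1) / 2\<close> pairs carries two weights and hence
  produces differences in two slots, which form a second difference as \<open>f\<close> is
  symmetric.\<close>

lemma iid_mean_wpair_times:
  assumes w: "\<And>G. (\<Sum>y\<in>A. \<nu> y * w y * G y) = G a - G b"
    and sym: "\<And>xs ys. mset xs = mset ys \<Longrightarrow> f xs = f ys"
  shows "iid_mean \<nu> A (Suc (Suc n)) (\<lambda>ys. wpair w ys * f ys) =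
    (real n + 2) * (real n + 1) / 2 * iid_mean \<nu> A n (\<lambda>ys. f (a # a # ys) - 2 * f (a # b # ys) + f (b # b # ys))"
  using sym
proof (induction n arbitrary: f)
  \<comment> \<open>Pairs that contain the head are separated from those within the tail. The former
    give \<open>wsum\<close> over the tail, to which \<open>iid_mean_wsum_times\<close> applies, and
    then a single weight at the head.\<close>
  have step: "iid_mean \<nu> A (Suc (Suc n)) (\<lambda>ys. wpair w ys * f ys) =
      (\<Sum>y\<in>A. \<nu> y * iid_mean \<nu> A (Suc n) (\<lambda>ys. wpair w ys * f (y # ys))) +
      Suc n * iid_mean \<nu> A n (\<lambda>ys. f (a # a # ys) - 2 * f (a # b # ys) + f (b # b # ys))"
    if sym: "\<And>xs ys. mset xs = mset ys \<Longrightarrow> f xs = f ys" for f and n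
  proof -
    have eq: "iid_mean \<nu> A (Suc n) (\<lambda>ys. wpair w (y # ys) * f (y # ys)) =
        iid_mean \<nu> A (Suc n) (\<lambda>ys. wpair w ys * f (y # ys)) +
        w y * (Suc n * iid_mean \<nu> A n (\<lambda>ys. f (y # a # ys) - f (y # b # ys)))" for y
    proof -
      have "iid_mean \<nu> A (Suc n) (\<lambda>ys. wpair w (y # ys) * f (y # ys)) =
        iid_mean \<nu> A (Suc n) (\<lambda>ys. wpair w ys * f (y # ys) + w y * (wsum w ys * f (y # ys)))"
        by (intro iid_mean_cong) (auto simp: algebra_simps)
      moreover have "iid_mean \<nu> A (Suc n) (\<lambda>ys. wsum w ys * f (y # ys)) =
          Suc n * iid_mean \<nu> A n (\<lambda>ys. f (y # a # ys) - f (y # b # ys))"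
        by (intro iid_mean_wsum_times w sym) simp
      ultimately show ?thesis unfolding iid_mean_add iid_mean_cmult by simp
    qed
    have "iid_mean \<nu> A (Suc (Suc n)) (\<lambda>ys. wpair w ys * f ys) =
       (\<Sum>y\<in>A. \<nu> y * iid_mean \<nu> A (Suc n) (\<lambda>ys. wpair w (y # ys) * f (y # ys)))" by simp
    also have "\<dots> = (\<Sum>y\<in>A. \<nu> y * iid_mean \<nu> A (Suc n) (\<lambda>ys. wpair w ys * f (y # ys))) +
      Suc n * (\<Sum>y\<in>A. \<nu> y * w y * iid_mean \<nu> A n (\<lambda>ys. f (y # a # ys) - f (y # b # ys)))"
      unfolding eq distrib_left sum.distrib sum_distrib_left by (simp add: mult_ac)
    also have "(\<Sum>y\<in>A. \<nu> y * w y * iid_mean \<nu> A n (\<lambda>ys. f (y # a # ys) - f (y # b # ys))) =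
       iid_mean \<nu> A n (\<lambda>ys. (f (a # a # ys) - f (a # b # ys)) - (f (b # a # ys) - f (b # b # ys)))"
      unfolding w iid_mean_diff ..
    also have "\<dots> = iid_mean \<nu> A n (\<lambda>ys. f (a # a # ys) - 2 * f (a # b # ys) + f (b # b # ys))"
    proof (intro iid_mean_cong)
      fix ys
      have "f (b # a # ys) = f (a # b # ys)" by (intro sym) auto
      then show "f (a # a # ys) - f (a # b # ys) - (f (b # a # ys) - f (b # b # ys)) =
         f (a # a # ys) - 2 * f (a # b # ys) + f (b # b # ys)" by simp
    qed auto
    finally show ?thesis .
  qed
  {
    case 0
    show ?case by (subst step, rule 0, assumption) simp
  next
    case (Suc n)
    let ?D = "\<lambda>ys. f (a # a # ys) - 2 * f (a # b # ys) + f (b # b # ys)"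
    have "iid_mean \<nu> A (Suc (Suc n)) (\<lambda>ys. wpair w ys * f (y # ys)) =
       (real n + 2) * (real n + 1) / 2 * iid_mean \<nu> A n (\<lambda>ys. ?D (y # ys))" for y
    proof -
      have "(\<lambda>ys. f (y # a # a # ys) - 2 * f (y # a # b # ys) + f (y # b # b # ys)) = (\<lambda>ys. ?D (y # ys))"
      proof
        fix ys
        have "f (y # a # a # ys) = f (a # a # y # ys)" "f (y # a # b # ys) = f (a # b # y # ys)"
          "f (y # b # b # ys) = f (b # b # y # ys)"
          by (intro Suc.prems; simp)+
        then show "f (y # a # a # ys) - 2 * f (y # a # b # ys) + f (y # b # b # ys) = ?D (y # ys)" by simp
      qed
      then show ?thesis by (subst Suc.IH) (auto intro: Suc.prems)
    qed
    then have "(\<Sum>y\<in>A. \<nu> y * iid_mean \<nu> A (Suc (Suc n)) (\<lambda>ys. wpair w ys * f (y # ys))) =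
       (real n + 2) * (real n + 1) / 2 * iid_mean \<nu> A (Suc n) ?D"
      by (simp only: iid_mean.simps sum_distrib_left mult_ac)
    then show ?case using step[where f=f, OF Suc.prems] by (simp add: field_simps del: iid_mean.simps)
  }
qed

text \<open>The second difference times the number of pairs is a mean weighted by
  \<open>wpair w\<close>, whose root mean square is only of order \<open>n\<close>. The constant
  comes from the bound \<open>2 / c\<close> on the variance \<open>V\<close> of
  \<open>w\<close>.\<close>

lemma iid_mean_second_difference:
  assumes fin: "finite A" and nonneg: "\<And>y. y \<in> A \<Longrightarrow> 0 \<le> \<nu> y" and one: "sum \<nu> A = 1"
    and ab: "a \<in> A" "b \<in> A" "a \<noteq> b" and c: "0 < c" "c \<le> \<nu> a" "c \<le> \<nu> b"
    and sym: "\<And>xs ys. mset xs = mset ys \<Longrightarrow> f xs = f ys"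
    and f: "\<And>ys. \<bar>f ys\<bar> \<le> 1"
  shows "\<bar>iid_mean \<nu> A n (\<lambda>ys. f (a # a # ys) - 2 * f (a # b # ys) + f (b # b # ys))\<bar> \<le> (1 + 2 / c\<^sup>2) / (real n + 1)"
proof -
  define w where "w = (\<lambda>y. if y = a then 1 / \<nu> a else if y = b then - 1 / \<nu> b else 0)"
  have pos: "\<nu> a > 0" "\<nu> b > 0" using c by auto
  have w: "(\<Sum>y\<in>A. \<nu> y * w y * G y) = G a - G b" for G
  proof -
    have "(\<Sum>y\<in>A. \<nu> y * w y * G y) = (\<Sum>y\<in>A. (if y = a then G a else 0) + (if y = b then - G b else 0))"
      using pos ab(3) by (intro sum.cong) (auto simp: w_def)
    then show ?thesis using fin ab by (simp add: sum.distrib)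
  qed
  have w0: "(\<Sum>y\<in>A. \<nu> y * w y) = 0" using w[of "\<lambda>_. 1"] by simp
  define V where "V = (\<Sum>y\<in>A. \<nu> y * (w y)\<^sup>2)"
  \<comment> \<open>The identity for \<open>w\<close> is tested against \<open>w\<close> itself,
    which gives \<open>w a - w b\<close>.\<close>
  have "V = 1 / \<nu> a + 1 / \<nu> b"
    using w[of w] ab(3) by (simp add: V_def power2_eq_square mult.assoc) (simp add: w_def)
  moreover have "1 / \<nu> a \<le> 1 / c" "1 / \<nu> b \<le> 1 / c" using c by (auto intro!: divide_left_mono)
  ultimately have V: "0 \<le> V" "V \<le> 2 / c" using pos by auto
  have V2: "V\<^sup>2 \<le> 4 / c\<^sup>2" using power_mono[OF V(2,1), of 2] by (simp add: power_divide)
  let ?D = "iid_mean \<nu> A n (\<lambda>ys. f (a # a # ys) - 2 * f (a # b # ys) + f (b # b # ys))"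
  define m where "m = real n + 2"
  have m: "m > 1" by (simp add: m_def)
  have eq: "iid_mean \<nu> A (Suc (Suc n)) (\<lambda>ys. wpair w ys * f ys) = m * (m - 1) / 2 * ?D"
    by (subst iid_mean_wpair_times[where f=f, OF w sym]) (simp_all add: m_def)
  have "\<bar>iid_mean \<nu> A (Suc (Suc n)) (\<lambda>ys. wpair w ys * f ys)\<bar> \<le>
        iid_mean \<nu> A (Suc (Suc n)) (\<lambda>ys. \<bar>wpair w ys * f ys\<bar>)"
    by (intro iid_mean_abs nonneg)
  \<comment> \<open>The factor \<open>m\<close> balances the two terms, as the mean square of
    \<open>wpair w\<close> is of order \<open>m\<close> squared.\<close>
  also have "\<dots> \<le> iid_mean \<nu> A (Suc (Suc n)) (\<lambda>ys. 1 / (2 * m) * (wpair w ys)\<^sup>2 + m / 2)"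
  proof (intro iid_mean_mono nonneg)
    fix ys
    have "\<bar>wpair w ys * f ys\<bar> \<le> \<bar>wpair w ys\<bar>"
      unfolding abs_mult using f[of ys] by (simp add: mult_left_le)
    also have "2 * m * \<bar>wpair w ys\<bar> \<le> (wpair w ys)\<^sup>2 + m\<^sup>2"
      using sum_squares_bound[of m "\<bar>wpair w ys\<bar>"] by simp
    then have "\<bar>wpair w ys\<bar> \<le> 1 / (2 * m) * (wpair w ys)\<^sup>2 + m / 2"
      using m by (simp add: field_simps power2_eq_square)
    finally show "\<bar>wpair w ys * f ys\<bar> \<le> 1 / (2 * m) * (wpair w ys)\<^sup>2 + m / 2" .
  qed
  also have "\<dots> = V\<^sup>2 * (m - 1) / 4 + m / 2"
    unfolding iid_mean_add iid_mean_cmult iid_mean_const[OF one] iid_mean_wpair_square[OF one w0] V_def[symmetric]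
    using m by (simp add: m_def field_simps)
  also have "\<dots> \<le> V\<^sup>2 * m / 4 + m / 2" using m by (simp add: mult_left_mono)
  also have "\<dots> \<le> (4 / c\<^sup>2) * m / 4 + m / 2"
    using V2 m by (intro add_mono divide_right_mono mult_right_mono) auto
  finally have "\<bar>m * (m - 1) / 2 * ?D\<bar> \<le> m * (1 / c\<^sup>2 + 1 / 2)"
    unfolding eq by (simp add: field_simps)
  then have "m * (m - 1) / 2 * \<bar>?D\<bar> \<le> m * (1 / c\<^sup>2 + 1 / 2)"
    using m by (simp add: abs_mult)
  then have "m * ((m - 1) / 2 * \<bar>?D\<bar>) \<le> m * (1 / c\<^sup>2 + 1 / 2)" by (simp add: mult_ac)
  then have "(m - 1) / 2 * \<bar>?D\<bar> \<le> 1 / c\<^sup>2 + 1 / 2"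
    using m by (subst (asm) mult_le_cancel_left_pos) auto
  then have "(m - 1) * \<bar>?D\<bar> \<le> 1 + 2 * (1 / c\<^sup>2)" by simp
  then show ?thesis by (simp add: m_def pos_le_divide_eq mult.commute add.commute)
qed

section \<open>The law of a vertex with a forced parent\<close>

lemma iid_mean_reindex:
  assumes "bij_betw \<phi> A A"
  shows "iid_mean \<nu> A n f = iid_mean (\<lambda>y. \<nu> (\<phi> y)) A n (\<lambda>ys. f (map \<phi> ys))"
proof (induction n arbitrary: f)
  case (Suc n)
  then show ?case
    by (simp add: sum.reindex_bij_betw[OF assms, of "\<lambda>y. \<nu> y * iid_mean (\<lambda>y. \<nu> (\<phi> y)) A n (\<lambda>ys. f (y # map \<phi> ys))", symmetric])
qed simp

text \<open>Extensional functions give each sequence of \<open>n\<close> spins exactly one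
  representative, so the set is finite and sums over it run over sequences.\<close>

definition paths :: "nat \<Rightarrow> (nat \<Rightarrow> real) set" where
  "paths n = (\<Pi>\<^sub>E t\<in>{..<n}. {- 1, 1})"

abbreviation psum :: "(nat \<Rightarrow> real) list \<Rightarrow> nat \<Rightarrow> real" where
  "psum ys t \<equiv> wsum (\<lambda>y. y t) ys"

definition vote :: "nat \<Rightarrow> (nat \<Rightarrow> real) \<Rightarrow> (nat \<Rightarrow> real) \<Rightarrow> (nat \<Rightarrow> real) list \<Rightarrow> real" where
  "vote n x c ys = (\<Prod>t<n. (1 + x (Suc t) * sgn (c t + psum ys t)) / 2)"

text \<open>
  \<open>law k n x u\<close> is the probability that a vertex of the tree follows \<open>x\<close> during the first
  \<open>n\<close> times if its parent is forced to follow \<open>u\<close>. A factor of \<open>vote\<close> is the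
  conditional probability of the next spin; it is \<open>1 / 2\<close> for ties as \<open>sgn 0 = 0\<close>.
\<close>

primrec law :: "nat \<Rightarrow> nat \<Rightarrow> (nat \<Rightarrow> real) \<Rightarrow> (nat \<Rightarrow> real) \<Rightarrow> real" where
  "law k 0 x u = 1"
| "law k (Suc n) x u = 1 / 2 * iid_mean (\<lambda>y. law k n y x) (paths n) (k - 1) (vote n x u)"

lemma finite_paths [simp]: "finite (paths n)"
  by (auto simp: paths_def intro!: finite_PiE)

lemma card_paths: "card (paths n) = 2 ^ n"
  by (simp add: paths_def card_PiE card_insert_if numeral_2_eq_2)

lemma pathsD: "x \<in> paths n \<Longrightarrow> t < n \<Longrightarrow> x t = - 1 \<or> x t = 1"
  by (auto simp: paths_def)

lemma paths_iff: "x \<in> paths n \<longleftrightarrow> (\<forall>t<n. x t = - 1 \<or> x t = 1) \<and> (\<forall>t\<ge>n. x t = undefined)"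
  by (auto simp: paths_def PiE_def extensional_def Pi_def not_less)

lemma paths_abs: "x \<in> paths n \<Longrightarrow> t < n \<Longrightarrow> \<bar>x t\<bar> = 1"
  using pathsD by fastforce

lemma paths_square: "x \<in> paths n \<Longrightarrow> t < n \<Longrightarrow> x t * x t = 1"
  using pathsD by fastforce

lemma vote_factor_bounds:
  fixes a s :: real
  assumes "\<bar>a\<bar> \<le> 1"
  shows "0 \<le> (1 + a * sgn s) / 2" "(1 + a * sgn s) / 2 \<le> 1"
proof -
  have "\<bar>a * sgn s\<bar> \<le> 1"
    using assms by (auto simp: abs_mult sgn_real_def)
  then show "0 \<le> (1 + a * sgn s) / 2" "(1 + a * sgn s) / 2 \<le> 1" by auto
qed

lemma vote_bounds:
  assumes "\<And>t. t < n \<Longrightarrow> \<bar>x (Suc t)\<bar> \<le> 1"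
  shows "0 \<le> vote n x c ys" "vote n x c ys \<le> 1"
  unfolding vote_def
  by (intro prod_nonneg prod_le_1 ballI conjI vote_factor_bounds assms; simp)+

lemma vote_cong:
  assumes "\<And>t. t < n \<Longrightarrow> x (Suc t) = x' (Suc t)" "\<And>t. t < n \<Longrightarrow> c t = c' t"
  shows "vote n x c ys = vote n x' c' ys"
  unfolding vote_def using assms by (intro prod.cong) auto

lemma law_nonneg:
  assumes "\<And>t. t < n \<Longrightarrow> \<bar>x t\<bar> \<le> 1"
  shows "0 \<le> law k n x u"
  using assms
proof (induction n arbitrary: x u)
  case (Suc n)
  then show ?case
    by (auto intro!: mult_nonneg_nonneg iid_mean_nonneg vote_bounds Suc.IH simp: paths_abs)
qed simp

text \<open>The spin of the parent at time \<open>t\<close> first acts on the vertex at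
  \<open>Suc t\<close>, so within the horizon \<open>n\<close> only times with
  \<open>Suc t < n\<close> are seen.\<close>

lemma law_cong:
  assumes "\<And>t. t < n \<Longrightarrow> x t = x' t" "\<And>t. Suc t < n \<Longrightarrow> u t = u' t"
  shows "law k n x u = law k n x' u'"
  using assms
proof (induction n arbitrary: x x' u u')
  case (Suc n)
  have "iid_mean (\<lambda>y. law k n y x) (paths n) (k - 1) (vote n x u) =
      iid_mean (\<lambda>y. law k n y x') (paths n) (k - 1) (vote n x' u')"
    by (intro iid_mean_cong Suc.IH vote_cong) (auto simp: Suc.prems)
  then show ?case by simp
qed simp

section \<open>Spin-flip symmetry\<close>

definition flip_path :: "nat \<Rightarrow> (nat \<Rightarrow> real) \<Rightarrow> nat \<Rightarrow> real" where
  "flip_path n y = (\<lambda>t\<in>{..<n}. - y t)"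

lemma flip_path: "t < n \<Longrightarrow> flip_path n y t = - y t"
  by (simp add: flip_path_def)

lemma flip_path_paths: "y \<in> paths n \<Longrightarrow> flip_path n y \<in> paths n"
  unfolding paths_def flip_path_def by (rule restrict_PiE_iff[THEN iffD2]) (auto dest!: PiE_mem)

lemma flip_flip: "y \<in> paths n \<Longrightarrow> flip_path n (flip_path n y) = y"
  by (auto simp: paths_def flip_path_def fun_eq_iff PiE_def extensional_def)

lemma bij_flip: "bij_betw (flip_path n) (paths n) (paths n)"
  by (rule bij_betw_byWitness[where f' = "flip_path n"]) (auto simp: flip_flip flip_path_paths)

text \<open>Reversing every spin preserves the dynamics, ties included, because \<open>sgn\<close>
  is odd. For the children the reversal is a reindexing of the samples; it uses
  \<open>flip_path\<close> since plain negation need not preserve the value \<open>undefined\<close>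
  beyond the horizon.\<close>

lemma law_flip: "law k n (\<lambda>t. - x t) (\<lambda>t. - u t) = law k n x u"
proof (induction n arbitrary: x u)
  case (Suc n)
  have "iid_mean (\<lambda>y. law k n y (\<lambda>t. - x t)) (paths n) (k - 1) (vote n (\<lambda>t. - x t) (\<lambda>t. - u t)) =
     iid_mean (\<lambda>y. law k n (flip_path n y) (\<lambda>t. - x t)) (paths n) (k - 1)
       (\<lambda>ys. vote n (\<lambda>t. - x t) (\<lambda>t. - u t) (map (flip_path n) ys))"
    by (rule iid_mean_reindex[OF bij_flip])
  also have "\<dots> = iid_mean (\<lambda>y. law k n y x) (paths n) (k - 1) (vote n x u)"
  proof (rule iid_mean_cong)
    fix y
    have "law k n (flip_path n y) (\<lambda>t. - x t) = law k n (\<lambda>t. - y t) (\<lambda>t. - x t)"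
      by (rule law_cong) (auto simp: flip_path)
    then show "law k n (flip_path n y) (\<lambda>t. - x t) = law k n y x" using Suc by simp
  next
    fix ys
    have p: "psum (map (flip_path n) ys) t = - psum ys t" if "t < n" for t
      using that by (induction ys) (auto simp: flip_path)
    show "vote n (\<lambda>t. - x t) (\<lambda>t. - u t) (map (flip_path n) ys) = vote n x u ys"
      unfolding vote_def
    proof (intro prod.cong refl)
      fix t assume "t \<in> {..<n}"
      then have "- u t + psum (map (flip_path n) ys) t = - (u t + psum ys t)" using p[of t] by simp
      then show "(1 + - x (Suc t) * sgn (- u t + psum (map (flip_path n) ys) t)) / 2 =
          (1 + x (Suc t) * sgn (u t + psum ys t)) / 2"
        by (simp only: sgn_minus minus_mult_minus)
    qed
  qed
  finally show ?case by simp
qed simp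

text \<open>By symmetry the mean at zero field is exactly zero, so a mean with a forced parent can
  be written as a difference of two laws; \<open>mean_converges_Suc\<close> rests on this.\<close>

lemma law_mean_zero:
  assumes "t < n"
  shows "(\<Sum>x\<in>paths n. x t * law k n x (\<lambda>_. 0)) = 0"
proof -
  have "(\<Sum>x\<in>paths n. x t * law k n x (\<lambda>_. 0)) =
     (\<Sum>x\<in>paths n. flip_path n x t * law k n (flip_path n x) (\<lambda>_. 0))"
    by (rule sum.reindex_bij_betw[OF bij_flip, symmetric])
  also have "\<dots> = (\<Sum>x\<in>paths n. - (x t * law k n x (\<lambda>_. 0)))"
  proof (rule sum.cong)
    fix x
    have "law k n (flip_path n x) (\<lambda>_. 0) = law k n (\<lambda>t. - x t) (\<lambda>_. - 0)"
      by (rule law_cong) (auto simp: flip_path)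
    also have "\<dots> = law k n x (\<lambda>_. 0)" by (rule law_flip)
    finally show "flip_path n x t * law k n (flip_path n x) (\<lambda>_. 0) = - (x t * law k n x (\<lambda>_. 0))"
      using assms by (simp add: flip_path)
  qed simp
  finally show ?thesis by (simp add: sum_negf)
qed

section \<open>Drift, fluctuations and lower bounds for votes\<close>

lemma paths_flip_at:
  assumes "t < n"
  shows "bij_betw (\<lambda>y. y(t := - y t)) (paths n) (paths n)"
proof -
  have "y(t := - y t) \<in> paths n" if "y \<in> paths n" for y
    using that assms unfolding paths_iff by fastforce
  then show ?thesis
    by (intro bij_betw_byWitness[where f' = "\<lambda>y. y(t := - y t)"]) auto
qed

lemma sum_paths_coord: "t < n \<Longrightarrow> (\<Sum>y\<in>paths n. y t) = 0"
  using sum.reindex_bij_betw[OF paths_flip_at, of t n "\<lambda>y. y t"] by (simp add: sum_negf)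

text \<open>Orthogonality of the coordinates under the uniform weight, by flipping one of them. A
  perturbation of the weights along one coordinate thus shifts the mean of that coordinate
  only.\<close>

lemma sum_paths_coord2:
  assumes "s < n" "t < n"
  shows "(\<Sum>y\<in>paths n. y s * y t) = (if s = t then 2 ^ n else 0)"
proof (cases "s = t")
  case True
  then have "(\<Sum>y\<in>paths n. y s * y t) = (\<Sum>y\<in>paths n. 1)"
    using assms by (intro sum.cong) (auto simp: paths_square)
  then show ?thesis using True by (simp add: card_paths)
next
  case False
  have "(\<Sum>y\<in>paths n. y s * y t) = (\<Sum>y\<in>paths n. (y(t := - y t)) s * (y(t := - y t)) t)"
    by (rule sum.reindex_bij_betw[OF paths_flip_at[OF assms(2)], symmetric])
  also have "\<dots> = - (\<Sum>y\<in>paths n. y s * y t)" using False by (simp add: sum_negf)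
  finally show ?thesis using False by simp
qed

lemma psum_variance:
  assumes one: "sum \<nu> (paths n) = 1" and t: "t < n"
  shows "iid_mean \<nu> (paths n) N (\<lambda>ys. (psum ys t - N * (\<Sum>z\<in>paths n. \<nu> z * z t))\<^sup>2) \<le> N"
proof -
  define \<mu> where "\<mu> = (\<Sum>z\<in>paths n. \<nu> z * z t)"
  have z: "(\<Sum>z\<in>paths n. \<nu> z * (z t - \<mu>)) = 0"
    using one by (simp add: right_diff_distrib sum_subtractf flip: sum_distrib_right) (simp add: \<mu>_def)
  have "iid_mean \<nu> (paths n) N (\<lambda>ys. (psum ys t - N * \<mu>)\<^sup>2) =
     iid_mean \<nu> (paths n) N (\<lambda>ys. (wsum (\<lambda>z. z t - \<mu>) ys)\<^sup>2)"
    by (intro iid_mean_cong) (auto simp: sum_list_subtractf sum_list_triv)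
  also have "\<dots> = N * (\<Sum>z\<in>paths n. \<nu> z * (z t - \<mu>)\<^sup>2)"
    by (rule iid_mean_wsum_square[OF one z])
  also have "(\<Sum>z\<in>paths n. \<nu> z * (z t - \<mu>)\<^sup>2) =
     (\<Sum>z\<in>paths n. \<nu> z * (z t * z t) - \<mu> * (\<nu> z * z t) - \<mu> * (\<nu> z * (z t - \<mu>)))"
    by (intro sum.cong) (auto simp: power2_eq_square algebra_simps)
  also have "\<dots> = (\<Sum>z\<in>paths n. \<nu> z * (z t * z t)) - \<mu> * \<mu>"
    unfolding sum_subtractf sum_distrib_left[symmetric] z by (simp add: \<mu>_def)
  also have "(\<Sum>z\<in>paths n. \<nu> z * (z t * z t)) = (\<Sum>z\<in>paths n. \<nu> z)"
    using t by (intro sum.cong) (auto simp: paths_square)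
  finally have "iid_mean \<nu> (paths n) N (\<lambda>ys. (psum ys t - N * \<mu>)\<^sup>2) = N * (1 - \<mu> * \<mu>)"
    using one by simp
  also have "\<dots> \<le> real N * 1" by (intro mult_left_mono) auto
  finally show ?thesis by (simp add: \<mu>_def)
qed

text \<open>The vote can differ from one only if some field lacks the sign prescribed by
  \<open>y\<close>. Then the sum is off its center \<open>m t\<close> by at least
  \<open>\<rho>\<close>, where the additional one in the drift pays for \<open>u t\<close>. This is
  Chebyshev's inequality before taking means.\<close>

lemma one_minus_vote_le:
  assumes y: "\<And>t. t < n \<Longrightarrow> y (Suc t) = - 1 \<or> y (Suc t) = 1"
    and \<rho>: "0 < \<rho>"
    and \<mu>: "\<And>t. t < n \<Longrightarrow> \<bar>u t\<bar> \<le> 1 \<and> \<rho> + 1 \<le> y (Suc t) * m t"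
  shows "1 - vote n y u ys \<le> (\<Sum>t<n. (psum ys t - m t)\<^sup>2 / \<rho>\<^sup>2)"
proof (cases "\<forall>t<n. 0 < y (Suc t) * (u t + psum ys t)")
  case True
  have "(1 + y (Suc t) * sgn (u t + psum ys t)) / 2 = 1" if "t < n" for t
    using True y[OF that] that by (auto simp: sgn_real_def)
  then have "vote n y u ys = 1" unfolding vote_def by (intro prod.neutral) auto
  then show ?thesis by (auto intro!: sum_nonneg)
next
  case False
  then obtain t where t: "t < n" "y (Suc t) * (u t + psum ys t) \<le> 0" by force
  have "\<rho> \<le> \<bar>psum ys t - m t\<bar>" using y[OF t(1)] \<mu>[OF t(1)] t(2) by (auto simp: abs_real_def split: if_splits)
  then have "\<rho>\<^sup>2 \<le> (psum ys t - m t)\<^sup>2" using \<rho> by (metis abs_le_square_iff abs_of_pos)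
  then have "1 \<le> (psum ys t - m t)\<^sup>2 / \<rho>\<^sup>2" using \<rho> by simp
  also have "\<dots> \<le> (\<Sum>t<n. (psum ys t - m t)\<^sup>2 / \<rho>\<^sup>2)" using t by (intro member_le_sum) auto
  moreover have "0 \<le> vote n y u ys" by (rule vote_bounds) (use y in fastforce)
  ultimately show ?thesis by linarith
qed

text \<open>
  Adding a perturbation of order \<open>1 / sqrt k\<close> to the weights gives all sums a drift that decides
  the votes with high probability by Chebyshev's inequality. The density of the perturbed samples has
  a bounded second moment, so the original probability is bounded below, too.
\<close>

lemma vote_lower_bound:
  fixes \<nu> :: "(nat \<Rightarrow> real) \<Rightarrow> real" and B c :: real and n k :: nat
  defines "\<kappa> \<equiv> B + 2 * (2 * real n + 1) + 1"
  assumes c: "0 < c" "\<And>z. z \<in> paths n \<Longrightarrow> c \<le> \<nu> z" and one: "sum \<nu> (paths n) = 1"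
    and mean: "\<And>t. t < n \<Longrightarrow> \<bar>\<Sum>z\<in>paths n. \<nu> z * z t\<bar> \<le> B / sqrt k"
    and B: "0 \<le> B" and k: "4 \<le> k" "\<kappa> * n / c \<le> sqrt k"
    and y: "\<And>t. t < n \<Longrightarrow> y (Suc t) = - 1 \<or> y (Suc t) = 1"
    and u: "\<And>t. t < n \<Longrightarrow> \<bar>u t\<bar> \<le> 1"
  shows "exp (- (\<kappa>\<^sup>2 * n\<^sup>2 / c)) / 4 \<le> iid_mean \<nu> (paths n) (k - 1) (vote n y u)"
proof -
  \<comment> \<open>By orthogonality this perturbation sums to zero and shifts the mean of
    coordinate \<open>t\<close> by exactly \<open>\<kappa> / sqrt k * y (Suc t)\<close>.\<close>
  define a where "a = (\<lambda>z. \<kappa> / sqrt k / 2 ^ n * (\<Sum>t<n. y (Suc t) * z t))"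
  define h where "h = (\<lambda>z. 1 + a z / \<nu> z)"
  define \<nu>' where "\<nu>' = (\<lambda>z. \<nu> z + a z)"
  define \<mu> where "\<mu> = (\<lambda>t. \<Sum>z\<in>paths n. \<nu>' z * z t)"
  \<comment> \<open>With this \<open>r\<close> each of the \<open>n\<close> times fails with
    probability at most \<open>1 / r\<^sup>2\<close>, and some time fails with probability at most
    one half. In \<open>\<kappa> = B + 2 * r + 1\<close> the term \<open>B\<close> outweighs the
    original mean, and the rest leaves a drift of at least \<open>r * sqrt k + 1\<close> for the sum
    of \<open>k - 1\<close> samples.\<close>
  define r where "r = 2 * real n + 1"
  define D where "D = exp (\<kappa>\<^sup>2 * n\<^sup>2 / c)"
  have \<kappa>: "\<kappa> = B + 2 * r + 1" by (simp add: \<kappa>_def r_def)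
  have r: "0 < r" by (simp add: r_def)
  have \<kappa>0: "0 < \<kappa>" using B r by (simp add: \<kappa>)
  have k0: "0 < sqrt k" "0 < real k" using k by auto
  have sk: "2 \<le> sqrt k" using k(1) by (intro real_le_rsqrt) auto
  have \<nu>0: "0 < \<nu> z" if "z \<in> paths n" for z using c that by fastforce
  have tilt: "\<nu> z * h z = \<nu>' z" if "z \<in> paths n" for z
    using \<nu>0[OF that] by (simp add: h_def \<nu>'_def field_simps)
  have a_abs: "\<bar>a z\<bar> \<le> \<kappa> / sqrt k / 2 ^ n * n" if "z \<in> paths n" for z
  proof -
    have "\<bar>\<Sum>t<n. y (Suc t) * z t\<bar> \<le> (\<Sum>t<n. \<bar>y (Suc t) * z t\<bar>)" by (rule sum_abs)
    also have "\<dots> = (\<Sum>t<n. 1)"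
      by (intro sum.cong) (use y that in \<open>auto simp: abs_mult paths_abs\<close>, force)
    finally show ?thesis
      using \<kappa>0 k0 by (auto simp: a_def abs_mult intro!: mult_left_mono divide_right_mono)
  qed
  have a_le: "\<bar>a z\<bar> \<le> c" if "z \<in> paths n" for z
  proof -
    have "\<kappa> * n / sqrt k \<le> c" using k(2) c(1) k0 by (simp add: field_simps)
    moreover have "\<kappa> / sqrt k / 2 ^ n * n \<le> \<kappa> * n / sqrt k"
      using \<kappa>0 k0 mult_left_mono[of 1 "2 ^ n" "real n"] by (simp add: field_simps)
    ultimately show ?thesis using a_abs[OF that] by linarith
  qed
  have \<nu>'0: "0 \<le> \<nu>' z" if "z \<in> paths n" for z
    using a_le[OF that] c(2)[OF that] by (auto simp: \<nu>'_def)
  have suma: "sum a (paths n) = 0"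
  proof -
    have "sum a (paths n) = \<kappa> / sqrt k / 2 ^ n * (\<Sum>z\<in>paths n. \<Sum>t<n. y (Suc t) * z t)"
      by (simp add: a_def sum_distrib_left)
    also have "(\<Sum>z\<in>paths n. \<Sum>t<n. y (Suc t) * z t) = (\<Sum>t<n. y (Suc t) * (\<Sum>z\<in>paths n. z t))"
      by (subst sum.swap) (simp add: sum_distrib_left)
    finally show ?thesis by (simp add: sum_paths_coord)
  qed
  have one': "sum \<nu>' (paths n) = 1" using one suma by (simp add: \<nu>'_def sum.distrib)
  have \<mu>: "\<mu> t = (\<Sum>z\<in>paths n. \<nu> z * z t) + \<kappa> / sqrt k * y (Suc t)" if t: "t < n" for t
  proof -
    have "(\<Sum>z\<in>paths n. a z * z t) = \<kappa> / sqrt k / 2 ^ n * (\<Sum>z\<in>paths n. \<Sum>s<n. y (Suc s) * (z s * z t))"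
      by (simp add: a_def sum_distrib_left sum_distrib_right sum_divide_distrib mult_ac)
    also have "(\<Sum>z\<in>paths n. \<Sum>s<n. y (Suc s) * (z s * z t)) =
        (\<Sum>s<n. y (Suc s) * (\<Sum>z\<in>paths n. z s * z t))"
      by (subst sum.swap) (simp add: sum_distrib_left)
    also have "\<dots> = (\<Sum>s<n. if s = t then y (Suc t) * 2 ^ n else 0)"
      using t by (intro sum.cong) (auto simp: sum_paths_coord2)
    finally show ?thesis using t by (simp add: \<mu>_def \<nu>'_def distrib_right sum.distrib)
  qed
  have drift: "r * sqrt k + 1 \<le> y (Suc t) * (real (k - 1) * \<mu> t)" if t: "t < n" for t
  proof -
    have "y (Suc t) * \<mu> t = y (Suc t) * (\<Sum>z\<in>paths n. \<nu> z * z t) + \<kappa> / sqrt k"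
      using y[OF t] by (auto simp: \<mu>[OF t])
    moreover have "- (B / sqrt k) \<le> y (Suc t) * (\<Sum>z\<in>paths n. \<nu> z * z t)"
      using y[OF t] mean[OF t] by auto
    ultimately have "(2 * r + 1) / sqrt k \<le> y (Suc t) * \<mu> t"
      by (simp add: \<kappa> add_divide_distrib)
    then have "(real k - 1) * ((2 * r + 1) / sqrt k) \<le> real (k - 1) * (y (Suc t) * \<mu> t)"
      using k(1) by (subst of_nat_diff) (auto intro: mult_left_mono simp del: times_divide_eq_right)
    moreover have "(r * sqrt k + 1) * sqrt k \<le> (real k - 1) * (2 * r + 1)"
    proof -
      have s: "sqrt k * sqrt k = k" by simp
      have "sqrt k * 2 \<le> sqrt k * sqrt k" using sk by (intro mult_left_mono) auto
      then have 1: "2 * sqrt k \<le> k" using s by simp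
      have "4 \<le> real k" using k(1) by simp
      then have "r * 4 \<le> r * k" using r by (intro mult_left_mono) auto
      moreover have "(r * sqrt k + 1) * sqrt k = r * k + sqrt k" by (simp add: algebra_simps)
      moreover have "(real k - 1) * (2 * r + 1) = 2 * (r * k) + k - 2 * r - 1" by (simp add: algebra_simps)
      ultimately show ?thesis using 1 r sk \<open>4 \<le> real k\<close> by linarith
    qed
    then have "r * sqrt k + 1 \<le> (real k - 1) * (2 * r + 1) / sqrt k"
      using k0 by (simp only: pos_le_divide_eq)
    ultimately show ?thesis by (simp add: mult.left_commute)
  qed
  have var: "iid_mean \<nu>' (paths n) (k - 1) (\<lambda>ys. (psum ys t - real (k - 1) * \<mu> t)\<^sup>2) \<le> k" if t: "t < n" for t
    using psum_variance[OF one' t, of "k - 1"] unfolding \<mu>_def by simp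
  have "1 - iid_mean \<nu>' (paths n) (k - 1) (vote n y u) = iid_mean \<nu>' (paths n) (k - 1) (\<lambda>ys. 1 - vote n y u ys)"
    by (simp add: iid_mean_diff iid_mean_const[OF one'])
  also have "\<dots> \<le> iid_mean \<nu>' (paths n) (k - 1)
      (\<lambda>ys. \<Sum>t<n. 1 / (r * sqrt k)\<^sup>2 * (psum ys t - real (k - 1) * \<mu> t)\<^sup>2)"
    using one_minus_vote_le[of n y "r * sqrt k" u "\<lambda>t. real (k - 1) * \<mu> t"] y u drift r k0
    by (intro iid_mean_mono \<nu>'0) auto
  also have "\<dots> = (\<Sum>t<n. 1 / (r * sqrt k)\<^sup>2 *
       iid_mean \<nu>' (paths n) (k - 1) (\<lambda>ys. (psum ys t - real (k - 1) * \<mu> t)\<^sup>2))"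
    unfolding iid_mean_sum iid_mean_cmult ..
  also have "\<dots> \<le> (\<Sum>t<n. 1 / (r * sqrt k)\<^sup>2 * k)"
    by (intro sum_mono mult_left_mono var) auto
  also have "\<dots> = n / r\<^sup>2" using k0 by (simp add: power_mult_distrib)
  also have "\<dots> \<le> 1 / 2"
  proof -
    have "2 * real n \<le> r\<^sup>2" by (simp add: r_def power2_eq_square algebra_simps)
    then show ?thesis using r by (simp add: divide_le_eq)
  qed
  finally have half: "1 / 2 \<le> iid_mean \<nu>' (paths n) (k - 1) (vote n y u)" by simp
  \<comment> \<open>The terms linear in \<open>a\<close> cancel because \<open>a\<close> sums to
    zero. So the second moment of the density of one sample is \<open>1 + O(1 / k)\<close>, and its
    power \<open>k - 1\<close> is at most \<open>D\<close>.\<close>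
  have h2: "(\<Sum>z\<in>paths n. \<nu> z * (h z)\<^sup>2) \<le> 1 + \<kappa>\<^sup>2 * n\<^sup>2 / c / k"
  proof -
    have "(\<Sum>z\<in>paths n. \<nu> z * (h z)\<^sup>2) = (\<Sum>z\<in>paths n. \<nu> z + 2 * a z + (a z)\<^sup>2 / \<nu> z)"
    proof (intro sum.cong refl)
      fix z assume "z \<in> paths n"
      from \<nu>0[OF this] show "\<nu> z * (h z)\<^sup>2 = \<nu> z + 2 * a z + (a z)\<^sup>2 / \<nu> z"
        by (simp add: h_def power2_eq_square field_simps)
    qed
    also have "\<dots> = 1 + (\<Sum>z\<in>paths n. (a z)\<^sup>2 / \<nu> z)"
      using one suma by (simp add: sum.distrib flip: sum_distrib_left)
    also have "(\<Sum>z\<in>paths n. (a z)\<^sup>2 / \<nu> z) \<le> (\<Sum>z\<in>paths n. (\<kappa> / sqrt k / 2 ^ n * n)\<^sup>2 / c)"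
    proof (intro sum_mono frac_le)
      fix z assume z: "z \<in> paths n"
      show "(a z)\<^sup>2 \<le> (\<kappa> / sqrt k / 2 ^ n * n)\<^sup>2"
        using a_abs[OF z] by (metis abs_ge_zero power2_abs power_mono)
    qed (use c in auto)
    also have "\<dots> = \<kappa>\<^sup>2 * n\<^sup>2 / c / k / 2 ^ n"
      using k0 by (simp add: card_paths power_mult_distrib power_divide power2_eq_square field_simps)
    also have "\<dots> \<le> \<kappa>\<^sup>2 * n\<^sup>2 / c / k / 1"
      using c k0 by (intro divide_left_mono) auto
    finally show ?thesis by simp
  qed
  have "(\<Sum>z\<in>paths n. \<nu> z * (h z)\<^sup>2) ^ (k - 1) \<le> exp (\<kappa>\<^sup>2 * n\<^sup>2 / c / k) ^ (k - 1)"
    using h2 exp_ge_add_one_self[of "\<kappa>\<^sup>2 * n\<^sup>2 / c / k"] \<nu>0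
    by (intro power_mono order_trans[OF h2] sum_nonneg mult_nonneg_nonneg) (auto simp: less_imp_le)
  also have "\<dots> \<le> D"
    using k c \<kappa>0 by (auto simp: D_def field_simps mult_left_mono mult_right_mono simp flip: exp_of_nat_mult)
  finally have hD: "(\<Sum>z\<in>paths n. \<nu> z * (h z)\<^sup>2) ^ (k - 1) \<le> D" .
  have D: "0 < D" by (simp add: D_def)
  have "iid_mean \<nu>' (paths n) (k - 1) (vote n y u) = iid_mean \<nu> (paths n) (k - 1) (\<lambda>ys. prod_list (map h ys) * vote n y u ys)"
    unfolding iid_mean_tilt by (intro iid_mean_cong) (auto simp: tilt)
  also have "\<dots> \<le> iid_mean \<nu> (paths n) (k - 1)
      (\<lambda>ys. 1 / (4 * D) * prod_list (map (\<lambda>z. (h z)\<^sup>2) ys) + D * vote n y u ys)"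
  proof (intro iid_mean_mono less_imp_le[OF \<nu>0])
    fix ys
    define p v where "p = prod_list (map h ys)" and "v = vote n y u ys"
    have v: "0 \<le> v" "v \<le> 1" unfolding v_def by (rule vote_bounds; use y in fastforce)+
    have p2: "prod_list (map (\<lambda>z. (h z)\<^sup>2) ys) = p\<^sup>2"
      unfolding p_def by (induction ys) (auto simp: power_mult_distrib)
    \<comment> \<open>A weighted form of the Cauchy-Schwarz inequality: the square of the density
      costs at most \<open>1 / 4\<close> of the available \<open>1 / 2\<close> in the mean, and
      \<open>v\<^sup>2 \<le> v\<close> brings back the vote itself.\<close>
    have "4 * D * (p * v) \<le> p\<^sup>2 + 4 * D\<^sup>2 * v\<^sup>2"
      using sum_squares_bound[of p "2 * D * v"] by (simp add: power_mult_distrib mult_ac)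
    also have "v\<^sup>2 \<le> v" using v by (simp add: power2_eq_square mult_left_le)
    finally have "4 * D * (p * v) \<le> p\<^sup>2 + 4 * D\<^sup>2 * v" using D by simp
    then have "p * v \<le> 1 / (4 * D) * p\<^sup>2 + D * v"
      using D by (simp add: field_simps power2_eq_square)
    then show "prod_list (map h ys) * vote n y u ys \<le>
      1 / (4 * D) * prod_list (map (\<lambda>z. (h z)\<^sup>2) ys) + D * vote n y u ys"
      unfolding p2 by (simp add: p_def v_def)
  qed
  also have "\<dots> = 1 / (4 * D) * (\<Sum>z\<in>paths n. \<nu> z * (h z)\<^sup>2) ^ (k - 1) + D * iid_mean \<nu> (paths n) (k - 1) (vote n y u)"
    unfolding iid_mean_add iid_mean_cmult iid_mean_prod_list ..
  also have "\<dots> \<le> 1 / (4 * D) * D + D * iid_mean \<nu> (paths n) (k - 1) (vote n y u)"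
    using hD D by (intro add_right_mono mult_left_mono) auto
  finally have "1 / 4 \<le> D * iid_mean \<nu> (paths n) (k - 1) (vote n y u)"
    using half D by simp
  then have "1 / D / 4 \<le> iid_mean \<nu> (paths n) (k - 1) (vote n y u)"
    using D by (simp add: field_simps)
  then show ?thesis by (simp add: D_def exp_minus inverse_eq_divide)
qed

section \<open>Convergence of sign products\<close>

text \<open>
  The libraries lack a multivariate continuity theorem. For products of signs it can be avoided:
  \<open>sgn x\<close> is close to a polynomial in \<open>sin (x / L)\<close> for large \<open>L\<close>, and products of such polynomials
  are trigonometric polynomials, whose means are given by the characteristic function.
\<close>

inductive trig :: "nat \<Rightarrow> ((nat \<Rightarrow> real) \<Rightarrow> real) \<Rightarrow> bool" for n where
  trig_cos: "trig n (\<lambda>x. cos ((\<Sum>t<n. a t * x t) + b))"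
| trig_add: "trig n f \<Longrightarrow> trig n g \<Longrightarrow> trig n (\<lambda>x. f x + g x)"
| trig_scale: "trig n f \<Longrightarrow> trig n (\<lambda>x. c * f x)"

lemma trig_const: "trig n (\<lambda>_. c)"
  using trig_scale[OF trig_cos[of n "\<lambda>_. 0" 0], of c] by simp

lemma trig_mult:
  assumes "trig n f" "trig n g"
  shows "trig n (\<lambda>x. f x * g x)"
  using assms(1)
proof induction
  case (trig_cos a b)
  from assms(2) show ?case
  proof induction
    case (trig_cos a' b')
    have "cos ((\<Sum>t<n. a t * x t) + b) * cos ((\<Sum>t<n. a' t * x t) + b') =
        1 / 2 * cos ((\<Sum>t<n. (a t - a' t) * x t) + (b - b')) +
        1 / 2 * cos ((\<Sum>t<n. (a t + a' t) * x t) + (b + b'))" for x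
      unfolding cos_times_cos by (simp add: sum.distrib sum_subtractf algebra_simps)
    then show ?case
      by (simp only:) (intro trig.trig_add trig.trig_scale trig.trig_cos)
  next
    case (trig_add f g)
    then show ?case by (auto simp: distrib_left intro: trig.trig_add)
  next
    case (trig_scale f c)
    then show ?case by (auto simp: mult.left_commute intro: trig.trig_scale)
  qed
next
  case (trig_add f g)
  then show ?case by (auto simp: distrib_right intro: trig.trig_add)
next
  case (trig_scale f c)
  then show ?case by (auto simp: mult.assoc intro: trig.trig_scale)
qed

lemma trig_prod:
  "(\<And>t. t < m \<Longrightarrow> trig n (f t)) \<Longrightarrow> trig n (\<lambda>x. \<Prod>t<(m::nat). f t x)"
  by (induction m) (auto intro: trig_const trig_mult)

lemma trig_sin:
  assumes "t < n"
  shows "trig n (\<lambda>x. sin (x t / L))"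
proof -
  have "(\<Sum>s<n. (if s = t then 1 / L else 0) * x s) = x t / L" for x :: "nat \<Rightarrow> real"
  proof -
    have "(\<Sum>s<n. (if s = t then 1 / L else 0) * x s) = (\<Sum>s<n. if s = t then x s / L else 0)"
      by (intro sum.cong) auto
    then show ?thesis using assms by simp
  qed
  then show ?thesis
    using trig_cos[of n "\<lambda>s. if s = t then 1 / L else 0" "- pi / 2"]
    by (simp add: cos_diff)
qed

lemma trig_bounded: "trig n f \<Longrightarrow> \<exists>B. \<forall>x. \<bar>f x\<bar> \<le> B"
proof (induction rule: trig.induct)
  case (trig_cos a b)
  then show ?case by (auto intro: exI[of _ 1])
next
  case (trig_add f g)
  then show ?case by (meson abs_triangle_ineq add_mono order_trans)
next
  case (trig_scale f c)
  then obtain B where "\<And>x. \<bar>f x\<bar> \<le> B" by auto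
  then have "\<bar>c * f x\<bar> \<le> \<bar>c\<bar> * B" for x by (simp add: abs_mult mult_left_mono)
  then show ?case by auto
qed

lemma trig_measurable:
  assumes "trig n f" "\<And>t. Z t \<in> borel_measurable N"
  shows "(\<lambda>\<omega>. f (\<lambda>t. Z t \<omega>)) \<in> borel_measurable N"
  using assms(1)
proof induction
  case (trig_cos a b)
  then show ?case using assms(2) by measurable
qed (auto intro: borel_measurable_add borel_measurable_times)

text \<open>The Newton-Schulz iteration for the sign: \<open>(3 * p - p ^ 3) / 2\<close> maps
  \<open>[-1, 1]\<close> to itself, fixes \<open>-1\<close>, \<open>0\<close> and \<open>1\<close>,
  and moves every other point of the interval toward the fixed point \<open>-1\<close> or
  \<open>1\<close> of its own sign.\<close>

primrec sgn_poly :: "nat \<Rightarrow> real \<Rightarrow> real" where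
  "sgn_poly 0 y = y"
| "sgn_poly (Suc j) y = (3 * sgn_poly j y - sgn_poly j y ^ 3) / 2"

lemma trig_sgn_poly: "trig n f \<Longrightarrow> trig n (\<lambda>x. sgn_poly j (f x))"
proof (induction j)
  case (Suc j)
  then have 1: "trig n (\<lambda>x. sgn_poly j (f x))" by simp
  have "trig n (\<lambda>x. 3 / 2 * sgn_poly j (f x) +
      (- 1 / 2) * (sgn_poly j (f x) * (sgn_poly j (f x) * sgn_poly j (f x))))"
    by (intro trig_add trig_scale trig_mult 1)
  then show ?case by (simp add: power3_eq_cube diff_divide_distrib mult.assoc)
qed simp

lemma sgn_poly_minus: "sgn_poly j (- y) = - sgn_poly j y"
  by (induction j) (simp_all add: power3_eq_cube field_simps)

text \<open>Each step multiplies the distance to one by \<open>1 - (p + p * p) / 2\<close>, which is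
  at most \<open>1 - y / 2\<close> as the iterates never fall below \<open>y\<close>.\<close>

lemma sgn_poly_pos:
  assumes "0 < y" "y \<le> 1"
  shows "y \<le> sgn_poly j y \<and> sgn_poly j y \<le> 1 \<and> 1 - sgn_poly j y \<le> (1 - y / 2) ^ j"
proof (induction j)
  case (Suc j)
  define p where "p = sgn_poly j y"
  have p: "y \<le> p" "p \<le> 1" "1 - p \<le> (1 - y / 2) ^ j" using Suc by (auto simp: p_def)
  have eq1: "1 - (3 * p - p ^ 3) / 2 = (1 - p) * (1 - (p + p * p) / 2)"
    by (simp add: power3_eq_cube field_simps)
  have eq2: "(3 * p - p ^ 3) / 2 - p = p * ((1 - p) * (1 + p)) / 2"
    by (simp add: power3_eq_cube field_simps)
  have pp: "0 \<le> p * p" "p * p \<le> 1" using p assms by (auto intro: mult_le_one)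
  have "0 \<le> p * ((1 - p) * (1 + p)) / 2" using p assms by auto
  then have a: "y \<le> (3 * p - p ^ 3) / 2" using p eq2 by linarith
  have "0 \<le> (1 - p) * (1 - (p + p * p) / 2)" using p pp by (intro mult_nonneg_nonneg) auto
  then have b: "(3 * p - p ^ 3) / 2 \<le> 1" using eq1 by linarith
  have "1 - (p + q) / 2 \<le> 1 - y / 2" "0 \<le> 1 - (p + q) / 2" if "0 \<le> q" "q \<le> 1" for q
    using p that by auto
  from this[OF pp] have "1 - (p + p * p) / 2 \<le> 1 - y / 2" "0 \<le> 1 - (p + p * p) / 2" .
  then have "(1 - p) * (1 - (p + p * p) / 2) \<le> (1 - y / 2) ^ j * (1 - y / 2)"
    using p assms by (intro mult_mono) auto
  then show ?case using a b eq1 by (simp add: p_def mult.commute)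
qed (use assms in auto)

lemma sgn_poly_limit:
  assumes "\<bar>y\<bar> \<le> 1" "y \<noteq> 0"
  shows "(\<lambda>j. (sgn_poly j y)\<^sup>2) \<longlonglongrightarrow> 1"
proof -
  define z where "z = \<bar>y\<bar>"
  have z: "0 < z" "z \<le> 1" using assms by (auto simp: z_def)
  have sq: "(sgn_poly j y)\<^sup>2 = (sgn_poly j z)\<^sup>2" for j
    using sgn_poly_minus[of j y] by (auto simp: z_def abs_real_def)
  have "(\<lambda>j. sgn_poly j z) \<longlonglongrightarrow> 1"
  proof (rule tendsto_sandwich)
    show "\<forall>\<^sub>F j in sequentially. 1 - (1 - z / 2) ^ j \<le> sgn_poly j z"
      "\<forall>\<^sub>F j in sequentially. sgn_poly j z \<le> 1"
      using sgn_poly_pos[OF z] by (auto intro!: always_eventually) (smt (verit))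
    have "(\<lambda>j. (1 - z / 2) ^ j) \<longlonglongrightarrow> 0" using z by (intro LIMSEQ_realpow_zero) auto
    from tendsto_diff[OF tendsto_const this, of 1] show "(\<lambda>j. 1 - (1 - z / 2) ^ j) \<longlonglongrightarrow> 1" by simp
  qed simp
  from tendsto_power[OF this, of 2] show ?thesis by (simp add: sq)
qed

lemma sgn_poly_abs_le: "\<bar>y\<bar> \<le> 1 \<Longrightarrow> \<bar>sgn_poly j y\<bar> \<le> 1"
proof -
  assume y: "\<bar>y\<bar> \<le> 1"
  consider "y = 0" | "0 < y" | "y < 0" by linarith
  then show ?thesis
  proof cases
    case 1
    have "sgn_poly j 0 = 0" by (induction j) auto
    then show ?thesis using 1 by simp
  next
    case 2
    then show ?thesis using sgn_poly_pos[of y j] y by auto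
  next
    case 3
    then show ?thesis using sgn_poly_pos[of "- y" j] y by (auto simp: sgn_poly_minus)
  qed
qed

text \<open>While \<open>\<bar>x\<bar> < pi * L\<close>, the sine has the sign of \<open>x\<close>,
  and a value \<open>p\<close> of the polynomial has error at most \<open>1 - p\<^sup>2\<close>.
  Beyond, the error is at most two and \<open>x\<^sup>2 / L\<^sup>2\<close> takes over. Both parts
  of the bound have controlled means: one is a trigonometric polynomial, the other a second
  moment.\<close>

lemma sgn_poly_sin_error:
  assumes "0 < L"
  shows "\<bar>sgn x - sgn_poly j (sin (x / L))\<bar> \<le> 1 - (sgn_poly j (sin (x / L)))\<^sup>2 + x\<^sup>2 / L\<^sup>2"
proof -
  have pos: "\<bar>1 - sgn_poly j (sin z)\<bar> \<le> 1 - (sgn_poly j (sin z))\<^sup>2 + z\<^sup>2" if z: "0 < z" for z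
  proof (cases "z < pi")
    case True
    then have "0 < sin z" "sin z \<le> 1" using z sin_gt_zero by auto
    from sgn_poly_pos[OF this, of j] this have "0 < sgn_poly j (sin z)" "sgn_poly j (sin z) \<le> 1" by auto
    then have "(sgn_poly j (sin z))\<^sup>2 \<le> sgn_poly j (sin z)" by (simp add: power2_eq_square mult_left_le)
    then show ?thesis using \<open>sgn_poly j (sin z) \<le> 1\<close> by (simp add: add_increasing2)
  next
    case False
    then have "2 \<le> z" using pi_ge_two by linarith
    then have "2 * 2 \<le> z * z" by (intro mult_mono) auto
    moreover have "\<bar>sgn_poly j (sin z)\<bar> \<le> 1" by (rule sgn_poly_abs_le) auto
    moreover from this have "(sgn_poly j (sin z))\<^sup>2 \<le> 1" by (simp add: abs_square_le_1)
    ultimately show ?thesis by (simp add: power2_eq_square abs_le_iff)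
  qed
  have eq: "x\<^sup>2 / L\<^sup>2 = (x / L)\<^sup>2" by (simp add: power_divide)
  consider "x = 0" | "0 < x" | "x < 0" by linarith
  then show ?thesis
  proof cases
    case 1
    have "sgn_poly j 0 = 0" by (induction j) auto
    then show ?thesis using 1 by simp
  next
    case 2
    then show ?thesis unfolding eq using pos[of "x / L"] assms by simp
  next
    case 3
    then show ?thesis unfolding eq using pos[of "- x / L"] assms
      by (simp add: sgn_poly_minus divide_neg_pos)
  qed
qed

text \<open>Averages over lists are finite sums and act on every function; this interface serves
  them without a probability space of their own.\<close>

definition mean_functional :: "(('a \<Rightarrow> real) \<Rightarrow> real) \<Rightarrow> bool" where
  "mean_functional E \<longleftrightarrow>
     (\<forall>f g. E (\<lambda>x. f x + g x) = E f + E g) \<and> (\<forall>c f. E (\<lambda>x. c * f x) = c * E f) \<and>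
     (\<forall>f g. (\<forall>x. f x \<le> g x) \<longrightarrow> E f \<le> E g) \<and> E (\<lambda>_. 1) = 1"

lemma
  assumes "mean_functional E"
  shows mean_add: "E (\<lambda>x. f x + g x) = E f + E g"
    and mean_scale: "E (\<lambda>x. c * f x) = c * E f"
    and mean_mono: "(\<And>x. f x \<le> g x) \<Longrightarrow> E f \<le> E g"
    and mean_const: "E (\<lambda>_. c) = c"
    and mean_diff: "E (\<lambda>x. f x - g x) = E f - E g"
proof -
  show a: "E (\<lambda>x. f x + g x) = E f + E g" and s: "E (\<lambda>x. c * f x) = c * E f" for f g c
    using assms unfolding mean_functional_def by auto
  show "(\<And>x. f x \<le> g x) \<Longrightarrow> E f \<le> E g" for f g using assms unfolding mean_functional_def by auto
  have one: "E (\<lambda>_. 1) = 1" using assms unfolding mean_functional_def by auto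
  show "E (\<lambda>_. c) = c" for c using s[of c "\<lambda>_. 1"] one by simp
  show "E (\<lambda>x. f x - g x) = E f - E g" for f g
    using a[of f "\<lambda>x. - 1 * g x"] s[of "- 1" g] by simp
qed

lemma mean_sum:
  assumes "mean_functional E"
  shows "E (\<lambda>x. \<Sum>t<n. f t x) = (\<Sum>t<(n::nat). E (f t))"
  by (induction n) (simp_all add: mean_add[OF assms] mean_const[OF assms])

lemma mean_abs_diff:
  assumes "mean_functional E" "\<And>x. \<bar>f x - g x\<bar> \<le> h x"
  shows "\<bar>E f - E g\<bar> \<le> E h"
proof -
  have "E (\<lambda>x. f x - g x) \<le> E h" "E (\<lambda>x. - 1 * h x) \<le> E (\<lambda>x. f x - g x)"
    by (intro mean_mono[OF assms(1)]; use assms(2) in \<open>smt (verit)\<close>)+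
  then show ?thesis unfolding mean_diff[OF assms(1)] mean_scale[OF assms(1)] by linarith
qed

lemma iid_mean_mean_functional:
  assumes "\<And>y. y \<in> A \<Longrightarrow> 0 \<le> \<nu> y" "sum \<nu> A = 1"
  shows "mean_functional (\<lambda>f. iid_mean \<nu> A n (\<lambda>ys. f (X ys)))"
  unfolding mean_functional_def
  by (auto simp: iid_mean_add iid_mean_cmult iid_mean_const assms intro!: iid_mean_mono)

section \<open>Convergence of means of trigonometric polynomials and sign products\<close>

context prob_space
begin

lemma trig_convergence:
  assumes mean: "\<forall>\<^sub>F k in sequentially. mean_functional (E k)"
    and cos: "\<And>a b. (\<lambda>k. E k (\<lambda>x. cos ((\<Sum>t<n. a t * x t) + b)))
        \<longlonglongrightarrow> (\<integral>\<omega>. cos ((\<Sum>t<n. a t * Z t \<omega>) + b) \<partial>M)"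
    and Z: "\<And>t. Z t \<in> borel_measurable M"
    and f: "trig n f"
  shows "(\<lambda>k. E k f) \<longlonglongrightarrow> (\<integral>\<omega>. f (\<lambda>t. Z t \<omega>) \<partial>M)"
  using f
proof induction
  have int: "integrable M (\<lambda>\<omega>. f (\<lambda>t. Z t \<omega>))" if f: "trig n f" for f
  proof -
    obtain B where "\<And>x. \<bar>f x\<bar> \<le> B" using trig_bounded[OF f] by auto
    then show ?thesis
      by (intro integrable_const_bound[of _ B] trig_measurable[OF f] Z) auto
  qed
  {
    case (trig_cos a b)
    show ?case by (rule cos)
  next
    case (trig_add f g)
    have "(\<lambda>k. E k f + E k g) \<longlonglongrightarrow> (\<integral>\<omega>. f (\<lambda>t. Z t \<omega>) + g (\<lambda>t. Z t \<omega>) \<partial>M)"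
      using trig_add by (auto intro!: tendsto_add simp: int)
    then show ?case
      by (rule Lim_transform_eventually) (use mean in eventually_elim, simp add: mean_add)
  next
    case (trig_scale f c)
    have "(\<lambda>k. c * E k f) \<longlonglongrightarrow> (\<integral>\<omega>. c * f (\<lambda>t. Z t \<omega>) \<partial>M)"
      using trig_scale by (auto intro!: tendsto_mult)
    then show ?case
      by (rule Lim_transform_eventually) (use mean in eventually_elim, simp add: mean_scale)
  }
qed

text \<open>The order of the choices matters: \<open>L\<close> makes the second moments harmless
  uniformly in \<open>k\<close>, then \<open>j\<close> is fixed by the limit variables alone, and
  the error bound, trigonometric up to the moments, carries over to large \<open>k\<close>. Absence
  of atoms keeps the limit variables off the zeros of the sine, where the squares of the polynomials
  do not tend to one.\<close>

lemma sgn_product_convergence: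
  fixes n :: nat
  assumes mean: "\<forall>\<^sub>F k in sequentially. mean_functional (E k)"
    and cos: "\<And>a b. (\<lambda>k. E k (\<lambda>x. cos ((\<Sum>t<n. a t * x t) + b)))
        \<longlonglongrightarrow> (\<integral>\<omega>. cos ((\<Sum>t<n. a t * Z t \<omega>) + b) \<partial>M)"
    and moment: "\<And>t. t < n \<Longrightarrow> \<forall>\<^sub>F k in sequentially. E k (\<lambda>x. (x t)\<^sup>2) \<le> B"
    and Z: "\<And>t. Z t \<in> borel_measurable M"
    and Z2: "\<And>t. t < n \<Longrightarrow> integrable M (\<lambda>\<omega>. (Z t \<omega>)\<^sup>2)"
    and no_atoms: "\<And>t r. t < n \<Longrightarrow> AE \<omega> in M. Z t \<omega> \<noteq> r"
    and y: "\<And>t. t < n \<Longrightarrow> \<bar>y t\<bar> \<le> (1 :: real)"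
  shows "(\<lambda>k. E k (\<lambda>x. \<Prod>t<n. (1 + y t * sgn (x t)) / 2))
    \<longlonglongrightarrow> (\<integral>\<omega>. (\<Prod>t<n. (1 + y t * sgn (Z t \<omega>)) / 2) \<partial>M)"
proof (rule tendstoI)
  fix e :: real assume "0 < e"
  \<comment> \<open>The error is \<open>2 * \<delta>\<close> for \<open>E k\<close>,
    \<open>2 * \<delta>\<close> for the limit and \<open>\<delta>\<close> for the trigonometric
    comparison, five sixths of \<open>e\<close>.\<close>
  define \<delta> where "\<delta> = e / 6"
  have \<delta>: "0 < \<delta>" using \<open>0 < e\<close> by (simp add: \<delta>_def)
  define B' where "B' = (\<Sum>t<n. \<bar>B\<bar> + (\<integral>\<omega>. (Z t \<omega>)\<^sup>2 \<partial>M))"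
  have B'0: "0 \<le> B'" by (auto simp: B'_def intro!: sum_nonneg add_nonneg_nonneg)
  define L where "L = sqrt ((B' + 1) / \<delta>)"
  have L: "0 < L" "L\<^sup>2 = (B' + 1) / \<delta>" using B'0 \<delta> by (auto simp: L_def)
  have BL: "B' / L\<^sup>2 \<le> \<delta>" using B'0 \<delta> by (simp add: L(2) field_simps mult_right_mono)
  define p where "p = (\<lambda>j (x::real). sgn_poly j (sin (x / L)))"
  have p1: "\<bar>p j x\<bar> \<le> 1" for j x unfolding p_def by (rule sgn_poly_abs_le) auto
  have p2: "(p j x)\<^sup>2 \<le> 1" for j x using p1[of j x] by (simp add: abs_square_le_1)
  have pm: "(\<lambda>\<omega>. p j (Z t \<omega>)) \<in> borel_measurable M" if "t < n" for j t
    unfolding p_def by (rule trig_measurable[OF trig_sgn_poly[OF trig_sin[OF that]] Z])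
  have "(\<lambda>j. (\<integral>\<omega>. (p j (Z t \<omega>))\<^sup>2 \<partial>M)) \<longlonglongrightarrow> (\<integral>\<omega>. 1 \<partial>M)" if t: "t < n" for t
  proof (rule integral_dominated_convergence[where w = "\<lambda>_. 1"])
    have "AE \<omega> in M. \<forall>i::int. Z t \<omega> \<noteq> of_int i * pi * L"
      unfolding AE_all_countable using no_atoms[OF t] by auto
    then show "AE \<omega> in M. (\<lambda>j. (p j (Z t \<omega>))\<^sup>2) \<longlonglongrightarrow> 1"
    proof eventually_elim
      case (elim \<omega>)
      have "sin (Z t \<omega> / L) \<noteq> 0"
      proof
        assume "sin (Z t \<omega> / L) = 0"
        then obtain i :: int where "Z t \<omega> / L = of_int i * pi" using sin_zero_iff_int2 by blast
        then have "Z t \<omega> = of_int i * pi * L" using L by (simp add: field_simps)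
        then show False using elim by blast
      qed
      then show ?case unfolding p_def by (intro sgn_poly_limit) auto
    qed
  qed (use pm[OF t] p2 in \<open>auto\<close>)
  then have "(\<lambda>j. \<Sum>t<n. 1 - (\<integral>\<omega>. (p j (Z t \<omega>))\<^sup>2 \<partial>M)) \<longlonglongrightarrow> (\<Sum>t<n. 1 - 1)"
    by (intro tendsto_sum tendsto_diff tendsto_const) (auto simp: prob_space)
  then have "\<forall>\<^sub>F j in sequentially. (\<Sum>t<n. 1 - (\<integral>\<omega>. (p j (Z t \<omega>))\<^sup>2 \<partial>M)) < \<delta>"
    using \<delta> by (intro order_tendstoD) auto
  then obtain j where j: "(\<Sum>t<n. 1 - (\<integral>\<omega>. (p j (Z t \<omega>))\<^sup>2 \<partial>M)) < \<delta>"
    using eventually_happens'[OF sequentially_bot] by blast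
  define g where "g = (\<lambda>x :: nat \<Rightarrow> real. \<Prod>t<n. (1 + y t * sgn (x t)) / 2)"
  define g' where "g' = (\<lambda>x :: nat \<Rightarrow> real. \<Prod>t<n. 1 / 2 + y t / 2 * p j (x t))"
  define err where "err = (\<lambda>t (x :: nat \<Rightarrow> real). (1 - (p j (x t))\<^sup>2) + 1 / L\<^sup>2 * (x t)\<^sup>2)"
  have fac: "\<bar>(1 + y t * s) / 2\<bar> \<le> 1" if "t < n" "\<bar>s\<bar> \<le> 1" for t s
  proof -
    have "\<bar>y t * s\<bar> \<le> 1" unfolding abs_mult using y[OF that(1)] that(2) by (intro mult_le_one) auto
    then show ?thesis by auto
  qed
  have gg: "\<bar>g x - g' x\<bar> \<le> (\<Sum>t<n. err t x)" for x :: "nat \<Rightarrow> real"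
  proof -
    have "\<bar>g x - g' x\<bar> \<le> (\<Sum>t<n. \<bar>(1 + y t * sgn (x t)) / 2 - (1 + y t * p j (x t)) / 2\<bar>)"
    proof -
      have "g' x = (\<Prod>t<n. (1 + y t * p j (x t)) / 2)" by (simp add: g'_def add_divide_distrib)
      moreover have "norm ((\<Prod>t<n. (1 + y t * sgn (x t)) / 2) - (\<Prod>t<n. (1 + y t * p j (x t)) / 2)) \<le>
          (\<Sum>t<n. norm ((1 + y t * sgn (x t)) / 2 - (1 + y t * p j (x t)) / 2))"
      proof (rule norm_prod_diff)
        fix t assume "t \<in> {..<n}"
        then show "norm ((1 + y t * sgn (x t)) / 2) \<le> 1" "norm ((1 + y t * p j (x t)) / 2) \<le> 1"
          unfolding real_norm_def by (intro fac p1; simp add: sgn_real_def)+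
      qed
      ultimately show ?thesis by (simp add: g_def)
    qed
    also have "\<dots> \<le> (\<Sum>t<n. err t x)"
    proof (rule sum_mono)
      fix t assume "t \<in> {..<n}"
      have "\<bar>(1 + y t * sgn (x t)) / 2 - (1 + y t * p j (x t)) / 2\<bar> = \<bar>y t\<bar> / 2 * \<bar>sgn (x t) - p j (x t)\<bar>"
        by (simp add: abs_mult flip: diff_divide_distrib right_diff_distrib)
      also have "\<dots> \<le> 1 * \<bar>sgn (x t) - p j (x t)\<bar>"
        using y[of t] \<open>t \<in> {..<n}\<close> by (intro mult_right_mono) auto
      also have "\<dots> \<le> err t x" using sgn_poly_sin_error[OF L(1), of "x t" j] by (simp add: err_def p_def)
      finally show "\<bar>(1 + y t * sgn (x t)) / 2 - (1 + y t * p j (x t)) / 2\<bar> \<le> err t x" .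
    qed
    finally show ?thesis .
  qed
  have tr: "trig n (\<lambda>x. p j (x t))" if "t < n" for t
    unfolding p_def by (intro trig_sgn_poly trig_sin that)
  have trg: "trig n g'"
    unfolding g'_def by (intro trig_prod trig_add trig_const trig_scale tr)
  have cg: "(\<lambda>k. E k g') \<longlonglongrightarrow> (\<integral>\<omega>. g' (\<lambda>t. Z t \<omega>) \<partial>M)"
    by (rule trig_convergence[OF mean cos Z trg])
  have "(\<lambda>k. E k (\<lambda>x. (p j (x t))\<^sup>2)) \<longlonglongrightarrow> (\<integral>\<omega>. (p j (Z t \<omega>))\<^sup>2 \<partial>M)" if "t < n" for t
    using trig_convergence[OF mean cos Z trig_mult[OF tr[OF that] tr[OF that]]]
    by (simp add: power2_eq_square)
  then have "(\<lambda>k. \<Sum>t<n. 1 - E k (\<lambda>x. (p j (x t))\<^sup>2)) \<longlonglongrightarrow> (\<Sum>t<n. 1 - (\<integral>\<omega>. (p j (Z t \<omega>))\<^sup>2 \<partial>M))"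
    by (intro tendsto_sum tendsto_diff tendsto_const) auto
  then have ev1: "\<forall>\<^sub>F k in sequentially. (\<Sum>t<n. 1 - E k (\<lambda>x. (p j (x t))\<^sup>2)) < \<delta>"
    using j by (intro order_tendstoD)
  have ev2: "\<forall>\<^sub>F k in sequentially. \<bar>E k g' - (\<integral>\<omega>. g' (\<lambda>t. Z t \<omega>) \<partial>M)\<bar> < \<delta>"
    using tendstoD[OF cg \<delta>] by (simp add: dist_real_def)
  have ev3: "\<forall>\<^sub>F k in sequentially. \<forall>t\<in>{..<n}. E k (\<lambda>x. (x t)\<^sup>2) \<le> B"
    by (intro eventually_ball_finite) (auto intro: moment)
  have ig: "integrable M (\<lambda>\<omega>. g (\<lambda>t. Z t \<omega>))"
  proof (rule integrable_const_bound[of _ 1])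
    show "(\<lambda>\<omega>. g (\<lambda>t. Z t \<omega>)) \<in> borel_measurable M"
      unfolding g_def using Z by measurable
    have "\<bar>g x\<bar> \<le> 1" for x
      unfolding g_def abs_prod by (intro prod_le_1 conjI fac; simp add: sgn_real_def)
    then show "AE \<omega> in M. norm (g (\<lambda>t. Z t \<omega>)) \<le> 1" by simp
  qed
  have ig': "integrable M (\<lambda>\<omega>. g' (\<lambda>t. Z t \<omega>))"
  proof -
    obtain b where "\<And>x. \<bar>g' x\<bar> \<le> b" using trig_bounded[OF trg] by auto
    then show ?thesis by (intro integrable_const_bound[of _ b] trig_measurable[OF trg] Z) auto
  qed
  have ip: "integrable M (\<lambda>\<omega>. (p j (Z t \<omega>))\<^sup>2)" if "t < n" for t
    by (rule integrable_const_bound[of _ 1]) (use pm[OF that] p2 in auto)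
  have ierr: "integrable M (\<lambda>\<omega>. err t (\<lambda>t. Z t \<omega>))" if "t < n" for t
    unfolding err_def using ip[OF that] Z2[OF that] by (intro Bochner_Integration.integrable_add Bochner_Integration.integrable_diff) auto
  have lim: "\<bar>(\<integral>\<omega>. g (\<lambda>t. Z t \<omega>) \<partial>M) - (\<integral>\<omega>. g' (\<lambda>t. Z t \<omega>) \<partial>M)\<bar> \<le> 2 * \<delta>"
  proof -
    have "\<bar>(\<integral>\<omega>. g (\<lambda>t. Z t \<omega>) \<partial>M) - (\<integral>\<omega>. g' (\<lambda>t. Z t \<omega>) \<partial>M)\<bar> =
        \<bar>\<integral>\<omega>. g (\<lambda>t. Z t \<omega>) - g' (\<lambda>t. Z t \<omega>) \<partial>M\<bar>"
      by (simp add: Bochner_Integration.integral_diff[OF ig ig'])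
    also have "\<dots> \<le> (\<integral>\<omega>. \<bar>g (\<lambda>t. Z t \<omega>) - g' (\<lambda>t. Z t \<omega>)\<bar> \<partial>M)"
      by (rule integral_abs_bound)
    also have "\<dots> \<le> (\<integral>\<omega>. (\<Sum>t<n. err t (\<lambda>t. Z t \<omega>)) \<partial>M)"
      using ig ig' ierr gg by (intro integral_mono Bochner_Integration.integrable_sum integrable_abs Bochner_Integration.integrable_diff) auto
    also have "\<dots> = (\<Sum>t<n. \<integral>\<omega>. err t (\<lambda>t. Z t \<omega>) \<partial>M)"
      using ierr by (intro Bochner_Integration.integral_sum) auto
    also have "\<dots> = (\<Sum>t<n. (1 - (\<integral>\<omega>. (p j (Z t \<omega>))\<^sup>2 \<partial>M)) + 1 / L\<^sup>2 * (\<integral>\<omega>. (Z t \<omega>)\<^sup>2 \<partial>M))"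
    proof (intro sum.cong refl)
      fix t assume t: "t \<in> {..<n}"
      then have "integrable M (\<lambda>\<omega>. 1 - (p j (Z t \<omega>))\<^sup>2)" "integrable M (\<lambda>\<omega>. 1 / L\<^sup>2 * (Z t \<omega>)\<^sup>2)"
        using ip Z2 by auto
      then show "(\<integral>\<omega>. err t (\<lambda>t. Z t \<omega>) \<partial>M) = (1 - (\<integral>\<omega>. (p j (Z t \<omega>))\<^sup>2 \<partial>M)) + 1 / L\<^sup>2 * (\<integral>\<omega>. (Z t \<omega>)\<^sup>2 \<partial>M)"
        unfolding err_def using ip t by (simp add: prob_space)
    qed
    also have "\<dots> = (\<Sum>t<n. 1 - (\<integral>\<omega>. (p j (Z t \<omega>))\<^sup>2 \<partial>M)) + (\<Sum>t<n. (\<integral>\<omega>. (Z t \<omega>)\<^sup>2 \<partial>M)) / L\<^sup>2"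
      by (simp add: sum.distrib sum_divide_distrib)
    also have "(\<Sum>t<n. (\<integral>\<omega>. (Z t \<omega>)\<^sup>2 \<partial>M)) / L\<^sup>2 \<le> B' / L\<^sup>2"
      unfolding B'_def by (intro divide_right_mono sum_mono) auto
    finally show ?thesis using j BL by linarith
  qed
  have "\<forall>\<^sub>F k in sequentially. \<bar>E k g - (\<integral>\<omega>. g (\<lambda>t. Z t \<omega>) \<partial>M)\<bar> < e"
    using mean ev1 ev2 ev3
  proof eventually_elim
    case (elim k)
    note E = elim(1)
    have "\<bar>E k g - E k g'\<bar> \<le> E k (\<lambda>x. \<Sum>t<n. err t x)"
      by (rule mean_abs_diff[OF E gg])
    also have "\<dots> = (\<Sum>t<n. (1 - E k (\<lambda>x. (p j (x t))\<^sup>2)) + 1 / L\<^sup>2 * E k (\<lambda>x. (x t)\<^sup>2))"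
      unfolding mean_sum[OF E] err_def mean_add[OF E] mean_diff[OF E] mean_const[OF E] mean_scale[OF E] ..
    also have "\<dots> = (\<Sum>t<n. 1 - E k (\<lambda>x. (p j (x t))\<^sup>2)) + (\<Sum>t<n. E k (\<lambda>x. (x t)\<^sup>2)) / L\<^sup>2"
      by (simp add: sum.distrib sum_divide_distrib)
    also have "(\<Sum>t<n. E k (\<lambda>x. (x t)\<^sup>2)) / L\<^sup>2 \<le> B' / L\<^sup>2"
      unfolding B'_def
    proof (intro divide_right_mono sum_mono)
      fix t assume "t \<in> {..<n}"
      then have "E k (\<lambda>x. (x t)\<^sup>2) \<le> B" using elim(4) by blast
      moreover have "0 \<le> (\<integral>\<omega>. (Z t \<omega>)\<^sup>2 \<partial>M)" by simp
      ultimately show "E k (\<lambda>x. (x t)\<^sup>2) \<le> \<bar>B\<bar> + (\<integral>\<omega>. (Z t \<omega>)\<^sup>2 \<partial>M)" by linarith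
    qed simp
    finally have "\<bar>E k g - E k g'\<bar> < 2 * \<delta>" using elim(2) BL by linarith
    then show ?case using elim(3) lim \<delta> unfolding \<delta>_def by linarith
  qed
  then show "\<forall>\<^sub>F k in sequentially. dist (E k (\<lambda>x. \<Prod>t<n. (1 + y t * sgn (x t)) / 2))
      (\<integral>\<omega>. (\<Prod>t<n. (1 + y t * sgn (Z t \<omega>)) / 2) \<partial>M) < e"
    by (simp add: dist_real_def g_def)
qed

end

section \<open>The central limit theorem for votes\<close>

lemma iid_mean_cos:
  "iid_mean \<nu> A N (\<lambda>ys. cos (\<theta> + wsum \<phi> ys)) = Re (cis \<theta> * (\<Sum>y\<in>A. of_real (\<nu> y) * cis (\<phi> y)) ^ N)"
proof (induction N arbitrary: \<theta>)
  case (Suc N)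
  let ?P = "\<Sum>y\<in>A. of_real (\<nu> y) * cis (\<phi> y)"
  have "iid_mean \<nu> A (Suc N) (\<lambda>ys. cos (\<theta> + wsum \<phi> ys)) =
      (\<Sum>y\<in>A. \<nu> y * iid_mean \<nu> A N (\<lambda>ys. cos ((\<theta> + \<phi> y) + wsum \<phi> ys)))"
    by (simp add: add.assoc)
  also have "\<dots> = (\<Sum>y\<in>A. Re (cis \<theta> * ?P ^ N * (of_real (\<nu> y) * cis (\<phi> y))))"
    unfolding Suc by (intro sum.cong) (auto simp: cis_mult[symmetric] algebra_simps)
  also have "\<dots> = Re (cis \<theta> * ?P ^ N * ?P)"
    unfolding sum_distrib_left Re_sum ..
  finally show ?case by (simp add: mult_ac)
qed simp

lemma cis_expansion: "cmod (cis x - Complex (1 - x\<^sup>2 / 2) x) \<le> \<bar>x\<bar> ^ 3 / 6"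
proof -
  have "(\<Sum>k\<le>2. (\<i> * of_real x) ^ k / fact k) = Complex (1 - x\<^sup>2 / 2) x"
    by (simp add: numeral_2_eq_2 complex_eq_iff)
  then show ?thesis using iexp_approx1[of x 2] by (simp add: cis_conv_exp eval_nat_numeral)
qed

text \<open>The weights vary with \<open>k\<close>, so this is a limit for triangular arrays. Both
  \<open>\<phi> k\<close> and \<open>v k = exp (z / k)\<close> lie in the unit disc, so their powers
  differ by at most \<open>k * cmod (\<phi> k - v k)\<close>. This vanishes because
  \<open>k * (\<phi> k - 1)\<close> and \<open>k * (v k - 1)\<close> have the same limit
  \<open>z\<close>; no complex logarithm is involved.\<close>

lemma char_power_limit:
  fixes \<nu> :: "nat \<Rightarrow> 'a \<Rightarrow> real" and \<theta> :: "'a \<Rightarrow> real" and N :: "nat \<Rightarrow> nat"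
  assumes fin: "finite A" and nonneg: "\<And>k y. y \<in> A \<Longrightarrow> 0 \<le> \<nu> k y"
    and one: "\<forall>\<^sub>F k in sequentially. sum (\<nu> k) A = 1"
    and m: "(\<lambda>k. sqrt k * (\<Sum>y\<in>A. \<nu> k y * \<theta> y)) \<longlonglongrightarrow> m"
    and V: "(\<lambda>k. \<Sum>y\<in>A. \<nu> k y * (\<theta> y)\<^sup>2) \<longlonglongrightarrow> V"
    and N: "\<And>k. N k \<le> k" "(\<lambda>k. real (N k) / k) \<longlonglongrightarrow> 1"
  shows "(\<lambda>k. (\<Sum>y\<in>A. of_real (\<nu> k y) * cis (\<theta> y / sqrt k)) ^ N k) \<longlonglongrightarrow> exp (Complex (- V / 2) m)"
proof -
  define \<phi> where "\<phi> = (\<lambda>k::nat. \<Sum>y\<in>A. of_real (\<nu> k y) * cis (\<theta> y / sqrt k))"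
  define z where "z = Complex (- V / 2) m"
  define v where "v = (\<lambda>k::nat. exp (z * of_real (1 / k)))"
  define w where "w = (\<lambda>k::nat. Complex (- (\<Sum>y\<in>A. \<nu> k y * (\<theta> y)\<^sup>2) / 2) (sqrt k * (\<Sum>y\<in>A. \<nu> k y * \<theta> y)))"
  have V0: "0 \<le> V"
    by (rule LIMSEQ_le_const[OF V]) (intro exI allI impI sum_nonneg mult_nonneg_nonneg nonneg; simp)
  have w: "w \<longlonglongrightarrow> z" unfolding w_def z_def by (intro tendsto_Complex tendsto_intros m V) auto
  \<comment> \<open>\<open>w k\<close> collects the terms of first and second order of the
    exponential; the remainder of third order, multiplied by \<open>k\<close>, is
    \<open>O(1 / sqrt k)\<close>.\<close>
  have "(\<lambda>k. of_nat k * (\<phi> k - 1) - w k) \<longlonglongrightarrow> 0"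
  proof (rule Lim_null_comparison)
    show "(\<lambda>k. (\<Sum>y\<in>A. \<bar>\<theta> y\<bar> ^ 3) / sqrt k) \<longlonglongrightarrow> 0"
    proof -
      have "(\<lambda>k::nat. 1 / sqrt k) \<longlonglongrightarrow> 0" by real_asymp
      from tendsto_mult_left[OF this, of "\<Sum>y\<in>A. \<bar>\<theta> y\<bar> ^ 3"] show ?thesis by simp
    qed
    show "\<forall>\<^sub>F k in sequentially. cmod (of_nat k * (\<phi> k - 1) - w k) \<le> (\<Sum>y\<in>A. \<bar>\<theta> y\<bar> ^ 3) / sqrt k"
      using one eventually_gt_at_top[of 0]
    proof eventually_elim
      case (elim k)
      have s: "sqrt k * sqrt k = k" "0 < sqrt k" using elim by auto
      have "of_nat k * (\<phi> k - 1) - w k =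
        (\<Sum>y\<in>A. of_real (k * \<nu> k y) * (cis (\<theta> y / sqrt k) - Complex (1 - (\<theta> y / sqrt k)\<^sup>2 / 2) (\<theta> y / sqrt k)))"
      proof -
        have "(\<Sum>y\<in>A. of_real (k * \<nu> k y) * Complex (1 - (\<theta> y / sqrt k)\<^sup>2 / 2) (\<theta> y / sqrt k)) =
           (\<Sum>y\<in>A. Complex (k * \<nu> k y - \<nu> k y * (\<theta> y)\<^sup>2 / 2) (sqrt k * (\<nu> k y * \<theta> y)))"
          using s by (intro sum.cong) (auto simp: complex_eq_iff field_simps power_divide)
        also have "\<dots> = of_nat k + w k"
          using elim by (simp add: w_def complex_eq_iff sum_subtractf flip: sum_distrib_left sum_divide_distrib)
        finally show ?thesis
          by (simp add: \<phi>_def right_diff_distrib sum_subtractf sum_distrib_left mult.assoc)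
      qed
      also have "cmod \<dots> \<le> (\<Sum>y\<in>A. \<bar>\<theta> y\<bar> ^ 3 / sqrt k)"
      proof (rule sum_norm_le)
        fix y assume y: "y \<in> A"
        have "\<nu> k y \<le> sum (\<nu> k) A" using nonneg fin y by (intro member_le_sum) auto
        then have n: "0 \<le> \<nu> k y" "\<nu> k y \<le> 1" using elim nonneg y by auto
        have "cmod (of_real (k * \<nu> k y) * (cis (\<theta> y / sqrt k) - Complex (1 - (\<theta> y / sqrt k)\<^sup>2 / 2) (\<theta> y / sqrt k)))
            \<le> (k * \<nu> k y) * (\<bar>\<theta> y / sqrt k\<bar> ^ 3 / 6)"
          unfolding norm_mult norm_of_real
          by (intro mult_mono cis_expansion) (use n in \<open>auto simp: abs_mult\<close>)
        also have "\<dots> = \<nu> k y * (\<bar>\<theta> y\<bar> ^ 3 / sqrt k) / 6"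
          using s by (simp add: power_divide power3_eq_cube field_simps)
        also have "\<dots> \<le> 1 * (\<bar>\<theta> y\<bar> ^ 3 / sqrt k) / 1"
          using n s by (intro frac_le mult_mono) auto
        finally show "cmod (of_real (k * \<nu> k y) * (cis (\<theta> y / sqrt k) -
          Complex (1 - (\<theta> y / sqrt k)\<^sup>2 / 2) (\<theta> y / sqrt k))) \<le> \<bar>\<theta> y\<bar> ^ 3 / sqrt k" by simp
      qed
      finally show ?case by (simp add: sum_divide_distrib)
    qed
  qed
  from tendsto_add[OF this w] have c1: "(\<lambda>k. of_nat k * (\<phi> k - 1)) \<longlonglongrightarrow> z" by simp
  have "((\<lambda>x. exp (z * x)) has_field_derivative z) (at 0)"
    by (auto intro!: derivative_eq_intros)
  then have "((\<lambda>x. (exp (z * x) - 1) / x) \<longlongrightarrow> z) (at 0)"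
    by (simp add: has_field_derivative_iff)
  moreover have "filterlim (\<lambda>k::nat. complex_of_real (1 / k)) (at 0) sequentially"
  proof (rule filterlim_atI)
    have "(\<lambda>k::nat. 1 / real k) \<longlonglongrightarrow> 0" by real_asymp
    from tendsto_of_real[OF this, where 'a = complex] show "(\<lambda>k::nat. complex_of_real (1 / k)) \<longlonglongrightarrow> 0" by simp
    show "\<forall>\<^sub>F k::nat in sequentially. complex_of_real (1 / k) \<noteq> 0"
      using eventually_gt_at_top[of 0] by eventually_elim auto
  qed
  ultimately have "(\<lambda>k::nat. (exp (z * complex_of_real (1 / k)) - 1) / complex_of_real (1 / k)) \<longlonglongrightarrow> z"
    by (rule filterlim_compose)
  then have c2: "(\<lambda>k. of_nat k * (v k - 1)) \<longlonglongrightarrow> z"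
    by (simp add: v_def divide_inverse mult.commute)
  have "(\<lambda>k. \<phi> k ^ N k - v k ^ N k) \<longlonglongrightarrow> 0"
  proof (rule Lim_null_comparison)
    from tendsto_norm[OF tendsto_diff[OF c1 c2]]
    show "(\<lambda>k. cmod (of_nat k * (\<phi> k - 1) - of_nat k * (v k - 1))) \<longlonglongrightarrow> 0" by simp
    show "\<forall>\<^sub>F k in sequentially. cmod (\<phi> k ^ N k - v k ^ N k) \<le> cmod (of_nat k * (\<phi> k - 1) - of_nat k * (v k - 1))"
      using one
    proof eventually_elim
      case (elim k)
      have "cmod (\<phi> k) \<le> (\<Sum>y\<in>A. \<nu> k y)"
        unfolding \<phi>_def by (rule sum_norm_le) (simp add: norm_mult nonneg)
      then have p1: "cmod (\<phi> k) \<le> 1" using elim by simp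
      have v1: "cmod (v k) \<le> 1" using V0 by (simp add: v_def z_def)
      have "cmod (\<phi> k ^ N k - v k ^ N k) \<le> N k * cmod (\<phi> k - v k)"
        by (rule norm_power_diff[OF p1 v1])
      also have "\<dots> \<le> k * cmod (\<phi> k - v k)" using N by (intro mult_right_mono) auto
      also have "\<dots> = cmod (of_nat k * (\<phi> k - v k))" by (simp add: norm_mult)
      finally show ?case by (simp add: algebra_simps)
    qed
  qed
  moreover have "(\<lambda>k. v k ^ N k) \<longlonglongrightarrow> exp (z * of_real 1)"
  proof -
    have "v k ^ N k = exp (z * of_real (real (N k) / k))" for k
      by (simp add: v_def mult.commute flip: exp_of_nat_mult)
    then show ?thesis by (simp only:) (intro tendsto_intros N(2))
  qed
  ultimately have "(\<lambda>k. (\<phi> k ^ N k - v k ^ N k) + v k ^ N k) \<longlonglongrightarrow> 0 + exp (z * of_real 1)"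
    by (rule tendsto_add)
  then show ?thesis by (simp add: \<phi>_def z_def)
qed

section \<open>Gaussian noise and the limit of a vote\<close>

context effective_process
begin

lemma eta_linear_distributed:
  assumes "\<exists>t<n. a t \<noteq> 0"
  defines "V \<equiv> \<Sum>s<n. \<Sum>t<n. a s * a t * C s t"
  shows "0 < V" "distributed N lborel (\<lambda>\<omega>. \<Sum>t<n. a t * \<eta> t \<omega>) (normal_density 0 (sqrt V))"
  using pos_def gaussian[OF assms(1)] assms(1) unfolding pos_def_matrix_def V_def by blast+

lemma eta_distributed: "0 < C t t" "distributed N lborel (\<eta> t) (normal_density 0 (sqrt (C t t)))"
proof -
  let ?a = "\<lambda>s. if s = t then 1 else 0 :: real"
  have "\<exists>s<Suc t. ?a s \<noteq> 0" by auto
  note * = eta_linear_distributed[OF this]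
  have "(\<Sum>s<Suc t. ?a s * \<eta> s \<omega>) = \<eta> t \<omega>" for \<omega>
    by (subst sum.cong[OF refl, where h = "\<lambda>s. if s = t then \<eta> s \<omega> else 0"]) auto
  moreover have "(\<Sum>s<Suc t. \<Sum>r<Suc t. ?a s * ?a r * C s r) = C t t"
  proof -
    have "(\<Sum>r<Suc t. ?a s * ?a r * C s r) = (if s = t then C s t else 0)" for s
      by (subst sum.cong[OF refl, where h = "\<lambda>r. if r = t then (if s = t then C s t else 0) else 0"]) auto
    then show ?thesis by simp
  qed
  ultimately show "0 < C t t" "distributed N lborel (\<eta> t) (normal_density 0 (sqrt (C t t)))"
    using * by simp_all
qed

lemma eta_measurable [measurable]: "\<eta> t \<in> borel_measurable N"
  using distributed_measurable[OF eta_distributed(2)[of t]] by simp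

lemma eta_no_atoms: "AE \<omega> in N. \<eta> t \<omega> \<noteq> r"
proof -
  have "AE x in density lborel (normal_density 0 (sqrt (C t t))). x \<noteq> r"
    using AE_lborel_singleton[of r] by (subst AE_density) (auto elim: eventually_mono)
  then have "AE x in distr N lborel (\<eta> t). x \<noteq> r"
    unfolding distributed_distr_eq_density[OF eta_distributed(2)] .
  then show ?thesis by (subst (asm) AE_distr_iff) auto
qed

lemma eta_moments: "integrable N (\<lambda>\<omega>. \<eta> t \<omega> ^ j)"
proof -
  have "integrable lborel (\<lambda>x. normal_density 0 (sqrt (C t t)) x * (x - 0) ^ j)"
    by (intro integrable_normal_moment) (simp add: eta_distributed)
  then show ?thesis
    by (subst distributed_integrable[OF eta_distributed(2), symmetric, where g = "\<lambda>x. x ^ j"]) auto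
qed

lemma eta_cos:
  "(\<integral>\<omega>. cos ((\<Sum>t<n. a t * \<eta> t \<omega>) + b) \<partial>N) = exp (- (\<Sum>s<n. \<Sum>t<n. a s * a t * C s t) / 2) * cos b"
proof (cases "\<exists>t<n. a t \<noteq> 0")
  case False
  then show ?thesis by (simp add: prob_space)
next
  case True
  define V where "V = (\<Sum>s<n. \<Sum>t<n. a s * a t * C s t)"
  define X where "X = (\<lambda>\<omega>. \<Sum>t<n. a t * \<eta> t \<omega>)"
  have [measurable]: "X \<in> borel_measurable N" by (simp add: X_def)
  have V: "0 < V" and D: "distributed N lborel X (normal_density 0 (sqrt V))"
    using eta_linear_distributed[OF True] by (simp_all add: V_def X_def)
  have "distributed N lborel (\<lambda>\<omega>. (X \<omega> - 0) / sqrt V) std_normal_density"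
    using D V by (subst normal_standard_normal_convert[symmetric]) auto
  then have dY: "distr N lborel (\<lambda>\<omega>. X \<omega> / sqrt V) = std_normal_distribution"
    by (simp add: distributed_distr_eq_density)
  have "(\<integral>\<omega>. iexp (X \<omega>) \<partial>N) = (\<integral>\<omega>. iexp (sqrt V * (X \<omega> / sqrt V)) \<partial>N)" using V by simp
  also have "\<dots> = (\<integral>x. iexp (sqrt V * x) \<partial>distr N lborel (\<lambda>\<omega>. X \<omega> / sqrt V))"
    by (subst integral_distr) auto
  also have "\<dots> = char std_normal_distribution (sqrt V)" by (simp add: dY char_def)
  also have "\<dots> = of_real (exp (- V / 2))" using V by (simp add: char_std_normal_distribution)
  finally have iX: "(\<integral>\<omega>. iexp (X \<omega>) \<partial>N) = of_real (exp (- V / 2))" .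
  have int: "integrable N (\<lambda>\<omega>. cis b * iexp (X \<omega>))"
    by (rule integrable_const_bound[of _ 1]) (auto simp: norm_mult)
  have "(\<integral>\<omega>. cos (X \<omega> + b) \<partial>N) = (\<integral>\<omega>. Re (cis b * iexp (X \<omega>)) \<partial>N)"
    by (intro Bochner_Integration.integral_cong) (auto simp: cos_add cis_conv_exp[symmetric] mult.commute)
  also have "\<dots> = Re (cis b * (\<integral>\<omega>. iexp (X \<omega>) \<partial>N))"
    by (subst integral_Re[OF int]) simp
  finally have "(\<integral>\<omega>. cos (X \<omega> + b) \<partial>N) = exp (- V / 2) * cos b" unfolding iX by simp
  then show ?thesis unfolding V_def X_def .
qed

text \<open>A mean of about \<open>m t / sqrt k\<close> per sample and a field of about
  \<open>h t * sqrt k\<close> both survive the normalization of the sum, as shifts of the Gaussian.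
  Ties count one half in \<open>vote\<close> and disappear in the limit, where the shifted variables
  have no atoms.\<close>

lemma vote_limit:
  fixes \<nu> :: "nat \<Rightarrow> (nat \<Rightarrow> real) \<Rightarrow> real" and L :: "nat \<Rightarrow> nat" and m h :: "nat \<Rightarrow> real"
    and c :: "nat \<Rightarrow> nat \<Rightarrow> real"
  assumes nonneg: "\<And>k y. y \<in> paths n \<Longrightarrow> 0 \<le> \<nu> k y"
    and one: "\<forall>\<^sub>F k in sequentially. sum (\<nu> k) (paths n) = 1"
    and L: "\<And>k. L k \<le> k" "(\<lambda>k. real (L k) / k) \<longlonglongrightarrow> 1"
    and m: "\<And>t. t < n \<Longrightarrow> (\<lambda>k. sqrt k * (\<Sum>y\<in>paths n. \<nu> k y * y t)) \<longlonglongrightarrow> m t"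
    and cov: "\<And>s t. s < n \<Longrightarrow> t < n \<Longrightarrow> (\<lambda>k. \<Sum>y\<in>paths n. \<nu> k y * (y s * y t)) \<longlonglongrightarrow> C s t"
    and c: "\<And>t. t < n \<Longrightarrow> (\<lambda>k. c k t / sqrt k) \<longlonglongrightarrow> h t"
    and x: "\<And>t. t < n \<Longrightarrow> \<bar>x (Suc t)\<bar> \<le> 1"
  shows "(\<lambda>k. iid_mean (\<nu> k) (paths n) (L k) (vote n x (c k)))
    \<longlonglongrightarrow> (\<integral>\<omega>. (\<Prod>t<n. (1 + x (Suc t) * sgn (\<eta> t \<omega> + m t + h t)) / 2) \<partial>N)"
proof -
  define X where "X = (\<lambda>(k::nat) ys t. (c k t + psum ys t) / sqrt k)"
  define E where "E = (\<lambda>k (f :: (nat \<Rightarrow> real) \<Rightarrow> real). iid_mean (\<nu> k) (paths n) (L k) (\<lambda>ys. f (X k ys)))"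
  have "(\<lambda>k. E k (\<lambda>z. \<Prod>t<n. (1 + x (Suc t) * sgn (z t)) / 2))
    \<longlonglongrightarrow> (\<integral>\<omega>. (\<Prod>t<n. (1 + x (Suc t) * sgn (\<eta> t \<omega> + m t + h t)) / 2) \<partial>N)"
  \<comment> \<open>In the moment bound \<open>2 * (h t + m t)\<^sup>2\<close> stems from the mean,
    two from the fluctuations, and one is a margin; the sum over \<open>t\<close> makes the bound
    common to all times.\<close>
  proof (rule sgn_product_convergence[where Z = "\<lambda>t \<omega>. \<eta> t \<omega> + m t + h t" and B = "\<Sum>t<n. 2 * (h t + m t)\<^sup>2 + 3"])
    show "\<forall>\<^sub>F k in sequentially. mean_functional (E k)"
      using one by eventually_elim (auto simp: E_def intro!: iid_mean_mean_functional nonneg)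
    show "(\<lambda>\<omega>. \<eta> t \<omega> + m t + h t) \<in> borel_measurable N" for t by simp
    show "\<bar>x (Suc t)\<bar> \<le> 1" if "t < n" for t using x[OF that] .
    show "AE \<omega> in N. \<eta> t \<omega> + m t + h t \<noteq> r" for t r
      using eta_no_atoms[of t "r - m t - h t"] by eventually_elim auto
    show "integrable N (\<lambda>\<omega>. (\<eta> t \<omega> + m t + h t)\<^sup>2)" for t
    proof -
      have "integrable N (\<lambda>\<omega>. \<eta> t \<omega> ^ 2 + (2 * (m t + h t)) * \<eta> t \<omega> ^ 1 + (m t + h t)\<^sup>2)"
        using eta_moments[of t 2] eta_moments[of t 1] by (intro Bochner_Integration.integrable_add integrable_mult_right) auto
      then show ?thesis by (simp add: power2_eq_square algebra_simps)
    qed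
    show "\<forall>\<^sub>F k in sequentially. E k (\<lambda>z. (z t)\<^sup>2) \<le> (\<Sum>t<n. 2 * (h t + m t)\<^sup>2 + 3)" if t: "t < n" for t
    proof -
      define M where "M = (\<lambda>k::nat. sqrt k * (\<Sum>y\<in>paths n. \<nu> k y * y t))"
      have "(\<lambda>k. 2 * (c k t / sqrt k + real (L k) / k * M k)\<^sup>2 + 2 * (real (L k) / k))
         \<longlonglongrightarrow> 2 * (h t + 1 * m t)\<^sup>2 + 2 * 1"
        unfolding M_def by (intro tendsto_intros c m t L(2))
      moreover have "2 * (h t + 1 * m t)\<^sup>2 + 2 * 1 < 2 * (h t + m t)\<^sup>2 + 3" by simp
      ultimately have "\<forall>\<^sub>F k in sequentially. 2 * (c k t / sqrt k + real (L k) / k * M k)\<^sup>2 + 2 * (real (L k) / k)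
          < 2 * (h t + m t)\<^sup>2 + 3"
        by (rule order_tendstoD)
      then show ?thesis using one eventually_gt_at_top[of 0]
      proof eventually_elim
        case (elim k)
        let ?\<mu> = "\<Sum>y\<in>paths n. \<nu> k y * y t"
        have s: "0 < sqrt k" "(sqrt k)\<^sup>2 = k" using elim by auto
        have "E k (\<lambda>z. (z t)\<^sup>2) \<le> iid_mean (\<nu> k) (paths n) (L k)
            (\<lambda>ys. 2 * (c k t / sqrt k + real (L k) / k * M k)\<^sup>2 + 2 / k * (psum ys t - L k * ?\<mu>)\<^sup>2)"
          unfolding E_def
        proof (intro iid_mean_mono nonneg)
          fix ys
          define r where "r = sqrt k"
          have r: "0 < r" "real k = r * r" using s by (auto simp: r_def power2_eq_square)
          have "real (L k) / k * (r * ?\<mu>) = L k * ?\<mu> / r"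
            unfolding r(2) using r(1) by simp
          then have "X k ys t = (c k t / sqrt k + real (L k) / k * M k) + (psum ys t - L k * ?\<mu>) / sqrt k"
            unfolding X_def M_def r_def[symmetric] by (simp add: add_divide_distrib diff_divide_distrib)
          moreover have "(a + b)\<^sup>2 \<le> 2 * a\<^sup>2 + 2 * b\<^sup>2" for a b :: real
            using sum_squares_bound[of a b] by (simp add: power2_sum)
          moreover have "((psum ys t - L k * ?\<mu>) / sqrt k)\<^sup>2 = 1 / k * (psum ys t - L k * ?\<mu>)\<^sup>2"
            using s by (simp add: power_divide)
          ultimately show "(X k ys t)\<^sup>2 \<le> 2 * (c k t / sqrt k + real (L k) / k * M k)\<^sup>2 +
              2 / k * (psum ys t - L k * ?\<mu>)\<^sup>2"
            by (metis (no_types, lifting) mult.assoc times_divide_eq_right mult_1_right)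
        qed
        also have "\<dots> \<le> 2 * (c k t / sqrt k + real (L k) / k * M k)\<^sup>2 + 2 / k * L k"
          unfolding iid_mean_add iid_mean_cmult iid_mean_const[OF elim(2)]
          using psum_variance[OF elim(2) t] by (intro add_left_mono mult_left_mono) auto
        also have "\<dots> \<le> 2 * (h t + m t)\<^sup>2 + 3" using elim(1) by simp
        also have "\<dots> \<le> (\<Sum>t<n. 2 * (h t + m t)\<^sup>2 + 3)"
          using t by (intro member_le_sum) auto
        finally show ?case .
      qed
    qed
    show "(\<lambda>k. E k (\<lambda>z. cos ((\<Sum>t<n. a t * z t) + b)))
        \<longlonglongrightarrow> (\<integral>\<omega>. cos ((\<Sum>t<n. a t * (\<eta> t \<omega> + m t + h t)) + b) \<partial>N)" for a b
    proof -
      define \<theta> where "\<theta> = (\<lambda>y. \<Sum>t<n. a t * y t)"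
      define V where "V = (\<Sum>s<n. \<Sum>t<n. a s * a t * C s t)"
      define \<beta> where "\<beta> = (\<lambda>k::nat. (\<Sum>t<n. a t * (c k t / sqrt k)) + b)"
      have w: "wsum (\<lambda>y. \<theta> y / r) ys = (\<Sum>t<n. a t * (psum ys t / r))" for ys and r :: real
        by (induction ys) (auto simp: \<theta>_def sum_divide_distrib distrib_left add_divide_distrib sum.distrib)
      have E: "E k (\<lambda>z. cos ((\<Sum>t<n. a t * z t) + b)) =
          Re (cis (\<beta> k) * (\<Sum>y\<in>paths n. of_real (\<nu> k y) * cis (\<theta> y / sqrt k)) ^ L k)" for k
        unfolding iid_mean_cos[symmetric] E_def w
        by (intro iid_mean_cong arg_cong[where f = cos])
          (auto simp: X_def \<beta>_def add_divide_distrib distrib_left sum.distrib)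
      have l1: "(\<lambda>k. sqrt k * (\<Sum>y\<in>paths n. \<nu> k y * \<theta> y)) \<longlonglongrightarrow> (\<Sum>t<n. a t * m t)"
      proof -
        have "sqrt k * (\<Sum>y\<in>paths n. \<nu> k y * \<theta> y) = (\<Sum>t<n. a t * (sqrt k * (\<Sum>y\<in>paths n. \<nu> k y * y t)))" for k
          unfolding \<theta>_def sum_distrib_left by (subst sum.swap) (simp add: mult_ac)
        then show ?thesis by (simp only:) (intro tendsto_intros m; simp)
      qed
      have l2: "(\<lambda>k. \<Sum>y\<in>paths n. \<nu> k y * (\<theta> y)\<^sup>2) \<longlonglongrightarrow> V"
      proof -
        have "(\<Sum>y\<in>paths n. \<nu> k y * (\<theta> y)\<^sup>2) =
           (\<Sum>s<n. \<Sum>t<n. a s * a t * (\<Sum>y\<in>paths n. \<nu> k y * (y s * y t)))" for k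
        proof -
          have "(\<theta> y)\<^sup>2 = (\<Sum>s<n. \<Sum>t<n. (a s * y s) * (a t * y t))" for y
            by (simp add: \<theta>_def power2_eq_square sum_product)
          then have "(\<Sum>y\<in>paths n. \<nu> k y * (\<theta> y)\<^sup>2) =
            (\<Sum>y\<in>paths n. \<Sum>s<n. \<Sum>t<n. a s * a t * (\<nu> k y * (y s * y t)))"
            by (simp add: sum_distrib_left mult_ac)
          also have "\<dots> = (\<Sum>s<n. \<Sum>y\<in>paths n. \<Sum>t<n. a s * a t * (\<nu> k y * (y s * y t)))"
            by (rule sum.swap)
          also have "\<dots> = (\<Sum>s<n. \<Sum>t<n. \<Sum>y\<in>paths n. a s * a t * (\<nu> k y * (y s * y t)))"
            by (intro sum.cong refl) (rule sum.swap)
          finally show ?thesis by (simp add: sum_distrib_left)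
        qed
        then show ?thesis unfolding V_def by (simp only:) (intro tendsto_intros cov; simp)
      qed
      have l3: "\<beta> \<longlonglongrightarrow> (\<Sum>t<n. a t * h t) + b"
        unfolding \<beta>_def by (intro tendsto_intros c) simp
      have re: "Re (cis p * exp (Complex A B)) = exp A * cos (B + p)" for p A B
        by (simp add: Re_exp Im_exp cos_add algebra_simps)
      have "(\<lambda>k. Re (cis (\<beta> k) * (\<Sum>y\<in>paths n. of_real (\<nu> k y) * cis (\<theta> y / sqrt k)) ^ L k))
          \<longlonglongrightarrow> Re (cis ((\<Sum>t<n. a t * h t) + b) * exp (Complex (- V / 2) (\<Sum>t<n. a t * m t)))"
        unfolding cis_conv_exp
        by (intro tendsto_intros l3 char_power_limit[OF finite_paths nonneg one l1 l2 L, unfolded cis_conv_exp])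
      also have "Re (cis ((\<Sum>t<n. a t * h t) + b) * exp (Complex (- V / 2) (\<Sum>t<n. a t * m t))) =
          exp (- V / 2) * cos ((\<Sum>t<n. a t * m t) + ((\<Sum>t<n. a t * h t) + b))"
        by (rule re)
      also have "\<dots> = (\<integral>\<omega>. cos ((\<Sum>t<n. a t * \<eta> t \<omega>) + ((\<Sum>t<n. a t * m t) + ((\<Sum>t<n. a t * h t) + b))) \<partial>N)"
        by (simp add: eta_cos V_def)
      finally show ?thesis unfolding E by (simp add: distrib_left sum.distrib add.assoc)
    qed
  qed
  moreover have "\<forall>\<^sub>F k in sequentially. E k (\<lambda>z. \<Prod>t<n. (1 + x (Suc t) * sgn (z t)) / 2) =
      iid_mean (\<nu> k) (paths n) (L k) (vote n x (c k))"
    using eventually_gt_at_top[of 0]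
  proof eventually_elim
    case (elim k)
    have "sgn (X k ys t) = sgn (c k t + psum ys t)" for ys t
      using elim by (auto simp: X_def sgn_real_def zero_less_divide_iff)
    then show ?case unfolding E_def by (intro iid_mean_cong) (auto simp: vote_def)
  qed
  ultimately show ?thesis by (rule Lim_transform_eventually)
qed

end

section \<open>Path probabilities of the effective process\<close>

context effective_process
begin

lemma tau_0 [simp]: "\<tau> h 0 \<omega> = \<tau>\<^sub>0 \<omega>"
  by (simp add: \<tau>_def)

lemma tau_Suc: "\<tau> h (Suc t) \<omega> = sgn (\<eta> t \<omega> + (\<Sum>s<t. R t s * \<tau> h s \<omega>) + h t)"
  by (simp add: \<tau>_def)

declare effective_path.simps [simp del]

lemma
  shows tau0_events: "sets (vimage_algebra (space N) \<tau>\<^sub>0 borel) \<subseteq> events"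
    and indep_tau0_eta: "A \<in> sets borel \<Longrightarrow> B \<in> sets (\<Pi>\<^sub>M t\<in>UNIV. borel) \<Longrightarrow>
      prob ({\<omega> \<in> space N. \<tau>\<^sub>0 \<omega> \<in> A} \<inter> {\<omega> \<in> space N. (\<lambda>t. \<eta> t \<omega>) \<in> B}) =
      prob {\<omega> \<in> space N. \<tau>\<^sub>0 \<omega> \<in> A} * prob {\<omega> \<in> space N. (\<lambda>t. \<eta> t \<omega>) \<in> B}"
proof -
  show "sets (vimage_algebra (space N) \<tau>\<^sub>0 borel) \<subseteq> events"
    using independent unfolding indep_set_def indep_sets_def by (auto split: bool.splits)
  assume A: "A \<in> sets borel" and B: "B \<in> sets (\<Pi>\<^sub>M t\<in>UNIV. borel :: real measure)"
  have "\<tau>\<^sub>0 -` A \<inter> space N \<in> sets (vimage_algebra (space N) \<tau>\<^sub>0 borel)"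
    by (rule in_vimage_algebra[OF A])
  moreover have "(\<lambda>\<omega> t. \<eta> t \<omega>) -` B \<inter> space N \<in>
      sets (vimage_algebra (space N) (\<lambda>\<omega> t. \<eta> t \<omega>) (\<Pi>\<^sub>M t\<in>UNIV. borel))"
    by (rule in_vimage_algebra[OF B])
  ultimately have "prob ((\<tau>\<^sub>0 -` A \<inter> space N) \<inter> ((\<lambda>\<omega> t. \<eta> t \<omega>) -` B \<inter> space N)) =
      prob (\<tau>\<^sub>0 -` A \<inter> space N) * prob ((\<lambda>\<omega> t. \<eta> t \<omega>) -` B \<inter> space N)"
    by (rule indep_setD[OF independent])
  moreover have "\<tau>\<^sub>0 -` A \<inter> space N = {\<omega> \<in> space N. \<tau>\<^sub>0 \<omega> \<in> A}"
    "(\<lambda>\<omega> t. \<eta> t \<omega>) -` B \<inter> space N = {\<omega> \<in> space N. (\<lambda>t. \<eta> t \<omega>) \<in> B}" by auto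
  ultimately show "prob ({\<omega> \<in> space N. \<tau>\<^sub>0 \<omega> \<in> A} \<inter> {\<omega> \<in> space N. (\<lambda>t. \<eta> t \<omega>) \<in> B}) =
      prob {\<omega> \<in> space N. \<tau>\<^sub>0 \<omega> \<in> A} * prob {\<omega> \<in> space N. (\<lambda>t. \<eta> t \<omega>) \<in> B}" by simp
qed

lemma tau0_measurable [measurable]: "\<tau>\<^sub>0 \<in> borel_measurable N"
proof (rule measurableI)
  fix A :: "real set" assume "A \<in> sets borel"
  then show "\<tau>\<^sub>0 -` A \<inter> space N \<in> events" using tau0_events in_vimage_algebra by blast
qed simp

lemma tau_measurable [measurable]: "\<tau> h t \<in> borel_measurable N"
proof (induction t rule: less_induct)
  case (less t)
  show ?case
  proof (cases t)
    case 0
    have "\<tau> h 0 = \<tau>\<^sub>0" by auto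
    then show ?thesis using 0 by simp
  next
    case (Suc t')
    have "(\<lambda>\<omega>. sgn (\<eta> t' \<omega> + (\<Sum>s<t'. R t' s * \<tau> h s \<omega>) + h t')) \<in> borel_measurable N"
    proof -
      have [measurable]: "\<And>s. s \<in> {..<t'} \<Longrightarrow> \<tau> h s \<in> borel_measurable N" using less Suc by auto
      show ?thesis by measurable
    qed
    moreover have "\<tau> h (Suc t') = (\<lambda>\<omega>. sgn (\<eta> t' \<omega> + (\<Sum>s<t'. R t' s * \<tau> h s \<omega>) + h t'))"
      by (auto simp: tau_Suc)
    ultimately show ?thesis using Suc by simp
  qed
qed

lemma tau_causal: "(\<And>s. s < t \<Longrightarrow> h s = h' s) \<Longrightarrow> \<tau> h t \<omega> = \<tau> h' t \<omega>"
proof (induction t rule: less_induct)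
  case (less t)
  show ?case
  proof (cases t)
    case (Suc t')
    have "\<tau> h s \<omega> = \<tau> h' s \<omega>" if "s < t'" for s using that Suc by (intro less) auto
    then show ?thesis using Suc less.prems by (simp add: tau_Suc)
  qed simp
qed

lemma tau0_prob_sign:
  assumes "x = - 1 \<or> x = (1 :: real)"
  shows "prob {\<omega> \<in> space N. \<tau>\<^sub>0 \<omega> = x} = 1 / 2"
proof (cases "x = 1")
  case False
  then have "{\<omega> \<in> space N. \<tau>\<^sub>0 \<omega> = x} = space N - {\<omega> \<in> space N. \<tau>\<^sub>0 \<omega> = 1}"
    using assms tau0_values by fastforce
  then show ?thesis using tau0_prob by (simp add: prob_compl)
qed (use tau0_prob in simp)

text \<open>The counterpart of \<open>vote\<close> with noise in place of the sum of samples and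
  with the feedback of the prescribed path. For a path of spins, every factor is almost surely the
  indicator that the next spin agrees with \<open>x\<close>.\<close>

definition gauss_vote :: "nat \<Rightarrow> (nat \<Rightarrow> real) \<Rightarrow> (nat \<Rightarrow> real) \<Rightarrow> real" where
  "gauss_vote n x h = (\<integral>\<omega>. (\<Prod>t<n. (1 + x (Suc t) * sgn (\<eta> t \<omega> + (\<Sum>s<t. R t s * x s) + h t)) / 2) \<partial>N)"

definition path_prob :: "nat \<Rightarrow> (nat \<Rightarrow> real) \<Rightarrow> (nat \<Rightarrow> real) \<Rightarrow> real" where
  "path_prob n x h = prob {\<omega> \<in> space N. \<forall>t<n. \<tau> h t \<omega> = x t}"

lemma path_prob_0 [simp]: "path_prob 0 x h = 1"
  by (simp add: path_prob_def prob_space)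

text \<open>On the event that the process has followed \<open>x\<close>, the feedback is that of
  \<open>x\<close>, so the recursion dissolves into conditions on \<open>\<tau>\<^sub>0\<close> and
  the noise alone.\<close>

lemma tau_path_iff:
  "(\<forall>t<Suc n. \<tau> h t \<omega> = x t) \<longleftrightarrow>
    \<tau>\<^sub>0 \<omega> = x 0 \<and> (\<forall>t<n. sgn (\<eta> t \<omega> + (\<Sum>s<t. R t s * x s) + h t) = x (Suc t))"
proof (induction n)
  case (Suc n)
  have "(\<forall>t<Suc (Suc n). \<tau> h t \<omega> = x t) \<longleftrightarrow> (\<forall>t<Suc n. \<tau> h t \<omega> = x t) \<and> \<tau> h (Suc n) \<omega> = x (Suc n)"
    by (auto simp: less_Suc_eq)
  also have "\<dots> \<longleftrightarrow> (\<forall>t<Suc n. \<tau> h t \<omega> = x t) \<and> sgn (\<eta> n \<omega> + (\<Sum>s<n. R n s * x s) + h n) = x (Suc n)"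
    by (auto simp: tau_Suc)
  also have "\<dots> \<longleftrightarrow> \<tau>\<^sub>0 \<omega> = x 0 \<and> (\<forall>t<Suc n. sgn (\<eta> t \<omega> + (\<Sum>s<t. R t s * x s) + h t) = x (Suc t))"
    unfolding Suc by (auto simp: less_Suc_eq)
  finally show ?case .
qed auto

lemma path_prob_Suc:
  assumes x: "x \<in> paths (Suc n)"
  shows "path_prob (Suc n) x h = 1 / 2 * gauss_vote n x h"
proof -
  define d where "d = (\<lambda>t. (\<Sum>s<t. R t s * x s) + h t)"
  define B where "B = {e :: nat \<Rightarrow> real. \<forall>t<n. sgn (e t + d t) = x (Suc t)}"
  have B: "B \<in> sets (\<Pi>\<^sub>M t\<in>UNIV. borel)"
  proof -
    have "{e \<in> space (\<Pi>\<^sub>M t\<in>(UNIV :: nat set). borel :: real measure). \<forall>t<n. sgn (e t + d t) = x (Suc t)}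
        \<in> sets (\<Pi>\<^sub>M t\<in>UNIV. borel)" by measurable
    then show ?thesis by (simp add: B_def space_PiM)
  qed
  have "path_prob (Suc n) x h = prob ({\<omega> \<in> space N. \<tau>\<^sub>0 \<omega> \<in> {x 0}} \<inter> {\<omega> \<in> space N. (\<lambda>t. \<eta> t \<omega>) \<in> B})"
    unfolding path_prob_def tau_path_iff
    by (intro arg_cong[where f = prob]) (auto simp: B_def d_def add.assoc)
  also have "\<dots> = 1 / 2 * prob {\<omega> \<in> space N. (\<lambda>t. \<eta> t \<omega>) \<in> B}"
    using pathsD[OF x, of 0] by (subst indep_tau0_eta) (auto simp: B tau0_prob_sign)
  also have "prob {\<omega> \<in> space N. (\<lambda>t. \<eta> t \<omega>) \<in> B} = (\<integral>\<omega>. indicator {\<omega> \<in> space N. (\<lambda>t. \<eta> t \<omega>) \<in> B} \<omega> \<partial>N)"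
    by (simp add: Int_absorb2)
  also have "\<dots> = gauss_vote n x h"
    unfolding gauss_vote_def
  proof (rule integral_cong_AE)
    have "{\<omega> \<in> space N. (\<lambda>t. \<eta> t \<omega>) \<in> B} \<in> events" unfolding B_def by measurable
    then show "indicator {\<omega> \<in> space N. (\<lambda>t. \<eta> t \<omega>) \<in> B} \<in> borel_measurable N" by simp
    have "AE \<omega> in N. \<forall>t\<in>{..<n}. \<eta> t \<omega> \<noteq> - d t"
      by (intro AE_finite_allI eta_no_atoms) simp
    then show "AE \<omega> in N. indicator {\<omega> \<in> space N. (\<lambda>t. \<eta> t \<omega>) \<in> B} \<omega> =
      (\<Prod>t<n. (1 + x (Suc t) * sgn (\<eta> t \<omega> + (\<Sum>s<t. R t s * x s) + h t)) / 2)"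
      using AE_space
    proof eventually_elim
      case (elim \<omega>)
      have f: "(1 + x (Suc t) * sgn (\<eta> t \<omega> + (\<Sum>s<t. R t s * x s) + h t)) / 2 =
          (if sgn (\<eta> t \<omega> + d t) = x (Suc t) then 1 else 0)" if t: "t < n" for t
      proof -
        have "\<eta> t \<omega> + d t \<noteq> 0" using elim(1) t by force
        then show ?thesis using pathsD[OF x, of "Suc t"] t
          by (auto simp: d_def sgn_real_def add.assoc not_less dest!: sym[of "- 1"])
      qed
      have "(\<Prod>t<n. (1 + x (Suc t) * sgn (\<eta> t \<omega> + (\<Sum>s<t. R t s * x s) + h t)) / 2) =
         (\<Prod>t<n. if sgn (\<eta> t \<omega> + d t) = x (Suc t) then 1 else 0)"
        by (intro prod.cong) (auto simp: f)
      also have "\<dots> = (if \<forall>t<n. sgn (\<eta> t \<omega> + d t) = x (Suc t) then 1 else 0)"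
        by (auto simp: prod_zero_iff)
      finally show ?case using elim(2) by (auto simp: B_def indicator_def)
    qed
  qed measurable
  finally show ?thesis .
qed

text \<open>\<open>sgn\<close> returns zero only if the noise exactly cancels feedback and field.
  Along spin paths the feedback takes finitely many values, and each cancellation has probability
  zero.\<close>

lemma AE_tau_paths: "AE \<omega> in N. (\<lambda>t\<in>{..<n}. \<tau> h t \<omega>) \<in> paths n"
proof (induction n)
  case 0
  then show ?case by (simp add: paths_def)
next
  case (Suc n)
  have "AE \<omega> in N. \<forall>x\<in>paths n. \<forall>m\<in>{..n}. \<eta> m \<omega> \<noteq> - (\<Sum>s<m. R m s * x s) - h m"
    by (intro AE_finite_allI eta_no_atoms) simp_all
  with Suc show ?case using AE_space
  proof eventually_elim
    case (elim \<omega>)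
    have *: "\<tau> h t \<omega> = - 1 \<or> \<tau> h t \<omega> = 1" if "t < n" for t
      using pathsD[OF elim(1) that] that by simp
    have "\<tau> h n \<omega> = - 1 \<or> \<tau> h n \<omega> = 1"
    proof (cases n)
      case 0
      then show ?thesis using tau0_values[OF elim(3)] by auto
    next
      case (Suc m)
      have "\<eta> m \<omega> \<noteq> - (\<Sum>s<m. R m s * (\<lambda>t\<in>{..<n}. \<tau> h t \<omega>) s) - h m"
        using elim(2) elim(1) Suc by auto
      moreover have "(\<Sum>s<m. R m s * (\<lambda>t\<in>{..<n}. \<tau> h t \<omega>) s) = (\<Sum>s<m. R m s * \<tau> h s \<omega>)"
        using Suc by (intro sum.cong) auto
      ultimately show ?thesis unfolding Suc tau_Suc by (auto simp: sgn_real_def)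
    qed
    with * show ?case by (auto simp: paths_iff less_Suc_eq)
  qed
qed

lemma expectation_path:
  assumes "(\<lambda>\<omega>. F (\<lambda>t\<in>{..<n}. \<tau> h t \<omega>)) \<in> borel_measurable N"
  shows "(\<integral>\<omega>. F (\<lambda>t\<in>{..<n}. \<tau> h t \<omega>) \<partial>N) = (\<Sum>x\<in>paths n. F x * path_prob n x h)"
proof -
  have ev [measurable]: "{\<omega> \<in> space N. \<forall>t<n. \<tau> h t \<omega> = x t} \<in> events" for x :: "nat \<Rightarrow> real"
    by measurable
  have int: "integrable N (indicat_real {\<omega> \<in> space N. \<forall>t<n. \<tau> h t \<omega> = x t})" for x :: "nat \<Rightarrow> real"
    by (rule integrable_const_bound[of _ 1]) (auto simp: indicator_def)
  have eq: "AE \<omega> in N. F (\<lambda>t\<in>{..<n}. \<tau> h t \<omega>) =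
      (\<Sum>x\<in>paths n. F x * indicator {\<omega> \<in> space N. \<forall>t<n. \<tau> h t \<omega> = x t} \<omega>)"
    using AE_tau_paths[where n = n and h = h] AE_space
  proof eventually_elim
    case (elim \<omega>)
    have "(\<Sum>x\<in>paths n. F x * indicator {\<omega> \<in> space N. \<forall>t<n. \<tau> h t \<omega> = x t} \<omega>) =
       (\<Sum>x\<in>paths n. if x = (\<lambda>t\<in>{..<n}. \<tau> h t \<omega>) then F x else 0)"
    proof (intro sum.cong refl)
      fix x assume "x \<in> paths n"
      then have "(\<forall>t<n. \<tau> h t \<omega> = x t) \<longleftrightarrow> x = (\<lambda>t\<in>{..<n}. \<tau> h t \<omega>)"
        by (auto simp: paths_iff fun_eq_iff restrict_def)
      then show "F x * indicator {\<omega> \<in> space N. \<forall>t<n. \<tau> h t \<omega> = x t} \<omega> =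
         (if x = (\<lambda>t\<in>{..<n}. \<tau> h t \<omega>) then F x else 0)" using elim(2) by simp
    qed
    also have "\<dots> = F (\<lambda>t\<in>{..<n}. \<tau> h t \<omega>)" using elim(1) by simp
    finally show ?case by simp
  qed
  have "(\<integral>\<omega>. F (\<lambda>t\<in>{..<n}. \<tau> h t \<omega>) \<partial>N) =
     (\<integral>\<omega>. (\<Sum>x\<in>paths n. F x * indicator {\<omega> \<in> space N. \<forall>t<n. \<tau> h t \<omega> = x t} \<omega>) \<partial>N)"
    by (intro integral_cong_AE eq assms borel_measurable_sum borel_measurable_times
        borel_measurable_indicator borel_measurable_const ev)
  also have "\<dots> = (\<Sum>x\<in>paths n. F x * path_prob n x h)"
    by (subst Bochner_Integration.integral_sum) (auto simp: path_prob_def Int_absorb2 int)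
  finally show ?thesis .
qed

lemma expectation_tau: "t < n \<Longrightarrow> expectation (\<tau> h t) = (\<Sum>x\<in>paths n. x t * path_prob n x h)"
  using expectation_path[where n = n and h = h and F = "\<lambda>x. x t"] by simp

lemma expectation_tau2:
  "s < n \<Longrightarrow> t < n \<Longrightarrow> expectation (\<lambda>\<omega>. \<tau> h s \<omega> * \<tau> h t \<omega>) = (\<Sum>x\<in>paths n. x s * x t * path_prob n x h)"
  using expectation_path[where n = n and h = h and F = "\<lambda>x. x s * x t"] by simp

end

section \<open>Asymptotics of the forced law\<close>

lemma vote_upd:
  assumes "s < n"
  shows "vote n x (c(s := a)) ys =
    (\<Prod>t\<in>{..<n} - {s}. (1 + x (Suc t) * sgn (c t + psum ys t)) / 2) * ((1 + x (Suc s) * sgn (a + psum ys s)) / 2)"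
proof -
  have "vote n x (c(s := a)) ys = (1 + x (Suc s) * sgn (a + psum ys s)) / 2 *
      (\<Prod>t\<in>{..<n} - {s}. (1 + x (Suc t) * sgn ((c(s := a)) t + psum ys t)) / 2)"
    unfolding vote_def using assms by (subst prod.remove[of _ s]) auto
  also have "(\<Prod>t\<in>{..<n} - {s}. (1 + x (Suc t) * sgn ((c(s := a)) t + psum ys t)) / 2) =
     (\<Prod>t\<in>{..<n} - {s}. (1 + x (Suc t) * sgn (c t + psum ys t)) / 2)"
    by (intro prod.cong) auto
  finally show ?thesis by (simp only: mult.commute)
qed

lemma psum_parity:
  assumes "set ys \<subseteq> paths n" "s < n"
  shows "\<exists>j::int. psum ys s = of_int j \<and> even (j + int (length ys))"
  using assms(1)
proof (induction ys)
  case (Cons y ys)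
  then obtain j :: int where j: "psum ys s = of_int j" "even (j + int (length ys))" by auto
  have "y s = - 1 \<or> y s = 1" using Cons.prems assms(2) by (auto dest: pathsD)
  then show ?case
  proof
    assume "y s = - 1"
    then show ?thesis using j by (intro exI[of _ "j - 1"]) auto
  next
    assume "y s = 1"
    then show ?thesis using j by (intro exI[of _ "j + 1"]) auto
  qed
qed auto

lemma sgn_even_mean:
  fixes e :: int
  assumes "even e"
  shows "2 * sgn (real_of_int e) = sgn (of_int e + 1) + sgn (of_int e - 1)"
proof -
  from assms have "e = 0 \<or> e \<ge> 2 \<or> e \<le> - 2" by presburger
  then show ?thesis
  proof (elim disjE)
    assume "e \<ge> 2"
    then have "real_of_int e \<ge> 2" by linarith
    then show ?thesis by auto
  next
    assume "e \<le> - 2"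
    then have "real_of_int e \<le> - 2" by linarith
    then show ?thesis by auto
  qed auto
qed

text \<open>
  The sums have the parity of \<open>m\<close>, hence the mean vote is affine in the field between consecutive
  integers of the opposite parity, and steps of size one are halves of steps of size two.
\<close>

lemma iid_mean_vote_parity:
  fixes a :: int and \<nu> :: "(nat \<Rightarrow> real) \<Rightarrow> real" and x c :: "nat \<Rightarrow> real"
  assumes "s < n" "even (a + int m)"
  defines "\<phi> \<equiv> \<lambda>a. iid_mean \<nu> (paths n) m (vote n x (c(s := a)))"
  shows "2 * \<phi> a = \<phi> (a + 1) + \<phi> (a - 1)"
proof -
  have "2 * \<phi> a = iid_mean \<nu> (paths n) m (\<lambda>ys. 2 * vote n x (c(s := real_of_int a)) ys)"
    by (simp add: \<phi>_def iid_mean_cmult)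
  also have "\<dots> = iid_mean \<nu> (paths n) m (\<lambda>ys. vote n x (c(s := a + 1)) ys + vote n x (c(s := a - 1)) ys)"
  proof (rule iid_mean_cong)
    fix ys assume ys: "set ys \<subseteq> paths n" "length ys = m"
    obtain j :: int where j: "psum ys s = of_int j" "even (j + int m)"
      using psum_parity[OF ys(1) assms(1)] ys(2) by auto
    have "even (a + j)" using j(2) assms(2) by presburger
    from sgn_even_mean[OF this]
    have sg: "2 * sgn (real_of_int a + psum ys s) = sgn (a + 1 + psum ys s) + sgn (a - 1 + psum ys s)"
      by (simp add: j(1) algebra_simps)
    let ?W = "\<Prod>t\<in>{..<n} - {s}. (1 + x (Suc t) * sgn (c t + psum ys t)) / 2"
    have "2 * vote n x (c(s := real_of_int a)) ys = ?W * (1 + x (Suc s) * (2 * sgn (real_of_int a + psum ys s)) / 2)"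
      unfolding vote_upd[OF assms(1)] by (simp add: field_simps)
    also have "\<dots> = vote n x (c(s := a + 1)) ys + vote n x (c(s := a - 1)) ys"
      unfolding vote_upd[OF assms(1)] sg by (simp add: field_simps)
    finally show "2 * vote n x (c(s := real_of_int a)) ys =
        vote n x (c(s := a + 1)) ys + vote n x (c(s := a - 1)) ys" .
  qed auto
  finally show ?thesis by (simp add: \<phi>_def iid_mean_add)
qed

text \<open>Replacing a sample by one that differs only at time \<open>s\<close> amounts to shifting
  the field at \<open>s\<close> by two, so the second difference over two samples is one over fields
  with step two.\<close>

lemma iid_mean_vote_second_difference:
  fixes \<nu> :: "(nat \<Rightarrow> real) \<Rightarrow> real" and x c :: "nat \<Rightarrow> real" and m :: nat
  assumes nonneg: "\<And>y. y \<in> paths n \<Longrightarrow> 0 \<le> \<nu> y" and one: "sum \<nu> (paths n) = 1"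
    and lower: "\<And>y. y \<in> paths n \<Longrightarrow> \<delta> \<le> \<nu> y" "0 < \<delta>"
    and s: "s < n" and x: "\<And>t. t < n \<Longrightarrow> \<bar>x (Suc t)\<bar> \<le> 1"
  defines "\<phi> \<equiv> \<lambda>a. iid_mean \<nu> (paths n) m (vote n x (c(s := a)))"
  shows "\<bar>\<phi> (a + 4) - 2 * \<phi> (a + 2) + \<phi> a\<bar> \<le> (1 + 2 / \<delta>\<^sup>2) / (real m + 1)"
proof -
  define p where "p = (\<lambda>r t. if t < n then if t = s then r else 1 else undefined :: real)"
  have p: "p 1 \<in> paths n" "p (- 1) \<in> paths n" by (auto simp: p_def paths_iff)
  have ne: "p 1 \<noteq> p (- 1)" using s by (auto simp: p_def fun_eq_iff intro!: exI[of _ s])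
  \<comment> \<open>Both additional samples contribute one at every time other than
    \<open>s\<close>, which is subtracted here; at \<open>s\<close> they contribute
    \<open>2\<close>, \<open>0\<close> or \<open>- 2\<close> around the midpoint
    \<open>a + 2\<close>.\<close>
  define c' where "c' = (\<lambda>t. if t = s then a + 2 else c t - 2)"
  define f where "f = vote n x c'"
  have shift: "f (p r # p r' # ys) = vote n x (c(s := a + 2 + r + r')) ys" for r r' ys
    unfolding f_def vote_def by (intro prod.cong refl) (auto simp: c'_def p_def add.assoc)
  have f1: "\<bar>f ys\<bar> \<le> 1" for ys unfolding f_def using vote_bounds[of n x c' ys] x by auto
  have sym: "f xs = f ys" if "mset xs = mset ys" for xs ys
  proof -
    have "psum xs t = psum ys t" for t
      using that by (metis mset_map sum_mset_sum_list)
    then show ?thesis by (simp add: f_def vote_def)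
  qed
  have "\<bar>iid_mean \<nu> (paths n) m (\<lambda>ys. f (p 1 # p 1 # ys) - 2 * f (p 1 # p (- 1) # ys) + f (p (- 1) # p (- 1) # ys))\<bar>
      \<le> (1 + 2 / \<delta>\<^sup>2) / (real m + 1)"
    by (rule iid_mean_second_difference[where f = f, OF finite_paths nonneg one p ne lower(2) lower(1)[OF p(1)] lower(1)[OF p(2)] sym f1])
  then show ?thesis
    unfolding shift by (simp add: \<phi>_def iid_mean_add iid_mean_diff iid_mean_cmult add.commute)
qed

text \<open>An increment \<open>j\<close> steps later differs from the first by at most
  \<open>j * B\<close>, and these deviations are summed over \<open>M\<close> increments.\<close>

lemma second_difference_sum:
  fixes \<phi> :: "real \<Rightarrow> real"
  assumes "\<And>a. \<bar>\<phi> (a + 4) - 2 * \<phi> (a + 2) + \<phi> a\<bar> \<le> B"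
  shows "\<bar>real M * (\<phi> (b + 2) - \<phi> b) - (\<phi> (b + 2 * real M) - \<phi> b)\<bar> \<le> (real M)\<^sup>2 * B"
proof -
  define d where "d = (\<lambda>j::nat. \<phi> (b + 2 * real j + 2) - \<phi> (b + 2 * real j))"
  have dd: "\<bar>d (Suc j) - d j\<bar> \<le> B" for j
    using assms[of "b + 2 * real j"] by (simp add: d_def algebra_simps)
  have d0: "\<bar>d 0 - d j\<bar> \<le> real j * B" for j
  proof (induction j)
    case (Suc j)
    then show ?case using dd[of j] by (simp add: algebra_simps)
  qed simp
  have B: "0 \<le> B" using dd[of 0] by linarith
  show ?thesis
  proof (induction M)
    case (Suc M)
    have eq: "real (Suc M) * (\<phi> (b + 2) - \<phi> b) - (\<phi> (b + 2 * real (Suc M)) - \<phi> b) =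
       (real M * (\<phi> (b + 2) - \<phi> b) - (\<phi> (b + 2 * real M) - \<phi> b)) + (d 0 - d M)"
      by (simp add: d_def algebra_simps)
    have "(real M)\<^sup>2 * B + real M * B \<le> (real (Suc M))\<^sup>2 * B"
      using B by (simp add: power2_eq_square algebra_simps)
    then show ?case unfolding eq using Suc d0[of M] by linarith
  qed simp
qed

section \<open>Induction over the time horizon\<close>

context cavity_process
begin

text \<open>The limit is the same for every \<open>u\<close>: at this precision a single parent is
  not felt.\<close>

definition law_converges :: "nat \<Rightarrow> bool" where
  "law_converges n \<longleftrightarrow> (\<forall>x\<in>paths n. \<forall>u. (\<lambda>k. law k n x u) \<longlonglongrightarrow> path_prob n x (\<lambda>_. 0))"

text \<open>The next order, at which the parent is felt: the response is linear in \<open>u\<close>,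
  and its kernel is the response function of the cavity process.\<close>

definition mean_converges :: "nat \<Rightarrow> bool" where
  "mean_converges n \<longleftrightarrow> (\<forall>u t. (\<forall>s<n. u s = - 1 \<or> u s = 1) \<longrightarrow> t < n \<longrightarrow>
     (\<lambda>k. sqrt k * (\<Sum>y\<in>paths n. law k n y u * y t)) \<longlonglongrightarrow> (\<Sum>s<t. R t s * u s))"

text \<open>Uniformity in \<open>k\<close> is the point, since the bound enters the constant of the
  second-difference estimate.\<close>

definition law_bounded_below :: "nat \<Rightarrow> bool" where
  "law_bounded_below n \<longleftrightarrow> (\<exists>\<delta>>0. \<forall>\<^sub>F k in sequentially. \<forall>y\<in>paths n. \<forall>u. (\<forall>t<n. \<bar>u t\<bar> \<le> 1) \<longrightarrow> \<delta> \<le> law k n y u)"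

text \<open>Normalization is not immediate from the recursion, because \<open>x\<close> also
  determines the weights of the children. It is supplied later by the tree, where \<open>law\<close>
  is the distribution of a forced vertex (\<open>law_total\<close>).\<close>

context
  assumes total: "\<And>k n u. 2 \<le> k \<Longrightarrow> (\<Sum>x\<in>paths n. law k n x u) = 1"
begin

text \<open>Consistency of \<open>C\<close> enters here: the covariances of a child converge to
  those of the cavity process, which are again \<open>C\<close>, the covariance of the noise in
  \<open>gauss_vote\<close>.\<close>

lemma law_vote_limit:
  fixes c :: "nat \<Rightarrow> nat \<Rightarrow> real"
  assumes n: "law_converges n" "mean_converges n"
    and x: "x \<in> paths (Suc n)"
    and L: "\<And>k. L k \<le> k" "(\<lambda>k. real (L k) / k) \<longlonglongrightarrow> 1"
    and c: "\<And>t. t < n \<Longrightarrow> (\<lambda>k. c k t / sqrt k) \<longlonglongrightarrow> h t"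
  shows "(\<lambda>k. iid_mean (\<lambda>y. law k n y x) (paths n) (L k) (vote n x (c k))) \<longlonglongrightarrow> gauss_vote n x h"
  unfolding gauss_vote_def
proof (rule vote_limit[where m = "\<lambda>t. \<Sum>s<t. R t s * x s"])
  show "0 \<le> law k n y x" if "y \<in> paths n" for k y
    using that by (intro law_nonneg) (simp add: paths_abs)
  show "\<forall>\<^sub>F k in sequentially. (\<Sum>y\<in>paths n. law k n y x) = 1"
    using eventually_ge_at_top[of 2] by eventually_elim (rule total)
  show "(\<lambda>k. sqrt (real k) * (\<Sum>y\<in>paths n. law k n y x * y t)) \<longlonglongrightarrow> (\<Sum>s<t. R t s * x s)"
    if "t < n" for t
    using n(2) that pathsD[OF x] unfolding mean_converges_def by auto
  show "(\<lambda>k. \<Sum>y\<in>paths n. law k n y x * (y s * y t)) \<longlonglongrightarrow> C s t" if "s < n" "t < n" for s t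
  proof -
    have "(\<lambda>k. \<Sum>y\<in>paths n. law k n y x * (y s * y t)) \<longlonglongrightarrow> (\<Sum>y\<in>paths n. path_prob n y (\<lambda>_. 0) * (y s * y t))"
      using n(1) unfolding law_converges_def by (intro tendsto_sum tendsto_mult tendsto_const) auto
    then show ?thesis
      unfolding consistent_C[of s t] expectation_tau2[OF that] by (simp add: mult_ac)
  qed
qed (use L c x in \<open>auto simp: paths_abs\<close>)

lemma pred_ratio: "(\<lambda>k::nat. real (k - 1) / k) \<longlonglongrightarrow> 1"
proof (rule Lim_transform_eventually)
  show "(\<lambda>k::nat. (real k - 1) / k) \<longlonglongrightarrow> 1" by real_asymp
  show "\<forall>\<^sub>F k::nat in sequentially. (real k - 1) / k = real (k - 1) / k"
    using eventually_ge_at_top[of 1] by eventually_elim (simp add: of_nat_diff)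
qed

lemma law_converges_Suc:
  assumes n: "law_converges n" "mean_converges n"
  shows "law_converges (Suc n)"
  unfolding law_converges_def
proof (intro ballI allI)
  fix x u assume x: "x \<in> paths (Suc n)"
  have "(\<lambda>k. iid_mean (\<lambda>y. law k n y x) (paths n) (k - 1) (vote n x u)) \<longlonglongrightarrow> gauss_vote n x (\<lambda>_. 0)"
  proof (rule law_vote_limit[OF n x _ pred_ratio])
    show "(\<lambda>k::nat. u t / sqrt k) \<longlonglongrightarrow> 0" for t
    proof -
      have "(\<lambda>k::nat. 1 / sqrt k) \<longlonglongrightarrow> 0" by real_asymp
      from tendsto_mult_left[OF this, of "u t"] show ?thesis by simp
    qed
  qed auto
  from tendsto_mult_left[OF this, of "1 / 2"]
  show "(\<lambda>k. law k (Suc n) x u) \<longlonglongrightarrow> path_prob (Suc n) x (\<lambda>_. 0)"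
    unfolding path_prob_Suc[OF x] law.simps .
qed

text \<open>The tilting in \<open>vote_lower_bound\<close> tolerates means of order
  \<open>1 / sqrt k\<close>, and \<open>mean_converges\<close> guarantees this order.\<close>

lemma law_bounded_below_Suc:
  assumes low: "law_bounded_below n" and mc: "mean_converges n"
  shows "law_bounded_below (Suc n)"
proof -
  obtain \<delta> where \<delta>: "0 < \<delta>" and ev: "\<forall>\<^sub>F k in sequentially. \<forall>y\<in>paths n. \<forall>u. (\<forall>t<n. \<bar>u t\<bar> \<le> 1) \<longrightarrow> \<delta> \<le> law k n y u"
    using low unfolding law_bounded_below_def by auto
  define l where "l = (\<lambda>x t. \<Sum>s<t. R t s * x s)"
  \<comment> \<open>A sum of nonnegative terms bounds finitely many limits at once; the added one is
    the strict margin that transfers the bound to large \<open>k\<close>.\<close>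
  define B where "B = (\<Sum>x\<in>paths (Suc n). \<Sum>t<n. \<bar>l x t\<bar> + 1)"
  define \<kappa> where "\<kappa> = B + 2 * (2 * real n + 1) + 1"
  have B: "\<bar>l x t\<bar> + 1 \<le> B" if "x \<in> paths (Suc n)" "t < n" for x t
  proof -
    have "\<bar>l x t\<bar> + 1 \<le> (\<Sum>t<n. \<bar>l x t\<bar> + 1)" using that by (intro member_le_sum) auto
    also have "\<dots> \<le> B" unfolding B_def using that
      by (intro member_le_sum[of x "paths (Suc n)" "\<lambda>x. \<Sum>t<n. \<bar>l x t\<bar> + 1"]) (auto intro!: sum_nonneg)
    finally show ?thesis .
  qed
  have B0: "0 \<le> B" unfolding B_def by (intro sum_nonneg) auto
  have evB: "\<forall>\<^sub>F k in sequentially. \<forall>x\<in>paths (Suc n). \<forall>t\<in>{..<n}.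
      \<bar>sqrt k * (\<Sum>y\<in>paths n. law k n y x * y t)\<bar> < B"
  proof (intro eventually_ball_finite ballI)
    fix x t assume x: "x \<in> paths (Suc n)" and t: "t \<in> {..<n}"
    have "(\<lambda>k. \<bar>sqrt k * (\<Sum>y\<in>paths n. law k n y x * y t)\<bar>) \<longlonglongrightarrow> \<bar>l x t\<bar>"
      unfolding l_def using mc t pathsD[OF x] unfolding mean_converges_def by (intro tendsto_rabs) auto
    then show "\<forall>\<^sub>F k in sequentially. \<bar>sqrt k * (\<Sum>y\<in>paths n. law k n y x * y t)\<bar> < B"
      by (rule order_tendstoD) (use B[OF x, of t] t in auto)
  qed auto
  have evk: "\<forall>\<^sub>F k::nat in sequentially. \<kappa> * n / \<delta> \<le> sqrt k"
  proof -
    have "filterlim (\<lambda>k::nat. sqrt k) at_top sequentially" by real_asymp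
    then show ?thesis by (simp add: filterlim_at_top)
  qed
  let ?\<delta> = "1 / 2 * (exp (- (\<kappa>\<^sup>2 * n\<^sup>2 / \<delta>)) / 4)"
  have "\<forall>\<^sub>F k in sequentially. \<forall>y\<in>paths (Suc n). \<forall>u. (\<forall>t<Suc n. \<bar>u t\<bar> \<le> 1) \<longrightarrow> ?\<delta> \<le> law k (Suc n) y u"
    using ev evB evk eventually_ge_at_top[of 4]
  proof eventually_elim
    case (elim k)
    show ?case
    proof (intro ballI allI impI)
      fix y u :: "nat \<Rightarrow> real" assume y: "y \<in> paths (Suc n)" and u: "\<forall>t<Suc n. \<bar>u t\<bar> \<le> 1"
      have "exp (- (\<kappa>\<^sup>2 * n\<^sup>2 / \<delta>)) / 4 \<le> iid_mean (\<lambda>z. law k n z y) (paths n) (k - 1) (vote n y u)"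
        unfolding \<kappa>_def
      proof (rule vote_lower_bound[OF \<delta>])
        show "\<delta> \<le> law k n z y" if "z \<in> paths n" for z
          using elim(1) that paths_abs[OF y] by auto
        show "\<bar>\<Sum>z\<in>paths n. law k n z y * z t\<bar> \<le> B / sqrt k" if "t < n" for t
          using elim(2) y that elim(4) by (auto simp: abs_mult field_simps less_imp_le)
        show "(B + 2 * (2 * real n + 1) + 1) * real n / \<delta> \<le> sqrt k"
          using elim(3) by (simp add: \<kappa>_def)
        show "(\<Sum>z\<in>paths n. law k n z y) = 1" using elim(4) by (intro total) simp
      qed (use B0 elim(4) u pathsD[OF y] in auto)
      then show "?\<delta> \<le> law k (Suc n) y u" unfolding law.simps by (intro mult_left_mono) auto
    qed
  qed
  moreover have "0 < ?\<delta>" by simp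
  ultimately show ?thesis unfolding law_bounded_below_def by blast
qed

text \<open>The scale \<open>\<epsilon>\<close> stays fixed while \<open>k\<close> grows;
  \<open>K\<close> depends only on the lower bound of the laws, so \<open>\<epsilon>\<close> can
  tend to zero afterwards. Entries of \<open>c\<close> at other times vanish after division by
  \<open>sqrt k\<close>, hence the quotient is taken around the zero field.\<close>

lemma response_limit:
  assumes n: "law_converges n" "mean_converges n" and low: "law_bounded_below n"
  obtains K where "0 < K"
    "\<And>x s c w \<epsilon>. x \<in> paths (Suc n) \<Longrightarrow> s < n \<Longrightarrow> w = - 1 \<or> w = 1 \<Longrightarrow> 0 < \<epsilon> \<Longrightarrow>
      \<forall>\<^sub>F k in sequentially.
       \<bar>sqrt k * (iid_mean (\<lambda>y. law k n y x) (paths n) (k - 1) (vote n x (c(s := w))) -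
                  iid_mean (\<lambda>y. law k n y x) (paths n) (k - 1) (vote n x (c(s := 0)))) -
        w * ((gauss_vote n x ((\<lambda>_. 0)(s := \<epsilon>)) - gauss_vote n x (\<lambda>_. 0)) / \<epsilon>)\<bar> \<le> K * \<epsilon>"
proof -
  obtain \<delta> where \<delta>: "0 < \<delta>" and ev: "\<forall>\<^sub>F k in sequentially. \<forall>y\<in>paths n. \<forall>u. (\<forall>t<n. \<bar>u t\<bar> \<le> 1) \<longrightarrow> \<delta> \<le> law k n y u"
    using low unfolding law_bounded_below_def by auto
  define K where "K = 1 + 2 / \<delta>\<^sup>2"
  have K: "0 < K" using \<delta> by (simp add: K_def add_pos_nonneg)
  have inv_sqrt: "(\<lambda>k::nat. 1 / sqrt k) \<longlonglongrightarrow> 0" by real_asymp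
  have main: "\<forall>\<^sub>F k in sequentially.
       \<bar>sqrt k * (iid_mean (\<lambda>y. law k n y x) (paths n) (k - 1) (vote n x (c(s := w))) -
                  iid_mean (\<lambda>y. law k n y x) (paths n) (k - 1) (vote n x (c(s := 0)))) -
        w * ((gauss_vote n x ((\<lambda>_. 0)(s := \<epsilon>)) - gauss_vote n x (\<lambda>_. 0)) / \<epsilon>)\<bar> \<le> K * \<epsilon>"
    if x: "x \<in> paths (Suc n)" and s: "s < n" and w: "w = - 1 \<or> w = 1" and \<epsilon>: "0 < \<epsilon>" for x s c w \<epsilon>
  proof -
    define \<phi> where "\<phi> = (\<lambda>k a. iid_mean (\<lambda>y. law k n y x) (paths n) (k - 1) (vote n x (c(s := a))))"
    \<comment> \<open>\<open>M\<close> steps of size two cover about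
      \<open>\<epsilon> * sqrt k\<close> units of the field. They start at \<open>b\<close>, the
      left end of an interval of length two that contains \<open>0\<close> and \<open>w\<close> and
      on whose integers parity makes the mean vote affine.\<close>
    define M where "M = (\<lambda>k::nat. nat \<lceil>\<epsilon> / 2 * sqrt k\<rceil>)"
    define b where "b = (\<lambda>k::nat. if odd k then - 1 else if w = 1 then 0 else - 2 :: real)"
    define G where "G = (\<lambda>a. gauss_vote n x ((\<lambda>_. 0)(s := a)))"
    have G0: "G 0 = gauss_vote n x (\<lambda>_. 0)" unfolding G_def by (intro arg_cong[where f = "gauss_vote n x"]) auto
    have Mlim: "(\<lambda>k. real (M k) / sqrt k) \<longlonglongrightarrow> \<epsilon> / 2"
    proof (rule tendsto_sandwich)
      show "\<forall>\<^sub>F k in sequentially. \<epsilon> / 2 \<le> real (M k) / sqrt k"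
        using eventually_gt_at_top[of 0]
      proof eventually_elim
        case (elim k)
        have "\<epsilon> / 2 * sqrt k \<le> real (M k)" unfolding M_def by (rule real_nat_ceiling_ge)
        then show ?case using elim by (simp add: pos_le_divide_eq)
      qed
      show "\<forall>\<^sub>F k in sequentially. real (M k) / sqrt k \<le> \<epsilon> / 2 + 1 / sqrt k"
        using eventually_gt_at_top[of 0]
      proof eventually_elim
        case (elim k)
        have "0 \<le> \<epsilon> / 2 * sqrt k" using \<epsilon> by simp
        then have "real (M k) \<le> \<epsilon> / 2 * sqrt k + 1" unfolding M_def by linarith
        then have "real (M k) / sqrt k \<le> (\<epsilon> / 2 * sqrt k + 1) / sqrt k" by (intro divide_right_mono) auto
        then show ?case using elim by (simp add: add_divide_distrib)
      qed
      show "(\<lambda>k::nat. \<epsilon> / 2 + 1 / sqrt k) \<longlonglongrightarrow> \<epsilon> / 2"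
        using tendsto_add[OF tendsto_const inv_sqrt, of "\<epsilon> / 2"] by simp
    qed simp
    have blim: "(\<lambda>k. b k / sqrt k) \<longlonglongrightarrow> 0"
    proof (rule Lim_null_comparison)
      show "\<forall>\<^sub>F k in sequentially. norm (b k / sqrt k) \<le> 2 * (1 / sqrt k)"
        by (intro always_eventually) (auto simp: b_def divide_right_mono)
      show "(\<lambda>k::nat. 2 * (1 / sqrt k)) \<longlonglongrightarrow> 0" using tendsto_mult_left[OF inv_sqrt, of 2] by simp
    qed
    have clim: "(\<lambda>k::nat. c t / sqrt k) \<longlonglongrightarrow> 0" for t
      using tendsto_mult_left[OF inv_sqrt, of "c t"] by simp
    have lim: "(\<lambda>k. \<phi> k (a k)) \<longlonglongrightarrow> G r" if "(\<lambda>k. a k / sqrt k) \<longlonglongrightarrow> r" for a :: "nat \<Rightarrow> real" and r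
      unfolding \<phi>_def G_def
    proof (rule law_vote_limit[where c = "\<lambda>k. c(s := a k)" and h = "(\<lambda>_. 0)(s := r)", OF n x _ pred_ratio])
      show "(\<lambda>k::nat. (c(s := a k)) t / sqrt k) \<longlonglongrightarrow> ((\<lambda>_. 0)(s := r)) t" for t
        using that clim[of t] by (cases "t = s") auto
    qed auto
    have "(\<lambda>k. (b k + 2 * real (M k)) / sqrt k) \<longlonglongrightarrow> \<epsilon>"
      using tendsto_add[OF blim tendsto_mult_left[OF Mlim, of 2]] by (simp add: add_divide_distrib)
    from tendsto_diff[OF lim[OF this] lim[OF blim]]
    have diff: "(\<lambda>k. \<phi> k (b k + 2 * real (M k)) - \<phi> k (b k)) \<longlonglongrightarrow> G \<epsilon> - G 0" .
    have "(\<lambda>k. w / 2 * ((\<phi> k (b k + 2 * real (M k)) - \<phi> k (b k)) / (real (M k) / sqrt k)))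
        \<longlonglongrightarrow> w / 2 * ((G \<epsilon> - G 0) / (\<epsilon> / 2))"
      using \<epsilon> by (intro tendsto_intros diff Mlim) auto
    moreover have "w / 2 * (z / (\<epsilon> / 2)) = w * (z / \<epsilon>)" for z by simp
    ultimately have lim1: "(\<lambda>k. w / 2 * ((\<phi> k (b k + 2 * real (M k)) - \<phi> k (b k)) / (real (M k) / sqrt k)))
        \<longlonglongrightarrow> w * ((G \<epsilon> - G 0) / \<epsilon>)" by (simp only:)
    \<comment> \<open>The budget \<open>K * \<epsilon>\<close> is split evenly between the central
      limit theorem and the second differences.\<close>
    have ev1: "\<forall>\<^sub>F k in sequentially. \<bar>w / 2 * ((\<phi> k (b k + 2 * real (M k)) - \<phi> k (b k)) / (real (M k) / sqrt k)) -
        w * ((G \<epsilon> - G 0) / \<epsilon>)\<bar> < K * \<epsilon> / 2"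
      using tendstoD[OF lim1, of "K * \<epsilon> / 2"] K \<epsilon> by (simp add: dist_real_def)
    have ev2: "\<forall>\<^sub>F k in sequentially. real (M k) / sqrt k < \<epsilon>"
      using \<epsilon> by (intro order_tendstoD[OF Mlim]) auto
    have "\<forall>\<^sub>F k in sequentially. \<bar>sqrt k * (\<phi> k w - \<phi> k 0) - w * ((G \<epsilon> - G 0) / \<epsilon>)\<bar> \<le> K * \<epsilon>"
      using ev ev1 ev2 eventually_ge_at_top[of 2]
    proof eventually_elim
      case (elim k)
      have k: "0 < sqrt k" "sqrt k * sqrt k = k" "0 < real k" using elim(4) by auto
      have "0 < \<epsilon> / 2 * sqrt k" using \<epsilon> k by simp
      then have M: "0 < real (M k)" unfolding M_def by (metis real_nat_ceiling_ge order_less_le_trans)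
      have sd: "\<bar>\<phi> k (a + 4) - 2 * \<phi> k (a + 2) + \<phi> k a\<bar> \<le> K / k" for a
      proof -
        have "\<bar>\<phi> k (a + 4) - 2 * \<phi> k (a + 2) + \<phi> k a\<bar> \<le> (1 + 2 / \<delta>\<^sup>2) / (real (k - 1) + 1)"
          unfolding \<phi>_def
        proof (rule iid_mean_vote_second_difference)
          show "\<delta> \<le> law k n y x" if "y \<in> paths n" for y
            using elim(1) that paths_abs[OF x] by auto
          then show "0 \<le> law k n y x" if "y \<in> paths n" for y
            using that \<delta> by (meson less_le_trans less_imp_le)
        qed (use elim(4) \<delta> s paths_abs[OF x] in \<open>auto intro: total\<close>)
        then show ?thesis using elim(4) by (simp add: K_def of_nat_diff)
      qed
      have par: "2 * \<phi> k (real_of_int a) = \<phi> k (a + 1) + \<phi> k (a - 1)" if "even (a + int (k - 1))" for a :: int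
        unfolding \<phi>_def by (rule iid_mean_vote_parity[OF s that])
      have step: "\<phi> k w - \<phi> k 0 = w / 2 * (\<phi> k (b k + 2) - \<phi> k (b k))"
      proof (cases "odd k")
        case True
        then show ?thesis using par[of 0] w elim(4) by (auto simp: b_def)
      next
        case False
        then show ?thesis using par[of 1] par[of "- 1"] w elim(4) by (auto simp: b_def)
      qed
      let ?d = "\<phi> k (b k + 2) - \<phi> k (b k)" and ?D = "\<phi> k (b k + 2 * real (M k)) - \<phi> k (b k)"
      have "\<bar>real (M k) * ?d - ?D\<bar> \<le> (real (M k))\<^sup>2 * (K / k)"
        by (rule second_difference_sum[OF sd])
      moreover have "real (M k) * ?d - ?D = real (M k) * (?d - ?D / real (M k))"
        using M by (simp add: field_simps)
      ultimately have "real (M k) * \<bar>?d - ?D / real (M k)\<bar> \<le> real (M k) * (real (M k) * (K / k))"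
        using M by (simp add: abs_mult power2_eq_square mult.assoc)
      then have d: "\<bar>?d - ?D / real (M k)\<bar> \<le> real (M k) * (K / k)"
        using M by (subst (asm) mult_le_cancel_left_pos) auto
      have "sqrt k * (w / 2 * z) - w / 2 * (z' / (real (M k) / sqrt k)) =
          w / 2 * (sqrt k * (z - z' / real (M k)))" for z z'
        by (simp add: algebra_simps)
      then have "\<bar>sqrt k * (\<phi> k w - \<phi> k 0) - w / 2 * (?D / (real (M k) / sqrt k))\<bar> =
          \<bar>w / 2 * (sqrt k * (?d - ?D / real (M k)))\<bar>"
        unfolding step by (simp only:)
      also have "\<dots> = sqrt k / 2 * \<bar>?d - ?D / real (M k)\<bar>"
        using w k(1) by (auto simp: abs_mult)
      also have "\<dots> \<le> sqrt k / 2 * (real (M k) * (K / k))"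
        using d k(1) by (intro mult_left_mono) auto
      also have "\<dots> = K / 2 * (real (M k) / sqrt k)"
      proof -
        define r where "r = sqrt k"
        have "real k = r * r" "0 < r" using k by (auto simp: r_def)
        then show ?thesis unfolding r_def[symmetric] by (simp add: field_simps)
      qed
      also have "\<dots> \<le> K / 2 * \<epsilon>" using elim(3) K by (intro mult_left_mono) auto
      finally have 1: "\<bar>sqrt k * (\<phi> k w - \<phi> k 0) - w / 2 * (?D / (real (M k) / sqrt k))\<bar> \<le> K / 2 * \<epsilon>" .
      have "\<bar>p - r\<bar> \<le> e + e'" if "\<bar>p - q\<bar> \<le> e" "\<bar>q - r\<bar> < e'" for p q r e e' :: real
        using that by linarith
      from this[OF 1 elim(2)] show ?case by simp
    qed
    then show ?thesis unfolding \<phi>_def G0 by (simp add: G_def)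
  qed
  show thesis by (rule that[OF K main])
qed

text \<open>The forcing is switched on one time after another, and the responses to the single
  switches add up to a linear functional of \<open>u\<close>. Averaged against \<open>x t\<close>,
  the Gaussian quotients become difference quotients of the expectation of the effective process at
  time \<open>t\<close>, which tend to \<open>R t s\<close> by consistency.\<close>

lemma mean_converges_Suc:
  assumes n: "law_converges n" "mean_converges n" and low: "law_bounded_below n"
  shows "mean_converges (Suc n)"
  unfolding mean_converges_def
proof (intro allI impI)
  fix u :: "nat \<Rightarrow> real" and t assume u: "\<forall>s<Suc n. u s = - 1 \<or> u s = 1" and t: "t < Suc n"
  obtain K where K: "0 < K" and resp: "\<And>x s c w \<epsilon>. x \<in> paths (Suc n) \<Longrightarrow> s < n \<Longrightarrow> w = - 1 \<or> w = 1 \<Longrightarrow> 0 < \<epsilon> \<Longrightarrow>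
      \<forall>\<^sub>F k in sequentially.
       \<bar>sqrt k * (iid_mean (\<lambda>y. law k n y x) (paths n) (k - 1) (vote n x (c(s := w))) -
                  iid_mean (\<lambda>y. law k n y x) (paths n) (k - 1) (vote n x (c(s := 0)))) -
        w * ((gauss_vote n x ((\<lambda>_. 0)(s := \<epsilon>)) - gauss_vote n x (\<lambda>_. 0)) / \<epsilon>)\<bar> \<le> K * \<epsilon>"
    by (rule response_limit[OF n low]) blast
  define F where "F = (\<lambda>k x c. iid_mean (\<lambda>y. law k n y x) (paths n) (k - 1) (vote n x c))"
  define g where "g = (\<lambda>x s \<epsilon>. (gauss_vote n x ((\<lambda>_. 0)(s := \<epsilon>)) - gauss_vote n x (\<lambda>_. 0)) / \<epsilon>)"
  \<comment> \<open>\<open>U s\<close> keeps the entries of \<open>u\<close> before time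
    \<open>s\<close>: \<open>U 0\<close> is the zero field, and \<open>U n\<close> agrees with
    \<open>u\<close> as far as the vote sees it.\<close>
  define U where "U = (\<lambda>s r. if r < s then u r else 0 :: real)"
  define \<Delta> where "\<Delta> = (\<lambda>k x s. sqrt k * (F k x ((U s)(s := u s)) - F k x ((U s)(s := 0))))"
  define Tg where "Tg = (\<lambda>\<epsilon>. \<Sum>x\<in>paths (Suc n). \<Sum>s<n. x t / 2 * (u s * g x s \<epsilon>))"
  define l where "l = (\<Sum>s<t. R t s * u s)"
  have mean: "sqrt k * (\<Sum>x\<in>paths (Suc n). law k (Suc n) x u * x t) =
      (\<Sum>x\<in>paths (Suc n). \<Sum>s<n. x t / 2 * \<Delta> k x s)" for k
  proof -
    have tele: "F k x u - F k x (\<lambda>_. 0) = (\<Sum>s<n. F k x ((U s)(s := u s)) - F k x ((U s)(s := 0)))" for x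
    proof -
      have "(U s)(s := u s) = U (Suc s)" "(U s)(s := 0) = U s" for s
        by (auto simp: U_def fun_eq_iff less_Suc_eq)
      then have "(\<Sum>s<n. F k x ((U s)(s := u s)) - F k x ((U s)(s := 0))) = F k x (U n) - F k x (U 0)"
        using sum_lessThan_telescope[of "\<lambda>s. F k x (U s)" n] by simp
      moreover have "F k x (U n) = F k x u" "F k x (U 0) = F k x (\<lambda>_. 0)"
        unfolding F_def by (intro iid_mean_cong vote_cong; simp add: U_def)+
      ultimately show ?thesis by simp
    qed
    have "(\<Sum>x\<in>paths (Suc n). law k (Suc n) x u * x t) =
       (\<Sum>x\<in>paths (Suc n). law k (Suc n) x u * x t) - (\<Sum>x\<in>paths (Suc n). x t * law k (Suc n) x (\<lambda>_. 0))"
      using law_mean_zero[OF t, of k] by simp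
    also have "\<dots> = (\<Sum>x\<in>paths (Suc n). x t / 2 * (F k x u - F k x (\<lambda>_. 0)))"
      by (simp add: F_def sum_subtractf[symmetric] algebra_simps diff_divide_distrib)
    finally show ?thesis unfolding tele \<Delta>_def by (simp add: sum_distrib_left mult_ac)
  qed
  have Tg: "Tg \<epsilon> = (\<Sum>s<n. u s * ((expectation (\<tau> ((\<lambda>_. 0)(s := \<epsilon>)) t) - expectation (\<tau> (\<lambda>_. 0) t)) / \<epsilon>))" for \<epsilon>
  proof -
    have gx: "(\<Sum>x\<in>paths (Suc n). x t / 2 * g x s \<epsilon>) =
        (expectation (\<tau> ((\<lambda>_. 0)(s := \<epsilon>)) t) - expectation (\<tau> (\<lambda>_. 0) t)) / \<epsilon>" for s
    proof -
      have "(\<Sum>x\<in>paths (Suc n). x t / 2 * g x s \<epsilon>) =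
        (\<Sum>x\<in>paths (Suc n). (x t * path_prob (Suc n) x ((\<lambda>_. 0)(s := \<epsilon>)) - x t * path_prob (Suc n) x (\<lambda>_. 0)) / \<epsilon>)"
        by (intro sum.cong refl) (simp add: path_prob_Suc g_def field_simps)
      then show ?thesis unfolding expectation_tau[OF t] by (simp only: sum_subtractf[symmetric] sum_divide_distrib)
    qed
    have "(\<Sum>s<n. u s * ((expectation (\<tau> ((\<lambda>_. 0)(s := \<epsilon>)) t) - expectation (\<tau> (\<lambda>_. 0) t)) / \<epsilon>)) =
       (\<Sum>s<n. \<Sum>x\<in>paths (Suc n). x t / 2 * (u s * g x s \<epsilon>))"
      by (simp add: gx[symmetric] sum_distrib_left mult_ac)
    then show ?thesis unfolding Tg_def by (subst sum.swap) simp
  qed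
  \<comment> \<open>Only positive \<open>\<epsilon>\<close> occur, so the derivative is restricted
    to the right. A field at a time \<open>s \<ge> t\<close> has no effect by causality, which cuts
    the sum down to \<open>s < t\<close>.\<close>
  have Tlim: "(Tg \<longlongrightarrow> l) (at_right 0)"
  proof -
    have "((\<lambda>\<epsilon>. (expectation (\<tau> ((\<lambda>_. 0)(s := \<epsilon>)) t) - expectation (\<tau> (\<lambda>_. 0) t)) / \<epsilon>) \<longlongrightarrow>
        (if s < t then R t s else 0)) (at_right 0)" for s
    proof (cases "s < t")
      case True
      have z: "(\<lambda>_::nat. 0::real)(s := 0) = (\<lambda>_. 0)" by auto
      from consistent_R[OF True] show ?thesis
        using True unfolding has_field_derivative_iff z by (auto intro: tendsto_within_subset)
    next
      case False
      have "\<tau> ((\<lambda>_. 0)(s := \<epsilon>)) t = \<tau> (\<lambda>_. 0) t" for \<epsilon>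
        using False by (intro ext tau_causal) auto
      then show ?thesis using False by simp
    qed
    then have "(Tg \<longlongrightarrow> (\<Sum>s<n. u s * (if s < t then R t s else 0))) (at_right 0)"
      unfolding Tg by (intro tendsto_intros)
    also have "(\<Sum>s<n. u s * (if s < t then R t s else 0)) = (\<Sum>s\<in>{..<n} \<inter> {s. s < t}. u s * R t s)"
      by (subst sum.inter_restrict) (auto intro!: sum.cong)
    also have "{..<n} \<inter> {s. s < t} = {..<t}" using t by auto
    finally show ?thesis by (simp add: l_def mult.commute)
  qed
  define K' where "K' = real (card (paths (Suc n))) * real n * (K / 2)"
  have close: "\<forall>\<^sub>F k in sequentially.
      \<bar>sqrt k * (\<Sum>x\<in>paths (Suc n). law k (Suc n) x u * x t) - Tg \<epsilon>\<bar> \<le> K' * \<epsilon>" if \<epsilon>: "0 < \<epsilon>" for \<epsilon>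
  proof -
    have "\<forall>\<^sub>F k in sequentially. \<forall>x\<in>paths (Suc n). \<forall>s\<in>{..<n}. \<bar>\<Delta> k x s - u s * g x s \<epsilon>\<bar> \<le> K * \<epsilon>"
    proof (intro eventually_ball_finite ballI)
      fix x s assume "x \<in> paths (Suc n)" "s \<in> {..<n}"
      then show "\<forall>\<^sub>F k in sequentially. \<bar>\<Delta> k x s - u s * g x s \<epsilon>\<bar> \<le> K * \<epsilon>"
        unfolding \<Delta>_def F_def g_def using u \<epsilon> by (intro resp) auto
    qed auto
    then show ?thesis
    proof eventually_elim
      case (elim k)
      have "\<bar>(\<Sum>x\<in>paths (Suc n). \<Sum>s<n. x t / 2 * \<Delta> k x s) - Tg \<epsilon>\<bar> =
          \<bar>\<Sum>x\<in>paths (Suc n). \<Sum>s<n. x t / 2 * (\<Delta> k x s - u s * g x s \<epsilon>)\<bar>"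
        by (simp add: Tg_def sum_subtractf right_diff_distrib)
      also have "\<dots> \<le> (\<Sum>x\<in>paths (Suc n). \<Sum>s<n. \<bar>x t / 2 * (\<Delta> k x s - u s * g x s \<epsilon>)\<bar>)"
        by (intro order_trans[OF sum_abs] sum_mono sum_abs)
      also have "\<dots> \<le> (\<Sum>x\<in>paths (Suc n). \<Sum>s<n. K / 2 * \<epsilon>)"
        using elim t by (intro sum_mono) (auto simp: abs_mult paths_abs)
      also have "\<dots> = K' * \<epsilon>" by (simp add: K'_def)
      finally show ?case unfolding mean .
    qed
  qed
  show "(\<lambda>k. sqrt k * (\<Sum>x\<in>paths (Suc n). law k (Suc n) x u * x t)) \<longlonglongrightarrow> (\<Sum>s<t. R t s * u s)"
  proof (rule tendstoI)
    fix e :: real assume e: "0 < e"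
    have "\<forall>\<^sub>F \<epsilon> in at_right 0. \<bar>Tg \<epsilon> - l\<bar> < e / 2"
      using tendstoD[OF Tlim, of "e / 2"] e by (simp add: dist_real_def)
    moreover have "((\<lambda>\<epsilon>. K' * \<epsilon>) \<longlongrightarrow> K' * 0) (at_right 0)" by (intro tendsto_intros)
    then have "\<forall>\<^sub>F \<epsilon> in at_right 0. K' * \<epsilon> < e / 2" using e by (intro order_tendstoD) auto
    moreover have "\<forall>\<^sub>F \<epsilon> in at_right 0. 0 < (\<epsilon> :: real)" by (rule eventually_at_right_less)
    ultimately have "\<forall>\<^sub>F \<epsilon> in at_right 0. \<bar>Tg \<epsilon> - l\<bar> < e / 2 \<and> K' * \<epsilon> < e / 2 \<and> 0 < \<epsilon>"
      by eventually_elim auto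
    then obtain \<epsilon> where \<epsilon>: "\<bar>Tg \<epsilon> - l\<bar> < e / 2" "K' * \<epsilon> < e / 2" "0 < \<epsilon>"
      using eventually_happens'[OF trivial_limit_at_right_real] by blast
    from close[OF \<epsilon>(3)]
    show "\<forall>\<^sub>F k in sequentially. dist (sqrt k * (\<Sum>x\<in>paths (Suc n). law k (Suc n) x u * x t)) (\<Sum>s<t. R t s * u s) < e"
    proof eventually_elim
      case (elim k)
      then show ?case using \<epsilon> unfolding dist_real_def l_def by linarith
    qed
  qed
qed

lemma law_asymptotics: "law_converges n \<and> mean_converges n \<and> law_bounded_below n"
proof (induction n)
  case 0
  have "law_bounded_below 0" unfolding law_bounded_below_def by (intro exI[of _ 1]) auto
  then show ?case by (auto simp: law_converges_def mean_converges_def)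
next
  case (Suc n)
  then show ?case using law_converges_Suc mean_converges_Suc law_bounded_below_Suc by blast
qed

text \<open>The root has no parent, so all \<open>k\<close> neighbors count as children and no field
  is added; the passage from \<open>k - 1\<close> to \<open>k\<close> samples leaves the limit
  unchanged.\<close>

lemma root_limit:
  assumes x: "x \<in> paths (Suc n)"
  shows "(\<lambda>k. 1 / 2 * iid_mean (\<lambda>y. law k n y x) (paths n) k (vote n x (\<lambda>_. 0))) \<longlonglongrightarrow> path_prob (Suc n) x (\<lambda>_. 0)"
proof -
  have "(\<lambda>k. iid_mean (\<lambda>y. law k n y x) (paths n) k (vote n x (\<lambda>_. 0))) \<longlonglongrightarrow> gauss_vote n x (\<lambda>_. 0)"
  proof (rule law_vote_limit[OF _ _ x])
    show "(\<lambda>k::nat. real k / k) \<longlonglongrightarrow> 1" by real_asymp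
  qed (use law_asymptotics[of n] in auto)
  from tendsto_mult_left[OF this, of "1 / 2"] show ?thesis unfolding path_prob_Suc[OF x] .
qed

end

end

section \<open>The forced process on the tree\<close>

text \<open>Loops are cut while the walk is built from its end: if the new vertex already occurs,
  the list restarts at that occurrence.\<close>

lemma rtranclp_distinct_list:
  assumes "r\<^sup>*\<^sup>* a b"
  obtains p where "p \<noteq> []" "hd p = a" "last p = b" "distinct p" "successively r p"
proof -
  from assms have "\<exists>p. p \<noteq> [] \<and> hd p = a \<and> last p = b \<and> distinct p \<and> successively r p"
  proof (induction rule: converse_rtranclp_induct)
    case base
    then show ?case by (intro exI[of _ "[b]"]) simp
  next
    case (step a c)
    then obtain p where p: "p \<noteq> []" "hd p = c" "last p = b" "distinct p" "successively r p" by blast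
    show ?case
    proof (cases "a \<in> set p")
      case True
      then obtain xs ys where "p = xs @ a # ys" by (auto simp: in_set_conv_decomp)
      then show ?thesis using p by (intro exI[of _ "a # ys"]) (auto simp: successively_append_iff)
    next
      case False
      then show ?thesis using p step(1)
        by (intro exI[of _ "a # p"]) (auto simp: successively_Cons)
    qed
  qed
  then show thesis using that by blast
qed

text \<open>Passage from families indexed by neighbors, as they arise on the tree, to the lists of
  \<open>iid_mean\<close>; it works because \<open>f\<close> sees a family only through its
  sums.\<close>

lemma iid_mean_PiE:
  assumes "finite L"
  shows "(\<Sum>y\<in>L \<rightarrow>\<^sub>E A. (\<Prod>l\<in>L. \<nu> (y l)) * f (\<lambda>t. \<Sum>l\<in>L. y l t)) = iid_mean \<nu> A (card L) (\<lambda>ys. f (psum ys))"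
  using assms
proof (induction L arbitrary: f rule: finite_induct)
  case (insert l L)
  let ?g = "\<lambda>y. (\<Prod>l\<in>insert l L. \<nu> (y l)) * f (\<lambda>t. \<Sum>l\<in>insert l L. y l t)"
  have "(\<Sum>y\<in>insert l L \<rightarrow>\<^sub>E A. ?g y) = (\<Sum>z\<in>A \<times> (L \<rightarrow>\<^sub>E A). ?g ((\<lambda>(v, y). y(l := v)) z))"
    unfolding PiE_insert_eq using insert.hyps
    by (subst sum.reindex) (auto simp: inj_combinator[of l L "\<lambda>_. A", simplified])
  also have "\<dots> = (\<Sum>v\<in>A. \<Sum>y\<in>L \<rightarrow>\<^sub>E A. ?g (y(l := v)))"
    by (simp add: sum.cartesian_product case_prod_unfold)
  also have "\<dots> = (\<Sum>v\<in>A. \<nu> v * (\<Sum>y\<in>L \<rightarrow>\<^sub>E A. (\<Prod>l\<in>L. \<nu> (y l)) * f (\<lambda>t. v t + (\<Sum>l\<in>L. y l t))))"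
  proof (intro sum.cong refl)
    fix v
    have "?g (y(l := v)) = \<nu> v * ((\<Prod>l\<in>L. \<nu> (y l)) * f (\<lambda>t. v t + (\<Sum>l\<in>L. y l t)))" for y
    proof -
      have "(\<Prod>m\<in>L. \<nu> ((y(l := v)) m)) = (\<Prod>l\<in>L. \<nu> (y l))"
        "(\<Sum>m\<in>L. (y(l := v)) m t) = (\<Sum>l\<in>L. y l t)" for t
        using insert.hyps by (auto intro!: prod.cong sum.cong)
      then show ?thesis using insert.hyps by simp
    qed
    then show "(\<Sum>y\<in>L \<rightarrow>\<^sub>E A. ?g (y(l := v))) =
      \<nu> v * (\<Sum>y\<in>L \<rightarrow>\<^sub>E A. (\<Prod>l\<in>L. \<nu> (y l)) * f (\<lambda>t. v t + (\<Sum>l\<in>L. y l t)))"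
      by (simp only: sum_distrib_left)
  qed
  also have "\<dots> = (\<Sum>v\<in>A. \<nu> v * iid_mean \<nu> A (card L) (\<lambda>ys. f (\<lambda>t. v t + psum ys t)))"
  proof (intro sum.cong refl)
    fix v
    show "\<nu> v * (\<Sum>y\<in>L \<rightarrow>\<^sub>E A. (\<Prod>l\<in>L. \<nu> (y l)) * f (\<lambda>t. v t + (\<Sum>l\<in>L. y l t))) =
      \<nu> v * iid_mean \<nu> A (card L) (\<lambda>ys. f (\<lambda>t. v t + psum ys t))"
      using insert.IH[of "\<lambda>g. f (\<lambda>t. v t + g t)"] by simp
  qed
  finally show ?case using insert.hyps by simp
qed simp

text \<open>Forced spins are to be signs in every environment, also where the environment itself is
  not; on the values that occur \<open>sign_of\<close> is the identity.\<close>

definition sign_of :: "real \<Rightarrow> real" where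
  "sign_of z = (if z = 1 then 1 else - 1)"

definition majority :: "real \<Rightarrow> real \<Rightarrow> real \<Rightarrow> real" where
  "majority s z x = (if s \<noteq> 0 then sgn s else z * x)"

lemma sign_of_cases: "sign_of z = - 1 \<or> sign_of z = 1"
  by (simp add: sign_of_def)

lemma majority_cases:
  "z = - 1 \<or> z = 1 \<Longrightarrow> x = - 1 \<or> x = 1 \<Longrightarrow> majority s z x = - 1 \<or> majority s z x = 1"
  by (auto simp: majority_def sgn_real_def)

lemma sign_of_measurable [measurable]: "sign_of \<in> borel_measurable borel"
  unfolding sign_of_def by measurable

lemma majority_measurable [measurable]:
  assumes [measurable]: "f \<in> borel_measurable M" "g \<in> borel_measurable M"
  shows "(\<lambda>e. majority (f e) (g e) x) \<in> borel_measurable M"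
  unfolding majority_def by measurable

section \<open>Branches of the tree and their forced spins\<close>

context regular_tree
begin

text \<open>
  The spins in the subtree of \<open>j\<close> away from its neighbor \<open>p\<close> if the path of \<open>p\<close> is replaced by
  \<open>u\<close>. An environment \<open>e\<close> assigns initial spins and coins to all vertices.
  The path of \<open>j\<close> up to time \<open>t\<close> is computed at once, since it acts as the external path on the
  children of \<open>j\<close>.
\<close>

fun forced :: "('v + 'v \<times> nat \<Rightarrow> real) \<Rightarrow> nat \<Rightarrow> 'v \<Rightarrow> 'v \<Rightarrow> (nat \<Rightarrow> real) \<Rightarrow> nat \<Rightarrow> real" where
  "forced e 0 p j u = (\<lambda>_. sign_of (e (Inl j)))"
| "forced e (Suc t) p j u = (let x = forced e t p j u in x(Suc t :=
     majority (u t + (\<Sum>l\<in>neighbors adj j - {p}. forced e t j l x t)) (sign_of (e (Inr (j, t)))) (x t)))"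

declare forced.simps(2) [simp del]

lemma forced_Suc_eq [simp]: "forced e (Suc t) p j u = (forced e t p j u)(Suc t :=
    majority (u t + (\<Sum>l\<in>neighbors adj j - {p}. forced e t j l (forced e t p j u) t))
      (sign_of (e (Inr (j, t)))) (forced e t p j u t))"
  by (simp add: forced.simps(2) Let_def)

text \<open>The condition for \<open>j\<close> to follow \<open>x\<close>, with the children
  \<open>L\<close> forced by \<open>x\<close> itself instead of by the path of \<open>j\<close>,
  which removes the interaction between them. For a root \<open>L\<close> consists of all neighbors,
  otherwise of all but the parent.\<close>

definition node_path ::
  "('v + 'v \<times> nat \<Rightarrow> real) \<Rightarrow> 'v \<Rightarrow> 'v set \<Rightarrow> (nat \<Rightarrow> real) \<Rightarrow> (nat \<Rightarrow> real) \<Rightarrow> nat \<Rightarrow> bool" where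
  "node_path e j L u x n \<longleftrightarrow> sign_of (e (Inl j)) = x 0 \<and>
     (\<forall>t<n. majority (u t + (\<Sum>l\<in>L. forced e t j l x t)) (sign_of (e (Inr (j, t)))) (x t) = x (Suc t))"

lemma forced_stable: "s \<le> t \<Longrightarrow> forced e t p j u s = forced e s p j u s"
  by (induction t) (auto simp: le_Suc_eq)

lemma forced_cong: "(\<And>s. s < t \<Longrightarrow> u s = u' s) \<Longrightarrow> forced e t p j u = forced e t p j u'"
  by (induction t) auto

lemma forced_cases: "forced e t p j u s = - 1 \<or> forced e t p j u s = 1"
proof (induction t arbitrary: s)
  case (Suc t)
  then show ?case using majority_cases[OF sign_of_cases Suc] by simp
qed (simp add: sign_of_cases)

lemma forced_Suc:
  assumes "\<And>s. s \<le> t \<Longrightarrow> forced e s p j u s = x s"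
  shows "forced e (Suc t) p j u (Suc t) =
    majority (u t + (\<Sum>l\<in>neighbors adj j - {p}. forced e t j l x t)) (sign_of (e (Inr (j, t)))) (x t)"
proof -
  have "forced e t j l (forced e t p j u) = forced e t j l x" for l
  proof (rule forced_cong)
    fix s assume "s < t"
    then show "forced e t p j u s = x s" using forced_stable[of s t e p j u] assms[of s] by simp
  qed
  then show ?thesis using assms[of t] by simp
qed

text \<open>As long as \<open>j\<close> has followed \<open>x\<close>, its children have seen
  nothing but \<open>x\<close>, so forcing them by \<open>x\<close> or by the actual path of
  \<open>j\<close> is the same.\<close>

lemma forced_iff_node_path:
  "(\<forall>t<Suc n. forced e t p j u t = x t) \<longleftrightarrow> node_path e j (neighbors adj j - {p}) u x n"
proof (induction n)
  case (Suc n)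
  have "(\<forall>t<Suc (Suc n). forced e t p j u t = x t) \<longleftrightarrow>
     (\<forall>t<Suc n. forced e t p j u t = x t) \<and> forced e (Suc n) p j u (Suc n) = x (Suc n)"
    by (metis less_Suc_eq)
  also have "\<dots> \<longleftrightarrow> (\<forall>t<Suc n. forced e t p j u t = x t) \<and>
     majority (u n + (\<Sum>l\<in>neighbors adj j - {p}. forced e n j l x n)) (sign_of (e (Inr (j, n)))) (x n) = x (Suc n)"
    using forced_Suc[of n e p j u x] by auto
  also have "\<dots> \<longleftrightarrow> node_path e j (neighbors adj j - {p}) u x (Suc n)"
    unfolding Suc by (auto simp: node_path_def less_Suc_eq)
  finally show ?case .
qed (auto simp: node_path_def)

text \<open>The component of \<open>j\<close> after removal of \<open>p\<close>: the branch that
  hangs off the edge from \<open>p\<close> to \<open>j\<close>.\<close>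

definition subtree :: "'v \<Rightarrow> 'v \<Rightarrow> 'v set" where
  "subtree p j = {v. (\<lambda>a b. adj a b \<and> a \<noteq> p \<and> b \<noteq> p)\<^sup>*\<^sup>* j v}"

lemma subtree_self: "j \<in> subtree p j"
  by (simp add: subtree_def)

lemma subtree_not_parent: "v \<in> subtree p j \<Longrightarrow> p \<noteq> j \<Longrightarrow> v \<noteq> p"
  unfolding subtree_def mem_Collect_eq by (induction rule: rtranclp_induct) auto

lemma subtree_vertices: "v \<in> subtree p j \<Longrightarrow> j \<in> V \<Longrightarrow> v \<in> V"
  unfolding subtree_def mem_Collect_eq by (induction rule: rtranclp_induct) (auto dest: adj_vertices)

text \<open>A connection between \<open>j\<close> and \<open>l\<close> that avoids \<open>p\<close>
  would close to a cycle through \<open>p\<close>.\<close>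

lemma subtree_disjoint:
  assumes "adj p j" "adj p l" "j \<noteq> l"
  shows "subtree p j \<inter> subtree p l = {}"
proof (rule ccontr)
  let ?r = "\<lambda>a b. adj a b \<and> a \<noteq> p \<and> b \<noteq> p"
  assume "subtree p j \<inter> subtree p l \<noteq> {}"
  then obtain v where v: "?r\<^sup>*\<^sup>* j v" "?r\<^sup>*\<^sup>* l v" by (auto simp: subtree_def)
  have "symp ?r\<^sup>*\<^sup>*" by (intro symp_rtranclp) (auto simp: symp_def adj_sym)
  then have "?r\<^sup>*\<^sup>* v l" using v(2) by (auto dest: sympD)
  with v(1) have "?r\<^sup>*\<^sup>* j l" by (rule rtranclp_trans)
  then obtain q where q: "q \<noteq> []" "hd q = j" "last q = l" "distinct q" "successively ?r q"
    by (rule rtranclp_distinct_list)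
  have "p \<noteq> j" using assms(1) adj_irrefl by blast
  have "p \<notin> set q"
    using q(1,2,5) \<open>p \<noteq> j\<close>
  proof (induction q arbitrary: j)
    case (Cons a q)
    then show ?case by (cases q) (auto simp: successively_Cons)
  qed simp
  have adjq: "successively adj q" using q(5) by (rule successively_mono) auto
  have "length q \<noteq> 1" using q(2,3) assms(3) by (auto simp: length_Suc_conv)
  moreover have "length q \<noteq> 0" using q(1) by simp
  ultimately have "3 \<le> length (p # q)" by (cases q; cases "tl q") auto
  moreover have "distinct (p # q)" using q(4) \<open>p \<notin> set q\<close> by simp
  moreover have "successively adj (p # q)" using q(1,2) adjq assms(1) by (auto simp: successively_Cons)
  ultimately have "\<not> adj (last (p # q)) (hd (p # q))" by (rule no_cycle)
  then show False using q(1,3) assms(2) adj_sym by simp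
qed

text \<open>Seen from \<open>j\<close>, the parent \<open>p\<close> lies in another branch than
  \<open>l\<close>; hence walks from \<open>l\<close> that avoid \<open>j\<close> avoid
  \<open>p\<close> as well.\<close>

lemma subtree_nested:
  assumes "adj p j" "adj j l" "l \<noteq> p"
  shows "subtree j l \<subseteq> subtree p j - {j}"
proof
  fix v assume v: "v \<in> subtree j l"
  have ne: "j \<noteq> l" using assms(2) adj_irrefl by blast
  have pne: "p \<noteq> j" using assms(1) adj_irrefl by blast
  have avoid: "w \<noteq> p" if "w \<in> subtree j l" for w
    using subtree_disjoint[OF assms(2) adj_sym[OF assms(1)] assms(3)] subtree_self[of p j] that by blast
  have "v \<in> subtree p j"
    using v unfolding subtree_def mem_Collect_eq
  proof (induction rule: rtranclp_induct)
    case base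
    then show ?case using assms pne by (intro r_into_rtranclp) auto
  next
    case (step w z)
    then have "w \<noteq> p" "z \<noteq> p"
      by (auto intro!: avoid simp: subtree_def intro: rtranclp.rtrancl_into_rtrancl)
    then show ?case using step by (auto intro: rtranclp.rtrancl_into_rtrancl)
  qed
  then show "v \<in> subtree p j - {j}" using subtree_not_parent[OF v ne] by simp
qed

abbreviation env_on :: "'v set \<Rightarrow> ('v + 'v \<times> nat) set" where
  "env_on D \<equiv> D <+> D \<times> UNIV"

text \<open>With \<open>subtree_disjoint\<close> this makes siblings functions of disjoint parts of
  the environment, hence independent.\<close>

lemma forced_local:
  assumes "adj p j" "\<And>i. i \<in> env_on (subtree p j) \<Longrightarrow> e i = e' i"
  shows "forced e t p j u = forced e' t p j u"
  using assms
proof (induction t arbitrary: p j u)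
  case 0
  have "e (Inl j) = e' (Inl j)" using subtree_self[of j p] by (intro 0(2)) auto
  then show ?case by simp
next
  case (Suc t)
  have 1: "forced e t p j u = forced e' t p j u" using Suc by auto
  have child: "forced e t j l x = forced e' t j l x" if "l \<in> neighbors adj j - {p}" for l x
  proof (rule Suc.IH)
    show "adj j l" using that by (simp add: neighbors_def)
    then have "subtree j l \<subseteq> subtree p j"
      using subtree_nested[OF Suc.prems(1)] that by blast
    then show "e i = e' i" if "i \<in> env_on (subtree j l)" for i
      using that by (intro Suc.prems(2)) auto
  qed
  have "(\<Sum>l\<in>neighbors adj j - {p}. forced e t j l x t) = (\<Sum>l\<in>neighbors adj j - {p}. forced e' t j l x t)" for x
    by (intro sum.cong refl) (simp only: child)
  moreover have "e (Inr (j, t)) = e' (Inr (j, t))"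
    using subtree_self[of j p] by (intro Suc.prems(2)) auto
  ultimately show ?case unfolding forced_Suc_eq 1 by simp
qed

text \<open>The children are forced by a random path. Splitting according to the finitely many paths
  of \<open>j\<close> makes the forcing deterministic, and each piece is a \<open>node_path\<close>
  event.\<close>

lemma forced_measurable:
  assumes "adj p j" "env_on (subtree p j) \<subseteq> K"
  shows "(\<lambda>e. forced e t p j u t) \<in> borel_measurable (PiM K (\<lambda>_. borel))"
  using assms
proof (induction t arbitrary: p j u rule: less_induct)
  case (less t)
  let ?M = "PiM K (\<lambda>_. borel :: real measure)"
  have mem: "Inl j \<in> K" "Inr (j, s) \<in> K" for s using less.prems subtree_self[of j p] by auto
  have coord: "(\<lambda>e. sign_of (e i)) \<in> borel_measurable ?M" if "i \<in> K" for i
    using that by measurable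
  show ?case
  proof (cases t)
    case 0
    then show ?thesis using coord[OF mem(1)] by simp
  next
    case (Suc n)
    have child: "(\<lambda>e. forced e s j l x s) \<in> borel_measurable ?M" if "l \<in> neighbors adj j - {p}" "s < t" for l x s
    proof (rule less.IH[OF that(2)])
      show "adj j l" using that by (simp add: neighbors_def)
      then have "subtree j l \<subseteq> subtree p j" using subtree_nested[OF less.prems(1)] that by blast
      then show "env_on (subtree j l) \<subseteq> K" using less.prems(2) by auto
    qed
    have node: "{e \<in> space ?M. node_path e j (neighbors adj j - {p}) u x t} \<in> sets ?M" for x
    proof -
      have "(\<lambda>e. majority (u s + (\<Sum>l\<in>neighbors adj j - {p}. forced e s j l x s)) (sign_of (e (Inr (j, s)))) (x s))
          \<in> borel_measurable ?M" if "s \<in> {..<t}" for s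
        using that child coord[OF mem(2)]
        by (intro majority_measurable borel_measurable_add borel_measurable_sum borel_measurable_const) auto
      note [measurable] = this coord[OF mem(1)]
      have "{e \<in> space ?M. sign_of (e (Inl j)) = x 0 \<and> (\<forall>s\<in>{..<t}.
         majority (u s + (\<Sum>l\<in>neighbors adj j - {p}. forced e s j l x s)) (sign_of (e (Inr (j, s)))) (x s) = x (Suc s))}
         \<in> sets ?M" by measurable
      then show ?thesis by (simp add: node_path_def Ball_def)
    qed
    have eq: "{e \<in> space ?M. forced e t p j u t = 1} =
       (\<Union>x\<in>{x \<in> paths (Suc t). x t = 1}. {e \<in> space ?M. node_path e j (neighbors adj j - {p}) u x t})"
    proof (intro equalityI subsetI)
      fix e assume e: "e \<in> {e \<in> space ?M. forced e t p j u t = 1}"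
      let ?x = "\<lambda>s\<in>{..<Suc t}. forced e s p j u s"
      have "\<forall>s<Suc t. forced e s p j u s = ?x s" by simp
      then have "node_path e j (neighbors adj j - {p}) u ?x t" by (simp only: forced_iff_node_path)
      moreover have "?x \<in> paths (Suc t)" using forced_cases by (auto simp: paths_iff)
      moreover have "?x t = 1" using e by simp
      ultimately show "e \<in> (\<Union>x\<in>{x \<in> paths (Suc t). x t = 1}. {e \<in> space ?M. node_path e j (neighbors adj j - {p}) u x t})"
        using e by blast
    qed (auto simp flip: forced_iff_node_path)
    have [measurable]: "{e \<in> space ?M. forced e t p j u t = 1} \<in> sets ?M"
      unfolding eq by (intro sets.finite_UN node) auto
    have "(\<lambda>e. if forced e t p j u t = 1 then 1 else - 1 :: real) \<in> borel_measurable ?M"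
      by measurable
    moreover have "(\<lambda>e. if forced e t p j u t = 1 then 1 else - 1) = (\<lambda>e. forced e t p j u t)"
    proof
      fix e show "(if forced e t p j u t = 1 then 1 else - 1) = forced e t p j u t"
        using forced_cases[of e t p j u t] by auto
    qed
    ultimately show ?thesis by simp
  qed
qed

end

section \<open>Path probabilities of the majority process\<close>

locale tree_majority = regular_tree k V adj + majority_process V adj 0 M \<sigma> \<xi>
  for k and V :: "'v set" and adj and M :: "'w measure" and \<sigma> and \<xi>
begin

definition environment :: "'w \<Rightarrow> 'v + 'v \<times> nat \<Rightarrow> real" where
  "environment \<omega> i = case_sum (\<lambda>i. \<sigma> i 0) (\<lambda>(i, t). \<xi> i t) i \<omega>"

lemma environment_simps [simp]:
  "environment \<omega> (Inl v) = \<sigma> v 0 \<omega>" "environment \<omega> (Inr (v, t)) = \<xi> v t \<omega>"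
  by (simp_all add: environment_def)

lemma environment_indep: "indep_vars (\<lambda>_. borel) (\<lambda>i \<omega>. environment \<omega> i) (env_on V)"
  using independent by (simp add: environment_def[abs_def])

lemma sign_of_initial: "v \<in> V \<Longrightarrow> \<omega> \<in> space M \<Longrightarrow> sign_of (\<sigma> v 0 \<omega>) = \<sigma> v 0 \<omega>"
  and sign_of_coin: "v \<in> V \<Longrightarrow> \<omega> \<in> space M \<Longrightarrow> sign_of (\<xi> v t \<omega>) = \<xi> v t \<omega>"
  using initial_values[of v \<omega>] coin_values[of v \<omega> t] by (auto simp: sign_of_def)

lemma spin_eq_forced:
  assumes "adj p j" "\<omega> \<in> space M"
  shows "\<sigma> j t \<omega> = forced (environment \<omega>) t p j (\<lambda>s. \<sigma> p s \<omega>) t"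
  using assms(1)
proof (induction t arbitrary: p j rule: less_induct)
  case (less t)
  have j: "j \<in> V" using less.prems adj_vertices by blast
  show ?case
  proof (cases t)
    case 0
    then show ?thesis using j assms(2) by (simp add: sign_of_initial)
  next
    case (Suc n)
    let ?e = "environment \<omega>"
    have "forced ?e (Suc n) p j (\<lambda>s. \<sigma> p s \<omega>) (Suc n) =
       majority (\<sigma> p n \<omega> + (\<Sum>l\<in>neighbors adj j - {p}. forced ?e n j l (\<lambda>s. \<sigma> j s \<omega>) n))
         (sign_of (?e (Inr (j, n)))) (\<sigma> j n \<omega>)"
      by (rule forced_Suc) (use less Suc in auto)
    also have "(\<Sum>l\<in>neighbors adj j - {p}. forced ?e n j l (\<lambda>s. \<sigma> j s \<omega>) n) = (\<Sum>l\<in>neighbors adj j - {p}. \<sigma> l n \<omega>)"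
      by (intro sum.cong refl less.IH[symmetric]) (auto simp: Suc neighbors_def)
    also have "\<sigma> p n \<omega> + (\<Sum>l\<in>neighbors adj j - {p}. \<sigma> l n \<omega>) = (\<Sum>l\<in>neighbors adj j. \<sigma> l n \<omega>)"
      using less.prems sum.remove[OF finite_neighbors[OF j], of p "\<lambda>l. \<sigma> l n \<omega>"] adj_sym
      by (simp add: neighbors_def)
    finally show ?thesis using j assms(2) Suc by (simp add: majority_def update sign_of_coin)
  qed
qed

lemma root_path_iff:
  assumes "i \<in> V" "\<omega> \<in> space M"
  shows "(\<forall>t<Suc n. \<sigma> i t \<omega> = x t) \<longleftrightarrow> node_path (environment \<omega>) i (neighbors adj i) (\<lambda>_. 0) x n"
proof (induction n)
  case (Suc n)
  let ?e = "environment \<omega>"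
  have "(\<forall>t<Suc (Suc n). \<sigma> i t \<omega> = x t) \<longleftrightarrow> (\<forall>t<Suc n. \<sigma> i t \<omega> = x t) \<and> \<sigma> i (Suc n) \<omega> = x (Suc n)"
    by (metis less_Suc_eq)
  also have "\<dots> \<longleftrightarrow> (\<forall>t<Suc n. \<sigma> i t \<omega> = x t) \<and>
     majority (0 + (\<Sum>l\<in>neighbors adj i. forced ?e n i l x n)) (sign_of (?e (Inr (i, n)))) (x n) = x (Suc n)"
  proof (intro conj_cong refl)
    assume x: "\<forall>t<Suc n. \<sigma> i t \<omega> = x t"
    have "forced ?e n i l x n = \<sigma> l n \<omega>" if "l \<in> neighbors adj i" for l
    proof -
      have "forced ?e n i l x = forced ?e n i l (\<lambda>s. \<sigma> i s \<omega>)" using x by (intro forced_cong) simp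
      then show ?thesis using spin_eq_forced[of i l \<omega> n] that assms by (simp add: neighbors_def)
    qed
    then have "(\<Sum>l\<in>neighbors adj i. forced ?e n i l x n) = (\<Sum>l\<in>neighbors adj i. \<sigma> l n \<omega>)" by simp
    then show "\<sigma> i (Suc n) \<omega> = x (Suc n) \<longleftrightarrow>
        majority (0 + (\<Sum>l\<in>neighbors adj i. forced ?e n i l x n)) (sign_of (?e (Inr (i, n)))) (x n) = x (Suc n)"
      using x assms by (simp add: majority_def update sign_of_coin)
  qed
  also have "\<dots> \<longleftrightarrow> node_path ?e i (neighbors adj i) (\<lambda>_. 0) x (Suc n)"
    unfolding Suc by (auto simp: node_path_def less_Suc_eq)
  finally show ?case .
qed (use assms in \<open>auto simp: node_path_def sign_of_initial\<close>)

lemma environment_measurable: "i \<in> env_on V \<Longrightarrow> (\<lambda>\<omega>. environment \<omega> i) \<in> borel_measurable M"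
  using environment_indep unfolding indep_vars_def by auto

lemma initial_prob_sign:
  assumes "v \<in> V" "x = - 1 \<or> x = 1"
  shows "prob {\<omega> \<in> space M. sign_of (\<sigma> v 0 \<omega>) = x} = 1 / 2"
proof -
  have 1: "prob {\<omega> \<in> space M. \<sigma> v 0 \<omega> = 1} = 1 / 2" using initial_prob[OF assms(1)] by simp
  have [measurable]: "\<sigma> v 0 \<in> borel_measurable M" using environment_measurable[of "Inl v"] assms(1) by auto
  have "prob {\<omega> \<in> space M. \<sigma> v 0 \<omega> \<noteq> 1} = 1 / 2"
    using prob_neg[of "\<lambda>\<omega>. \<sigma> v 0 \<omega> = 1"] 1 by simp
  moreover have "{\<omega> \<in> space M. sign_of (\<sigma> v 0 \<omega>) = x} =
     (if x = 1 then {\<omega> \<in> space M. \<sigma> v 0 \<omega> = 1} else {\<omega> \<in> space M. \<sigma> v 0 \<omega> \<noteq> 1})"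
    using assms(2) by (auto simp: sign_of_def)
  ultimately show ?thesis using 1 by simp
qed

lemma majority_prob:
  assumes "v \<in> V" "x = - 1 \<or> x = 1" "x' = - 1 \<or> x' = (1 :: real)"
  shows "prob {\<omega> \<in> space M. majority s (sign_of (\<xi> v t \<omega>)) x = x'} = (1 + x' * sgn s) / 2"
proof (cases "s = 0")
  case False
  then have "sgn s = x' \<or> sgn s = - x'" using assms(3) by (auto simp: sgn_real_def)
  then show ?thesis using False assms(3) by (auto simp: majority_def prob_space)
next
  case True
  have 1: "prob {\<omega> \<in> space M. \<xi> v t \<omega> = 1} = 1 / 2" by (rule coin_prob[OF assms(1)])
  have [measurable]: "\<xi> v t \<in> borel_measurable M" using environment_measurable[of "Inr (v, t)"] assms(1) by auto
  have "prob {\<omega> \<in> space M. \<xi> v t \<omega> \<noteq> 1} = 1 / 2"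
    using prob_neg[of "\<lambda>\<omega>. \<xi> v t \<omega> = 1"] 1 by simp
  moreover have "{\<omega> \<in> space M. majority s (sign_of (\<xi> v t \<omega>)) x = x'} =
     (if x = x' then {\<omega> \<in> space M. \<xi> v t \<omega> = 1} else {\<omega> \<in> space M. \<xi> v t \<omega> \<noteq> 1})"
    using True assms(2,3) by (auto simp: majority_def sign_of_def)
  ultimately show ?thesis using 1 True by simp
qed

lemma own_randomness_prob:
  assumes j: "j \<in> V" and x: "x \<in> paths (Suc n)"
  shows "prob {\<omega> \<in> space M. sign_of (\<sigma> j 0 \<omega>) = x 0 \<and> (\<forall>t<n. majority (s t) (sign_of (\<xi> j t \<omega>)) (x t) = x (Suc t))} =
    1 / 2 * (\<Prod>t<n. (1 + x (Suc t) * sgn (s t)) / 2)"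
proof -
  let ?J = "insert (Inl j) ((\<lambda>t. Inr (j, t)) ` {..<n}) :: ('v + 'v \<times> nat) set"
  define A where "A = case_sum (\<lambda>_::'v. {z. sign_of z = x 0})
    (\<lambda>(_::'v, t). {z. majority (s t) (sign_of z) (x t) = x (Suc t)})"
  have "{\<omega> \<in> space M. sign_of (\<sigma> j 0 \<omega>) = x 0 \<and> (\<forall>t<n. majority (s t) (sign_of (\<xi> j t \<omega>)) (x t) = x (Suc t))} =
     (\<Inter>i\<in>?J. (\<lambda>\<omega>. environment \<omega> i) -` A i \<inter> space M)"
    by (auto simp: A_def)
  also have "prob \<dots> = (\<Prod>i\<in>?J. prob ((\<lambda>\<omega>. environment \<omega> i) -` A i \<inter> space M))"
  proof (rule indep_varsD[OF environment_indep])
    have "{z. sign_of z = x 0} \<in> sets borel" by measurable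
    moreover have "{z. majority (s t) (sign_of z) (x t) = x (Suc t)} \<in> sets borel" for t by measurable
    ultimately show "A i \<in> sets borel" for i by (auto simp: A_def split: sum.splits)
  qed (use j in auto)
  also have "\<dots> = prob {\<omega> \<in> space M. sign_of (\<sigma> j 0 \<omega>) = x 0} *
      (\<Prod>t<n. prob {\<omega> \<in> space M. majority (s t) (sign_of (\<xi> j t \<omega>)) (x t) = x (Suc t)})"
    by (subst prod.insert) (auto simp: prod.reindex inj_on_def A_def vimage_def Int_def conj_commute)
  also have "\<dots> = 1 / 2 * (\<Prod>t<n. (1 + x (Suc t) * sgn (s t)) / 2)"
    using pathsD[OF x] by (auto simp: initial_prob_sign[OF j] majority_prob[OF j] intro!: prod.cong)
  finally show ?thesis .
qed

text \<open>Once \<open>x\<close> is prescribed, the randomness of \<open>j\<close> itself and the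
  branches of its children occupy disjoint, hence independent, parts of the environment. Summing
  over all families \<open>y\<close> of paths of the children gives the average in
  \<open>iid_mean\<close>.\<close>

lemma node_path_prob:
  assumes j: "j \<in> V" and L: "L \<subseteq> neighbors adj j" and x: "x \<in> paths (Suc n)"
    and law: "\<And>l y. l \<in> L \<Longrightarrow> y \<in> paths n \<Longrightarrow>
      prob {\<omega> \<in> space M. \<forall>t<n. forced (environment \<omega>) t j l x t = y t} = law k n y x"
  shows "prob {\<omega> \<in> space M. node_path (environment \<omega>) j L u x n} =
    1 / 2 * iid_mean (\<lambda>y. law k n y x) (paths n) (card L) (vote n x u)"
proof -
  have finL: "finite L" using L finite_neighbors[OF j] by (rule finite_subset)
  have adjL: "adj j l" if "l \<in> L" for l using L that by (auto simp: neighbors_def)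
  have jL: "j \<notin> L" using adjL adj_irrefl by blast
  \<comment> \<open>The index \<open>j\<close> is not in \<open>L\<close>, so it can label the block
    of the initial spin and the coins of \<open>j\<close> itself.\<close>
  define K where "K = (\<lambda>l. env_on (if l = j then {j} else subtree j l))"
  have K: "K l = env_on (subtree j l)" if "l \<in> L" for l using that jL by (auto simp: K_def)
  have KV: "K l \<subseteq> env_on V" if "l \<in> insert j L" for l
  proof (cases "l = j")
    case False
    then have "adj j l" using that adjL by blast
    then have "subtree j l \<subseteq> V" using subtree_vertices adj_vertices by blast
    then show ?thesis using False by (auto simp: K_def)
  qed (use j in \<open>auto simp: K_def\<close>)
  have disj: "disjoint_family_on K (insert j L)"
  proof -
    have "(if a = j then {j} else subtree j a) \<inter> (if b = j then {j} else subtree j b) = {}"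
      if "a \<in> insert j L" "b \<in> insert j L" "a \<noteq> b" for a b
      using that subtree_disjoint[of j a b] subtree_not_parent[of j j a] subtree_not_parent[of j j b] adjL by auto
    then show ?thesis unfolding disjoint_family_on_def K_def by blast
  qed
  note ind = indep_vars_restrict[OF environment_indep KV disj]
  \<comment> \<open>For a prescribed family \<open>y\<close> the fields are numbers, so the
    condition on \<open>j\<close> involves only its own initial spin and coins.\<close>
  define S where "S = (\<lambda>y t. u t + (\<Sum>l\<in>L. y l t))"
  define B where "B = (\<lambda>(y :: 'v \<Rightarrow> nat \<Rightarrow> real) l. if l = j
    then {e \<in> space (PiM (K j) (\<lambda>_. borel)). sign_of (e (Inl j)) = x 0 \<and>
      (\<forall>t\<in>{..<n}. majority (S y t) (sign_of (e (Inr (j, t)))) (x t) = x (Suc t))}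
    else {e \<in> space (PiM (K l) (\<lambda>_. borel)). \<forall>t\<in>{..<n}. forced e t j l x t = y l t})"
  have B_sets: "B y l \<in> sets (PiM (K l) (\<lambda>_. borel))" if l: "l \<in> insert j L" for y l
  proof (cases "l = j")
    case True
    have "Inl j \<in> K j" "Inr (j, t) \<in> K j" for t by (auto simp: K_def)
    then have [measurable]: "(\<lambda>e. sign_of (e (Inl j))) \<in> borel_measurable (PiM (K j) (\<lambda>_. borel))"
      "(\<lambda>e. sign_of (e (Inr (j, t)))) \<in> borel_measurable (PiM (K j) (\<lambda>_. borel))" for t
      by measurable
    show ?thesis unfolding B_def True by simp
  next
    case False
    then have l: "l \<in> L" using l by simp
    have [measurable]: "(\<lambda>e. forced e t j l x t) \<in> borel_measurable (PiM (K l) (\<lambda>_. borel))" for t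
      by (rule forced_measurable[OF adjL[OF l]]) (simp add: K l)
    show ?thesis unfolding B_def using False by simp
  qed
  have in_space: "restrict (environment \<omega>) (K l) \<in> space (PiM (K l) (\<lambda>_. borel))" for \<omega> l
    by (simp add: space_PiM)
  have B_j: "restrict (environment \<omega>) (K j) \<in> B y j \<longleftrightarrow> sign_of (\<sigma> j 0 \<omega>) = x 0 \<and>
      (\<forall>t<n. majority (S y t) (sign_of (\<xi> j t \<omega>)) (x t) = x (Suc t))" for y \<omega>
  proof -
    have "Inl j \<in> K j" "Inr (j, t) \<in> K j" for t by (auto simp: K_def)
    then show ?thesis unfolding B_def using in_space[of \<omega> j] by (simp add: Ball_def)
  qed
  have B_l: "restrict (environment \<omega>) (K l) \<in> B y l \<longleftrightarrow> (\<forall>t<n. forced (environment \<omega>) t j l x t = y l t)"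
    if l: "l \<in> L" for y \<omega> l
  proof -
    have "forced (restrict (environment \<omega>) (K l)) t j l x = forced (environment \<omega>) t j l x" for t
      by (rule forced_local[OF adjL[OF l]]) (simp add: K l)
    moreover have "l \<noteq> j" using l jL by blast
    ultimately show ?thesis unfolding B_def using in_space[of \<omega> l] by (simp add: Ball_def)
  qed
  define D where "D = (\<lambda>y. \<Inter>l\<in>insert j L. (\<lambda>\<omega>. restrict (\<lambda>i. environment \<omega> i) (K l)) -` B y l \<inter> space M)"
  have D_iff: "\<omega> \<in> D y \<longleftrightarrow> \<omega> \<in> space M \<and> (sign_of (\<sigma> j 0 \<omega>) = x 0 \<and>
      (\<forall>t<n. majority (S y t) (sign_of (\<xi> j t \<omega>)) (x t) = x (Suc t))) \<and>
      (\<forall>l\<in>L. \<forall>t<n. forced (environment \<omega>) t j l x t = y l t)" for \<omega> y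
    unfolding D_def using B_j B_l by auto
  have D_prob: "prob (D y) = 1 / 2 * ((\<Prod>l\<in>L. law k n (y l) x) * (\<Prod>t<n. (1 + x (Suc t) * sgn (S y t)) / 2))"
    if y: "y \<in> L \<rightarrow>\<^sub>E paths n" for y
  proof -
    have "prob (D y) = (\<Prod>l\<in>insert j L. prob ((\<lambda>\<omega>. restrict (\<lambda>i. environment \<omega> i) (K l)) -` B y l \<inter> space M))"
      unfolding D_def by (rule indep_varsD_finite[OF ind]) (use finL B_sets in auto)
    also have "\<dots> = prob ((\<lambda>\<omega>. restrict (\<lambda>i. environment \<omega> i) (K j)) -` B y j \<inter> space M) *
       (\<Prod>l\<in>L. prob ((\<lambda>\<omega>. restrict (\<lambda>i. environment \<omega> i) (K l)) -` B y l \<inter> space M))"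
      using finL jL by simp
    also have "(\<lambda>\<omega>. restrict (\<lambda>i. environment \<omega> i) (K j)) -` B y j \<inter> space M =
       {\<omega> \<in> space M. sign_of (\<sigma> j 0 \<omega>) = x 0 \<and>
         (\<forall>t<n. majority (S y t) (sign_of (\<xi> j t \<omega>)) (x t) = x (Suc t))}"
      using B_j by auto
    also have "(\<Prod>l\<in>L. prob ((\<lambda>\<omega>. restrict (\<lambda>i. environment \<omega> i) (K l)) -` B y l \<inter> space M)) =
       (\<Prod>l\<in>L. law k n (y l) x)"
    proof (intro prod.cong refl)
      fix l assume l: "l \<in> L"
      have "(\<lambda>\<omega>. restrict (\<lambda>i. environment \<omega> i) (K l)) -` B y l \<inter> space M =
         {\<omega> \<in> space M. \<forall>t<n. forced (environment \<omega>) t j l x t = y l t}" using B_l[OF l] by auto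
      then show "prob ((\<lambda>\<omega>. restrict (\<lambda>i. environment \<omega> i) (K l)) -` B y l \<inter> space M) = law k n (y l) x"
        using law[OF l] y l by auto
    qed
    finally show ?thesis by (simp add: own_randomness_prob[OF j x])
  qed
  have D_events: "D y \<in> events" for y
  proof -
    have "(\<lambda>\<omega>. restrict (\<lambda>i. environment \<omega> i) (K l)) -` B y l \<inter> space M \<in> events" if "l \<in> insert j L" for l
      using ind that B_sets[OF that] unfolding indep_vars_def by (auto intro: measurable_sets)
    then show ?thesis unfolding D_def using finL by (intro sets.finite_INT) auto
  qed
  have "{\<omega> \<in> space M. node_path (environment \<omega>) j L u x n} = (\<Union>y\<in>L \<rightarrow>\<^sub>E paths n. D y)"
  proof (intro equalityI subsetI)
    fix \<omega> assume \<omega>: "\<omega> \<in> {\<omega> \<in> space M. node_path (environment \<omega>) j L u x n}"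
    define y where "y = (\<lambda>l\<in>L. \<lambda>t\<in>{..<n}. forced (environment \<omega>) t j l x t)"
    have "y \<in> L \<rightarrow>\<^sub>E paths n" unfolding y_def using forced_cases by (auto simp: paths_iff)
    moreover have "S y t = u t + (\<Sum>l\<in>L. forced (environment \<omega>) t j l x t)" if "t < n" for t
      using that by (simp add: S_def y_def)
    then have "\<omega> \<in> D y" using \<omega> unfolding D_iff by (auto simp: node_path_def y_def)
    ultimately show "\<omega> \<in> (\<Union>y\<in>L \<rightarrow>\<^sub>E paths n. D y)" by blast
  next
    fix \<omega> assume "\<omega> \<in> (\<Union>y\<in>L \<rightarrow>\<^sub>E paths n. D y)"
    then obtain y where "\<omega> \<in> D y" by blast
    then have y: "\<omega> \<in> space M" "sign_of (\<sigma> j 0 \<omega>) = x 0"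
      "\<And>t. t < n \<Longrightarrow> majority (S y t) (sign_of (\<xi> j t \<omega>)) (x t) = x (Suc t)"
      "\<And>l t. l \<in> L \<Longrightarrow> t < n \<Longrightarrow> forced (environment \<omega>) t j l x t = y l t" unfolding D_iff by auto
    have "S y t = u t + (\<Sum>l\<in>L. forced (environment \<omega>) t j l x t)" if "t < n" for t
      using that y(4) by (simp add: S_def)
    then show "\<omega> \<in> {\<omega> \<in> space M. node_path (environment \<omega>) j L u x n}"
      using y by (auto simp: node_path_def)
  qed
  also have "prob \<dots> = (\<Sum>y\<in>L \<rightarrow>\<^sub>E paths n. prob (D y))"
  proof (rule finite_measure_finite_Union)
    show "finite (L \<rightarrow>\<^sub>E paths n)" using finL by (intro finite_PiE) auto
    show "disjoint_family_on D (L \<rightarrow>\<^sub>E paths n)"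
      unfolding disjoint_family_on_def
    proof (intro ballI impI)
      fix y z assume y: "y \<in> L \<rightarrow>\<^sub>E paths n" and z: "z \<in> L \<rightarrow>\<^sub>E paths n" and "y \<noteq> z"
      have "y = z" if "\<omega> \<in> D y" "\<omega> \<in> D z" for \<omega>
      proof (rule PiE_ext[OF y z])
        fix l assume l: "l \<in> L"
        then have "y l \<in> paths n" "z l \<in> paths n" using y z by auto
        moreover have "y l t = z l t" if "t < n" for t
          using \<open>\<omega> \<in> D y\<close> \<open>\<omega> \<in> D z\<close> l that unfolding D_iff by metis
        ultimately show "y l = z l" unfolding paths_def by (intro PiE_ext) auto
      qed
      then show "D y \<inter> D z = {}" using \<open>y \<noteq> z\<close> by blast
    qed
  qed (use D_events in auto)
  also have "\<dots> = (\<Sum>y\<in>L \<rightarrow>\<^sub>E paths n. 1 / 2 * ((\<Prod>l\<in>L. law k n (y l) x) *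
      (\<lambda>g. \<Prod>t<n. (1 + x (Suc t) * sgn (u t + g t)) / 2) (\<lambda>t. \<Sum>l\<in>L. y l t)))"
    by (intro sum.cong refl) (simp only: D_prob S_def)
  also have "\<dots> = 1 / 2 * iid_mean (\<lambda>y. law k n y x) (paths n) (card L)
      (\<lambda>ys. \<Prod>t<n. (1 + x (Suc t) * sgn (u t + psum ys t)) / 2)"
    unfolding sum_distrib_left[symmetric]
    using iid_mean_PiE[OF finL, where A = "paths n" and \<nu> = "\<lambda>y. law k n y x"
        and f = "\<lambda>g. \<Prod>t<n. (1 + x (Suc t) * sgn (u t + g t)) / 2"] by simp
  finally show ?thesis by (simp add: vote_def[abs_def])
qed

lemma forced_prob:
  assumes "adj p j" "x \<in> paths n"
  shows "prob {\<omega> \<in> space M. \<forall>t<n. forced (environment \<omega>) t p j u t = x t} = law k n x u"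
  using assms
proof (induction n arbitrary: p j u x)
  case 0
  then show ?case by (simp add: prob_space)
next
  case (Suc n)
  have j: "j \<in> V" using Suc.prems adj_vertices by blast
  have "p \<in> neighbors adj j" using Suc.prems adj_sym by (simp add: neighbors_def)
  then have "card (neighbors adj j - {p}) = k - 1"
    using finite_neighbors[OF j] regular[OF j] by simp
  then show ?case
    unfolding forced_iff_node_path
    by (subst node_path_prob[OF j _ Suc.prems(2)]) (auto intro!: Suc.IH simp: neighbors_def)
qed

lemma root_path_prob:
  assumes "i \<in> V" "x \<in> paths (Suc n)"
  shows "prob {\<omega> \<in> space M. \<forall>t<Suc n. \<sigma> i t \<omega> = x t} =
    1 / 2 * iid_mean (\<lambda>y. law k n y x) (paths n) k (vote n x (\<lambda>_. 0))"
proof -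
  have "{\<omega> \<in> space M. \<forall>t<Suc n. \<sigma> i t \<omega> = x t} =
      {\<omega> \<in> space M. node_path (environment \<omega>) i (neighbors adj i) (\<lambda>_. 0) x n}"
    using root_path_iff[OF assms(1)] by auto
  then show ?thesis
    using node_path_prob[OF assms(1) order_refl assms(2)] forced_prob regular[OF assms(1)]
    by (simp add: neighbors_def)
qed

text \<open>\<open>law k n x u\<close> is the probability that a vertex forced along an edge of the
  tree follows \<open>x\<close>, and these events partition the space.\<close>

lemma law_total:
  assumes "2 \<le> k"
  shows "(\<Sum>x\<in>paths n. law k n x u) = 1"
proof -
  obtain p where p: "p \<in> V" using infinite_vertices by fastforce
  have "neighbors adj p \<noteq> {}" using regular[OF p] assms by auto
  then obtain j where pj: "adj p j" by (auto simp: neighbors_def)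
  then have j: "j \<in> V" using adj_vertices by blast
  define D where "D = (\<lambda>x. {\<omega> \<in> space M. \<forall>t<n. forced (environment \<omega>) t p j u t = x t})"
  have sub: "env_on (subtree p j) \<subseteq> env_on V" using subtree_vertices j by auto
  have fm: "(\<lambda>\<omega>. forced (environment \<omega>) t p j u t) \<in> borel_measurable M" for t
  proof -
    have "(\<lambda>\<omega>. restrict (environment \<omega>) (env_on V)) \<in> measurable M (PiM (env_on V) (\<lambda>_. borel))"
      using environment_measurable by (intro measurable_restrict) auto
    from measurable_compose[OF this forced_measurable[OF pj sub]]
    have "(\<lambda>\<omega>. forced (restrict (environment \<omega>) (env_on V)) t p j u t) \<in> borel_measurable M" .
    moreover have "forced (restrict (environment \<omega>) (env_on V)) t p j u = forced (environment \<omega>) t p j u" for \<omega>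
      by (rule forced_local[OF pj]) (use sub in auto)
    ultimately show ?thesis by simp
  qed
  have "(\<Sum>x\<in>paths n. law k n x u) = (\<Sum>x\<in>paths n. prob (D x))"
    unfolding D_def using forced_prob[OF pj] by simp
  also have "\<dots> = prob (\<Union>x\<in>paths n. D x)"
  proof (rule finite_measure_finite_Union[symmetric])
    have "D x \<in> events" for x
    proof -
      define g where "g = (\<lambda>t \<omega>. forced (environment \<omega>) t p j u t)"
      have [measurable]: "g t \<in> borel_measurable M" for t using fm[of t] by (simp add: g_def)
      have "{\<omega> \<in> space M. \<forall>t<n. g t \<omega> = x t} \<in> events" by measurable
      then show ?thesis unfolding D_def g_def .
    qed
    then show "D ` paths n \<subseteq> events" by blast
    show "disjoint_family_on D (paths n)"
      unfolding disjoint_family_on_def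
    proof (intro ballI impI)
      fix y z assume y: "y \<in> paths n" and z: "z \<in> paths n" and "y \<noteq> z"
      then obtain t where "t < n" "y t \<noteq> z t" unfolding paths_def by (meson PiE_ext lessThan_iff)
      then show "D y \<inter> D z = {}" by (auto simp: D_def)
    qed
  qed simp
  also have "(\<Union>x\<in>paths n. D x) = space M"
  proof (intro equalityI subsetI)
    fix \<omega> assume "\<omega> \<in> space M"
    then have "\<omega> \<in> D (\<lambda>t\<in>{..<n}. forced (environment \<omega>) t p j u t)" by (simp add: D_def)
    moreover have "(\<lambda>t\<in>{..<n}. forced (environment \<omega>) t p j u t) \<in> paths n"
      using forced_cases by (auto simp: paths_iff)
    ultimately show "\<omega> \<in> (\<Union>x\<in>paths n. D x)" by blast
  qed (auto simp: D_def)
  finally show ?thesis by (simp add: prob_space)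
qed

lemma spin_cases:
  assumes "i \<in> V" "\<omega> \<in> space M"
  shows "\<sigma> i t \<omega> = - 1 \<or> \<sigma> i t \<omega> = 1"
proof (induction t)
  case 0
  then show ?case using initial_values[OF assms] by auto
next
  case (Suc t)
  then show ?case
    using coin_values[OF assms, of t] majority_cases[of "\<xi> i t \<omega>" "\<sigma> i t \<omega>"] assms
    by (auto simp: update majority_def)
qed

lemma spin_measurable:
  assumes "i \<in> V"
  shows "\<sigma> i t \<in> borel_measurable M"
  using assms
proof (induction t arbitrary: i)
  case 0
  then show ?case using environment_measurable[of "Inl i"] by auto
next
  case (Suc t)
  have "\<xi> i t \<in> borel_measurable M" using environment_measurable[of "Inr (i, t)"] Suc.prems by auto
  moreover have "(\<lambda>\<omega>. \<Sum>j\<in>neighbors adj i. \<sigma> j t \<omega>) \<in> borel_measurable M"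
    using Suc.IH adj_vertices by (intro borel_measurable_sum) (auto simp: neighbors_def)
  ultimately have "(\<lambda>\<omega>. if (\<Sum>j\<in>neighbors adj i. \<sigma> j t \<omega>) \<noteq> 0
         then sgn (\<Sum>j\<in>neighbors adj i. \<sigma> j t \<omega>) else \<xi> i t \<omega> * \<sigma> i t \<omega>) \<in> borel_measurable M"
    using Suc.IH[OF Suc.prems] by measurable
  then show ?case by (subst measurable_cong[OF update[OF Suc.prems]])
qed

lemma expectation_spins:
  assumes i: "i \<in> V"
  shows "(\<integral>\<omega>. f (\<lambda>t\<in>{..<n}. \<sigma> i t \<omega>) \<partial>M) =
    (\<Sum>x\<in>paths n. f x * prob {\<omega> \<in> space M. \<forall>t<n. \<sigma> i t \<omega> = x t})"
proof -
  have [measurable]: "\<sigma> i t \<in> borel_measurable M" for t by (rule spin_measurable[OF i])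
  have int: "integrable M (indicat_real {\<omega> \<in> space M. \<forall>t<n. \<sigma> i t \<omega> = x t})" for x :: "nat \<Rightarrow> real"
    by (rule integrable_const_bound[of _ 1]) (auto simp: indicator_def)
  have "(\<integral>\<omega>. f (\<lambda>t\<in>{..<n}. \<sigma> i t \<omega>) \<partial>M) =
     (\<integral>\<omega>. (\<Sum>x\<in>paths n. f x * indicator {\<omega> \<in> space M. \<forall>t<n. \<sigma> i t \<omega> = x t} \<omega>) \<partial>M)"
  proof (intro Bochner_Integration.integral_cong refl)
    fix \<omega> assume \<omega>: "\<omega> \<in> space M"
    let ?y = "\<lambda>t\<in>{..<n}. \<sigma> i t \<omega>"
    have "?y \<in> paths n" using spin_cases[OF i \<omega>] by (auto simp: paths_iff)
    moreover have "f x * indicator {\<omega> \<in> space M. \<forall>t<n. \<sigma> i t \<omega> = x t} \<omega> = (if x = ?y then f x else 0)"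
      if "x \<in> paths n" for x
    proof -
      have "(\<forall>t<n. \<sigma> i t \<omega> = x t) \<longleftrightarrow> x = ?y"
        using that by (auto simp: paths_iff fun_eq_iff restrict_def)
      then show ?thesis using \<omega> by simp
    qed
    ultimately show "f ?y = (\<Sum>x\<in>paths n. f x * indicator {\<omega> \<in> space M. \<forall>t<n. \<sigma> i t \<omega> = x t} \<omega>)"
      by (simp cong: sum.cong)
  qed
  also have "\<dots> = (\<Sum>x\<in>paths n. f x * prob {\<omega> \<in> space M. \<forall>t<n. \<sigma> i t \<omega> = x t})"
    by (subst Bochner_Integration.integral_sum) (auto simp: Int_absorb2 int)
  finally show ?thesis .
qed

end

text \<open>Both path laws are carried by the finite set \<open>paths (Suc T)\<close>, for the
  cavity process up to a null set, so convergence of the single path probabilities suffices. Tree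
  and vertex may change with \<open>k\<close>, as the probabilities on the tree depend on
  \<open>k\<close> alone.\<close>

theorem theorem2p7:
  fixes V :: "nat \<Rightarrow> 'v set" and adj :: "nat \<Rightarrow> 'v \<Rightarrow> 'v \<Rightarrow> bool"
    and M :: "nat \<Rightarrow> 'w measure"
    and \<sigma> :: "nat \<Rightarrow> 'v \<Rightarrow> nat \<Rightarrow> 'w \<Rightarrow> real" and \<xi> :: "nat \<Rightarrow> 'v \<Rightarrow> nat \<Rightarrow> 'w \<Rightarrow> real"
    and i :: "nat \<Rightarrow> 'v"
    and N :: "'u measure" and \<tau>\<^sub>0 :: "'u \<Rightarrow> real" and \<eta> :: "nat \<Rightarrow> 'u \<Rightarrow> real"
    and C R :: "nat \<Rightarrow> nat \<Rightarrow> real" and T :: nat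
  assumes "\<And>k. k \<ge> 2 \<Longrightarrow> regular_tree k (V k) (adj k)"
    and "\<And>k. k \<ge> 2 \<Longrightarrow> majority_process (V k) (adj k) 0 (M k) (\<sigma> k) (\<xi> k)"
    and "\<And>k. k \<ge> 2 \<Longrightarrow> i k \<in> V k"
    and "cavity_process N \<tau>\<^sub>0 \<eta> C R"
  shows "converges_in_distribution
           M (\<lambda>k \<omega>. \<lambda>t\<in>{..T}. \<sigma> k (i k) t \<omega>)
           N (\<lambda>\<omega>. \<lambda>t\<in>{..T}. effective_process.\<tau> \<tau>\<^sub>0 \<eta> R (\<lambda>_. 0) t \<omega>)"
proof -
  interpret cavity_process N \<tau>\<^sub>0 \<eta> C R by fact
  have tree: "tree_majority k (V k) (adj k) (M k) (\<sigma> k) (\<xi> k)" if "2 \<le> k" for k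
    using assms(1,2)[OF that] by (simp add: tree_majority_def)
  have total: "(\<Sum>x\<in>paths n. law k n x u) = 1" if "2 \<le> k" for k n u
    using tree_majority.law_total[OF tree[OF that] that] .
  show ?thesis
    unfolding converges_in_distribution_def
  proof (intro allI impI)
    fix f :: "(nat \<Rightarrow> real) \<Rightarrow> real" assume f: "continuous_on UNIV f"
    have set_eq: "{..T} = {..<Suc T}" by auto
    have "(\<lambda>k. \<Sum>x\<in>paths (Suc T). f x * (1 / 2 * iid_mean (\<lambda>y. law k T y x) (paths T) k (vote T x (\<lambda>_. 0))))
        \<longlonglongrightarrow> (\<Sum>x\<in>paths (Suc T). f x * path_prob (Suc T) x (\<lambda>_. 0))"
      by (intro tendsto_sum tendsto_mult tendsto_const root_limit total)
    also have "(\<Sum>x\<in>paths (Suc T). f x * path_prob (Suc T) x (\<lambda>_. 0)) =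
        (\<integral>\<omega>. f (\<lambda>t\<in>{..T}. \<tau> (\<lambda>_. 0) t \<omega>) \<partial>N)"
      unfolding set_eq
    proof (rule expectation_path[symmetric])
      have "(\<lambda>\<omega>. \<lambda>t\<in>{..<Suc T}. \<tau> (\<lambda>_. 0) t \<omega>) \<in> borel_measurable N"
        by (rule measurable_coordinatewise_then_product) (simp add: restrict_def)
      then show "(\<lambda>\<omega>. f (\<lambda>t\<in>{..<Suc T}. \<tau> (\<lambda>_. 0) t \<omega>)) \<in> borel_measurable N"
        by (rule borel_measurable_continuous_on[OF f])
    qed
    finally show "(\<lambda>k. \<integral>\<omega>. f (\<lambda>t\<in>{..T}. \<sigma> k (i k) t \<omega>) \<partial>M k) \<longlonglongrightarrow>
        (\<integral>\<omega>. f (\<lambda>t\<in>{..T}. \<tau> (\<lambda>_. 0) t \<omega>) \<partial>N)"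
    proof (rule Lim_transform_eventually)
      show "\<forall>\<^sub>F k in sequentially.
          (\<Sum>x\<in>paths (Suc T). f x * (1 / 2 * iid_mean (\<lambda>y. law k T y x) (paths T) k (vote T x (\<lambda>_. 0)))) =
          (\<integral>\<omega>. f (\<lambda>t\<in>{..T}. \<sigma> k (i k) t \<omega>) \<partial>M k)"
        using eventually_ge_at_top[of 2]
      proof eventually_elim
        case (elim k)
        interpret t: tree_majority k "V k" "adj k" "M k" "\<sigma> k" "\<xi> k" by (rule tree[OF elim])
        show ?case
          unfolding set_eq t.expectation_spins[OF assms(3)[OF elim]]
          by (intro sum.cong refl) (simp only: t.root_path_prob[OF assms(3)[OF elim]])
      qed
    qed
  qed
qed

end
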